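(* Fix rational numbers $\beta,\gamma$ such that $\beta\neq\gamma$ and $|\beta+\gamma|>2$. For any positive integer $\Delta$, there is a fully polynomial-time (deterministic) approximation scheme (FPTAS) for $Z_G$, where the input graph $G$ has maximum degree at most $\Delta$. Without the bounded degree requirement, there is a quasi-polynomial time approximation scheme for $Z_G$.
   Context: Graphs are finite undirected multigraphs, possibly with self-loops and parallel edges. For fixed $\beta,\gamma$, let $A=\begin{bmatrix}\beta&1\\1&\gamma\end{bmatrix}$ and for a graph $G=(V,E)$ define $Z_G=\sum_{\sigma\in\{0,1\}^V}\prod_{\{u,v\}\in E}A_{\sigma(u),\sigma(v)}$. *)

theory Defs
  imports
    Complex_Main
    "HOL-Library.Multiset"
    "HOL-Library.FuncSet"
    "HOL-Library.Uprod"
begin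

record 'a multigraph =
  verts :: "'a set"
  edges :: "'a uprod multiset"

definition wf_multigraph :: "'a multigraph \<Rightarrow> bool" where
  "wf_multigraph G \<longleftrightarrow>
     finite (verts G) \<and> (\<forall>e \<in># edges G. set_uprod e \<subseteq> verts G)"

text \<open>A self-loop contributes 2 to the degree of its vertex.\<close>

definition vertex_degree :: "'a multigraph \<Rightarrow> 'a \<Rightarrow> nat" where
  "vertex_degree G v =
     size {#e \<in># edges G. v \<in> set_uprod e#} + size {#e \<in># edges G. e = Upair v v#}"

definition max_degree_le :: "'a multigraph \<Rightarrow> nat \<Rightarrow> bool" where
  "max_degree_le G \<Delta> \<longleftrightarrow> (\<forall>v \<in> verts G. vertex_degree G v \<le> \<Delta>)"

definition interaction :: "rat \<Rightarrow> rat \<Rightarrow> nat \<Rightarrow> nat \<Rightarrow> rat" where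
  "interaction \<beta> \<gamma> i j =
     (if i = 0 \<and> j = 0 then \<beta> else if i = 1 \<and> j = 1 then \<gamma> else 1)"

lift_definition edge_weight :: "rat \<Rightarrow> rat \<Rightarrow> ('a \<Rightarrow> nat) \<Rightarrow> 'a uprod \<Rightarrow> rat" is
  "\<lambda>\<beta> \<gamma> \<sigma> (u, v). interaction \<beta> \<gamma> (\<sigma> u) (\<sigma> v)"
  by (auto simp: interaction_def)

lemma edge_weight_Upair [simp]:
  "edge_weight \<beta> \<gamma> \<sigma> (Upair u v) = interaction \<beta> \<gamma> (\<sigma> u) (\<sigma> v)"
  by transfer simp

definition partition_function :: "rat \<Rightarrow> rat \<Rightarrow> 'a multigraph \<Rightarrow> rat" where
  "partition_function \<beta> \<gamma> G =
     (\<Sum>\<sigma> \<in> verts G \<rightarrow>\<^sub>E {0, 1}. \<Prod>e \<in># edges G. edge_weight \<beta> \<gamma> \<sigma> e)"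

text \<open>
  Algorithms are programs of a first-order, call-by-value functional language whose only data are
  binary trees over a single atom (as in Jones's languages F and WHILE).  A program is a list of
  function bodies, called by position; function 0 is the entry point, and variables are de Bruijn
  indices into the current environment.  Every evaluation rule costs one step.  No rule copies or
  compares trees, so with trees represented by shared pointers one step is a constant number of
  machine operations, and running times agree with those of Turing machines up to a polynomial.
\<close>

datatype data = Atom | Cell data data

fun cells :: "data \<Rightarrow> nat" where
  "cells Atom = 0"
| "cells (Cell x y) = Suc (cells x + cells y)"

fun left :: "data \<Rightarrow> data" where
  "left Atom = Atom"
| "left (Cell x y) = x"

fun right :: "data \<Rightarrow> data" where
  "right Atom = Atom"
| "right (Cell x y) = y"

datatype expr =
    Var nat
  | Nil_E
  | Cons_E expr expr
  | Hd_E expr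
  | Tl_E expr
  | If_E expr expr expr
  | Let_E expr expr
  | Call_E nat "expr list"

type_synonym program = "expr list"

inductive
  eval :: "program \<Rightarrow> data list \<Rightarrow> expr \<Rightarrow> nat \<Rightarrow> data \<Rightarrow> bool" and
  evals :: "program \<Rightarrow> data list \<Rightarrow> expr list \<Rightarrow> nat \<Rightarrow> data list \<Rightarrow> bool"
  for p :: program
where
  eval_Var: "i < length env \<Longrightarrow> eval p env (Var i) 1 (env ! i)"
| eval_Nil: "eval p env Nil_E 1 Atom"
| eval_Cons: "eval p env a s x \<Longrightarrow> eval p env b t y \<Longrightarrow>
    eval p env (Cons_E a b) (s + t + 1) (Cell x y)"
| eval_Hd: "eval p env a t x \<Longrightarrow> eval p env (Hd_E a) (t + 1) (left x)"
| eval_Tl: "eval p env a t x \<Longrightarrow> eval p env (Tl_E a) (t + 1) (right x)"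
| eval_If_true: "eval p env c s x \<Longrightarrow> x \<noteq> Atom \<Longrightarrow> eval p env a t y \<Longrightarrow>
    eval p env (If_E c a b) (s + t + 1) y"
| eval_If_false: "eval p env c s Atom \<Longrightarrow> eval p env b t y \<Longrightarrow>
    eval p env (If_E c a b) (s + t + 1) y"
| eval_Let: "eval p env a s x \<Longrightarrow> eval p (x # env) b t y \<Longrightarrow>
    eval p env (Let_E a b) (s + t + 1) y"
| eval_Call: "evals p env as s xs \<Longrightarrow> f < length p \<Longrightarrow> eval p xs (p ! f) t y \<Longrightarrow>
    eval p env (Call_E f as) (s + t + 1) y"
| evals_Nil: "evals p env [] 0 []"
| evals_Cons: "eval p env a s x \<Longrightarrow> evals p env as t xs \<Longrightarrow>
    evals p env (a # as) (s + t) (x # xs)"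

definition runs :: "program \<Rightarrow> data \<Rightarrow> nat \<Rightarrow> data \<Rightarrow> bool" where
  "runs p x t y \<longleftrightarrow> p \<noteq> [] \<and> eval p [x] (p ! 0) t y"

inductive_cases eval_VarE: "eval p env (Var i) t y"
inductive_cases eval_NilE: "eval p env Nil_E t y"
inductive_cases eval_ConsE: "eval p env (Cons_E a b) t y"
inductive_cases eval_HdE: "eval p env (Hd_E a) t y"
inductive_cases eval_TlE: "eval p env (Tl_E a) t y"
inductive_cases eval_IfE: "eval p env (If_E c a b) t y"
inductive_cases eval_LetE: "eval p env (Let_E a b) t y"
inductive_cases eval_CallE: "eval p env (Call_E f as) t y"
inductive_cases evals_NilE: "evals p env [] t ys"
inductive_cases evals_ConsE: "evals p env (a # as) t ys"

lemma eval_deterministic: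
  "eval p env e t y \<Longrightarrow> eval p env e t' y' \<Longrightarrow> t = t' \<and> y = y'"
  "evals p env es t ys \<Longrightarrow> evals p env es t' ys' \<Longrightarrow> t = t' \<and> ys = ys'"
proof (induction arbitrary: t' y' and t' ys' rule: eval_evals.inducts)
  case (eval_Var i env)
  from eval_Var.prems show ?case by (rule eval_VarE) simp
next
  case (eval_Nil env)
  from eval_Nil.prems show ?case by (rule eval_NilE) simp
next
  case (eval_Cons env a s x b t y)
  from eval_Cons.prems show ?case
  proof (rule eval_ConsE)
    fix s2 x2 t2 y2
    assume *: "t' = Suc (s2 + t2)" "y' = Cell x2 y2" "eval p env a s2 x2" "eval p env b t2 y2"
    from eval_Cons.IH(2)[OF *(3)] eval_Cons.IH(4)[OF *(4)] *(1,2) show ?thesis by simp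
  qed
next
  case (eval_Hd env a t x)
  from eval_Hd.prems show ?case
  proof (rule eval_HdE)
    fix t2 x2
    assume *: "t' = Suc t2" "y' = left x2" "eval p env a t2 x2"
    from eval_Hd.IH(2)[OF *(3)] *(1,2) show ?thesis by simp
  qed
next
  case (eval_Tl env a t x)
  from eval_Tl.prems show ?case
  proof (rule eval_TlE)
    fix t2 x2
    assume *: "t' = Suc t2" "y' = right x2" "eval p env a t2 x2"
    from eval_Tl.IH(2)[OF *(3)] *(1,2) show ?thesis by simp
  qed
next
  case (eval_If_true env c s x a t y b)
  from eval_If_true.prems show ?case
  proof (rule eval_IfE)
    fix s2 x2 t2
    assume *: "t' = Suc (s2 + t2)" "eval p env c s2 x2" "eval p env a t2 y'"
    from eval_If_true.IH(2)[OF *(2)] eval_If_true.IH(4)[OF *(3)] *(1) show ?thesis by simp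
  next
    fix s2 t2
    assume "eval p env c s2 Atom"
    from eval_If_true.IH(2)[OF this] eval_If_true.hyps show ?thesis by simp
  qed
next
  case (eval_If_false env c s b t y a)
  from eval_If_false.prems show ?case
  proof (rule eval_IfE)
    fix s2 x2 t2
    assume "eval p env c s2 x2" "x2 \<noteq> Atom"
    from eval_If_false.IH(2)[OF this(1)] this(2) show ?thesis by simp
  next
    fix s2 t2
    assume *: "t' = Suc (s2 + t2)" "eval p env c s2 Atom" "eval p env b t2 y'"
    from eval_If_false.IH(2)[OF *(2)] eval_If_false.IH(4)[OF *(3)] *(1) show ?thesis by simp
  qed
next
  case (eval_Let env a s x b t y)
  from eval_Let.prems show ?case
  proof (rule eval_LetE)
    fix s2 x2 t2
    assume *: "t' = Suc (s2 + t2)" "eval p env a s2 x2" "eval p (x2 # env) b t2 y'"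
    from eval_Let.IH(2)[OF *(2)] have "s = s2" "x = x2" by simp_all
    with eval_Let.IH(4) * show ?thesis by simp
  qed
next
  case (eval_Call env as s xs f t y)
  from eval_Call.prems show ?case
  proof (rule eval_CallE)
    fix s2 xs2 t2
    assume *: "t' = Suc (s2 + t2)" "evals p env as s2 xs2" "eval p xs2 (p ! f) t2 y'"
    from eval_Call.IH(2)[OF *(2)] have "s = s2" "xs = xs2" by simp_all
    with eval_Call.IH(5) * show ?thesis by simp
  qed
next
  case (evals_Nil env)
  from evals_Nil.prems show ?case by (rule evals_NilE) simp
next
  case (evals_Cons env a s x as t xs)
  from evals_Cons.prems show ?case
  proof (rule evals_ConsE)
    fix s2 x2 t2 xs2
    assume *: "t' = s2 + t2" "ys' = x2 # xs2" "eval p env a s2 x2" "evals p env as t2 xs2"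
    from evals_Cons.IH(2)[OF *(3)] evals_Cons.IH(4)[OF *(4)] *(1,2) show ?thesis by simp
  qed
qed

lemma runs_deterministic: "runs p x t y \<Longrightarrow> runs p x t' y' \<Longrightarrow> t = t' \<and> y = y'"
  unfolding runs_def using eval_deterministic(1) by blast

definition bool_code :: "bool \<Rightarrow> data" where
  "bool_code b = (if b then Cell Atom Atom else Atom)"

definition list_code :: "('a \<Rightarrow> data) \<Rightarrow> 'a list \<Rightarrow> data" where
  "list_code c xs = foldr (\<lambda>x. Cell (c x)) xs Atom"

fun bits :: "nat \<Rightarrow> bool list" where
  "bits n = (if n = 0 then [] else odd n # bits (n div 2))"

declare bits.simps [simp del]

definition nat_code :: "nat \<Rightarrow> data" where
  "nat_code n = list_code bool_code (bits n)"

definition int_code :: "int \<Rightarrow> data" where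
  "int_code i = Cell (bool_code (i < 0)) (nat_code (nat \<bar>i\<bar>))"

text \<open>
  A rational number may be presented by any fraction with positive denominator, and a graph by any
  enumeration of its vertices and edges; hence these encodings are relations.
\<close>

definition encodes_rat :: "rat \<Rightarrow> data \<Rightarrow> bool" where
  "encodes_rat q x \<longleftrightarrow>
     (\<exists>a b. b > 0 \<and> q = of_int a / of_nat b \<and> x = Cell (int_code a) (nat_code b))"

definition encodes_graph :: "nat multigraph \<Rightarrow> data \<Rightarrow> bool" where
  "encodes_graph G x \<longleftrightarrow>
     (\<exists>vs es. distinct vs \<and> set vs = verts G \<and>
        mset (map (\<lambda>(u, v). Upair u v) es) = edges G \<and>
        x = Cell (list_code nat_code vs)
                 (list_code (\<lambda>(u, v). Cell (nat_code u) (nat_code v)) es))"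

definition approximates_within ::
    "program \<Rightarrow> (nat multigraph \<Rightarrow> rat) \<Rightarrow> nat multigraph set \<Rightarrow> (nat \<Rightarrow> real \<Rightarrow> real) \<Rightarrow> bool"
where
  "approximates_within p F \<G> T \<longleftrightarrow>
     (\<forall>G \<in> \<G>. \<forall>\<epsilon> > 0. \<forall>g r. encodes_graph G g \<longrightarrow> encodes_rat \<epsilon> r \<longrightarrow>
        (\<exists>t y z. runs p (Cell g r) t y \<and>
           real t \<le> T (cells (Cell g r)) (1 / of_rat \<epsilon>) \<and>
           encodes_rat z y \<and> \<bar>z - F G\<bar> \<le> \<epsilon> * \<bar>F G\<bar>))"

text \<open>
  The size \<open>n\<close> of the whole input (graph and accuracy) and the inverse accuracy \<open>s\<close> satisfy
  \<open>n + s > 1\<close>, so \<open>c * (n + s) ^ k\<close> majorizes every polynomial in \<open>n\<close> and \<open>s\<close>.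
\<close>

definition has_FPTAS :: "(nat multigraph \<Rightarrow> rat) \<Rightarrow> nat multigraph set \<Rightarrow> bool" where
  "has_FPTAS F \<G> \<longleftrightarrow>
     (\<exists>p c k. approximates_within p F \<G> (\<lambda>n s. c * (real n + s) ^ k))"

definition has_QPTAS :: "(nat multigraph \<Rightarrow> rat) \<Rightarrow> nat multigraph set \<Rightarrow> bool" where
  "has_QPTAS F \<G> \<longleftrightarrow>
     (\<exists>p c k. approximates_within p F \<G> (\<lambda>n s. 2 powr (c * log 2 (real n + s) ^ k)))"

end

theory Submission
  imports Defs "HOL-Library.Log_Nat" "HOL-Complex_Analysis.Complex_Analysis"
begin

text \<open>
  Flipping all spins exchanges \<open>\<beta>\<close> and \<open>\<gamma>\<close>, so assume \<open>\<bar>\<beta>\<bar> > \<bar>\<gamma>\<bar>\<close>.  Attach a variable \<open>x\<close> to every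
  half-edge whose endpoint has spin 1, so that the edge weights become \<open>\<beta>, x, x, \<gamma> x\<^sup>2\<close>.  Since
  \<open>\<bar>\<beta> + \<gamma>\<bar> > 2\<close>, the polynomial \<open>\<beta> + a + b + \<gamma> a b\<close> has no zero with \<open>\<bar>a\<bar>, \<bar>b\<bar> \<le> \<rho>\<close> for some
  \<open>\<rho> > 1\<close>, and Asano contractions carry this over to all graphs: every ratio
  \<open>R\<^sub>v = Z[\<sigma>(v) = 1] / Z[\<sigma>(v) = 0]\<close>, with any set of vertices pinned to 0, is holomorphic and bounded
  by 1 in the disc \<open>\<bar>x\<bar> < \<rho>\<close>.  Pinning the vertices to 0 one after the other gives
  \<open>Z = \<beta>\<^bsup>|E|\<^esup> \<Prod> (1 + R\<^sub>v)\<close>, where by Cauchy's estimate each \<open>R\<^sub>v(1)\<close> may be replaced by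
  a partial sum of its Taylor series of length \<open>O(log (n / \<epsilon>))\<close>.

  The Taylor coefficients come from a recursion in the style of Weitz, run on power series instead of
  numbers: splitting \<open>v\<close> into one copy per incident edge shows that \<open>R\<^sub>v\<close> is a product of factors
  \<open>x (1 + \<gamma> x R\<^sub>u) / (\<beta> + x R\<^sub>u)\<close>, where \<open>R\<^sub>u\<close> refers to the graph without \<open>v\<close> and with some neighbours
  of \<open>v\<close> pinned (to 0 or to 1, which is harmless for formal series).  As each factor gains a power of
  \<open>x\<close>, the first \<open>k\<close> coefficients need recursion depth \<open>k\<close> only, hence \<open>\<Delta>\<^sup>k\<close> calls: polynomially many
  for bounded degree and quasi-polynomially many in general.
\<close>

section \<open>Sums over subsets\<close>

lemma sum_Pow_insert:
  assumes "finite W" "v \<notin> W"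
  shows "(\<Sum>T\<in>Pow (insert v W). f T) = (\<Sum>T\<in>Pow W. f T) + (\<Sum>T\<in>Pow W. f (insert v T))"
proof -
  have "inj_on (insert v) (Pow W)"
    using assms(2) by (auto simp: inj_on_def)
  moreover have "Pow W \<inter> insert v ` Pow W = {}"
    using assms(2) by auto
  ultimately show ?thesis
    using assms(1) by (simp add: Pow_insert sum.union_disjoint sum.reindex)
qed

definition multiaffine :: "('a set \<Rightarrow> 'b::comm_semiring_1) \<Rightarrow> 'a set \<Rightarrow> ('a \<Rightarrow> 'b) \<Rightarrow> 'b" where
  "multiaffine f W z = (\<Sum>T\<in>Pow W. f T * prod z T)"

lemma multiaffine_cong:
  assumes "\<And>T. T \<subseteq> W \<Longrightarrow> f T = g T" and "\<And>w. w \<in> W \<Longrightarrow> z w = z' w"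
  shows "multiaffine f W z = multiaffine g W z'"
  unfolding multiaffine_def
proof (rule sum.cong[OF refl])
  fix T assume "T \<in> Pow W"
  then have "f T = g T" "prod z T = prod z' T"
    using assms by (auto intro: prod.cong)
  then show "f T * prod z T = g T * prod z' T"
    by simp
qed

lemma multiaffine_scale_coeff: "multiaffine (\<lambda>T. c * f T) W z = c * multiaffine f W z"
  by (simp add: multiaffine_def sum_distrib_left mult.assoc)

lemma multiaffine_scale_var:
  assumes "finite W"
  shows "multiaffine f W (z(v := c * z v)) = multiaffine (\<lambda>T. (if v \<in> T then c else 1) * f T) W z"
  unfolding multiaffine_def
proof (rule sum.cong[OF refl])
  fix T assume "T \<in> Pow W"
  then have "finite T"
    using assms finite_subset by auto
  have "prod (z(v := c * z v)) T = (\<Prod>w\<in>T. (if w = v then c else 1) * z w)"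
    by (intro prod.cong) auto
  also have "\<dots> = (if v \<in> T then c else 1) * prod z T"
    using \<open>finite T\<close> by (simp add: prod.distrib prod.delta)
  finally show "f T * prod (z(v := c * z v)) T = (if v \<in> T then c else 1) * f T * prod z T"
    by (simp add: ac_simps)
qed

lemma multiaffine_insert:
  assumes "finite W" "u \<notin> W"
  shows "multiaffine f (insert u W) z = multiaffine f W z + multiaffine (\<lambda>T. f (insert u T)) W z * z u"
proof -
  have "f (insert u T) * prod z (insert u T) = f (insert u T) * prod z T * z u" if "T \<in> Pow W" for T
    using that assms by (subst prod.insert) (auto intro: finite_subset simp: ac_simps)
  then show ?thesis
    by (simp add: multiaffine_def sum_Pow_insert[OF assms] sum_distrib_right)
qed

lemma multiaffine_insert2:
  assumes "finite W" "u \<notin> W" "v \<notin> W" "u \<noteq> v"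
  shows "multiaffine f (insert u (insert v W)) z =
    multiaffine f W z + multiaffine (\<lambda>T. f (insert u T)) W z * z u
      + multiaffine (\<lambda>T. f (insert v T)) W z * z v
      + multiaffine (\<lambda>T. f (insert u (insert v T))) W z * z u * z v"
  using assms by (simp add: multiaffine_insert algebra_simps)

lemma multiaffine_one: "finite W \<Longrightarrow> multiaffine (\<lambda>_. 1) W z = (\<Prod>v\<in>W. z v + 1)"
  by (simp add: multiaffine_def prod_add)

section \<open>Asano contractions\<close>

lemma cmod_less_if_affine_nonzero:
  assumes "\<And>a. cmod a \<le> 1 \<Longrightarrow> p + q * a \<noteq> 0"
  shows "cmod q < cmod p"
proof (rule ccontr)
  assume "\<not> cmod q < cmod p"
  moreover have "p \<noteq> 0"
    using assms[of 0] by simp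
  ultimately have "q \<noteq> 0" "cmod (- p / q) \<le> 1"
    by (auto simp: norm_divide divide_le_eq_1)
  then show False
    using assms[of "- p / q"] by simp
qed

lemma add_nonzero_if_cmod_less: "cmod q < cmod p \<Longrightarrow> p + q \<noteq> 0"
  by (metis add_eq_0_iff norm_minus_cancel order_less_irrefl)

definition bidisc_nonzero :: "complex \<Rightarrow> complex \<Rightarrow> complex \<Rightarrow> complex \<Rightarrow> bool" where
  "bidisc_nonzero p q r s \<longleftrightarrow>
     (\<forall>a b. cmod a \<le> 1 \<longrightarrow> cmod b \<le> 1 \<longrightarrow> p + q * a + r * b + s * a * b \<noteq> 0)"

lemma bidisc_nonzero_commute: "bidisc_nonzero p q r s \<longleftrightarrow> bidisc_nonzero p r q s"
proof -
  have "p + q * a + r * b + s * a * b = p + r * b + q * a + s * b * a" for a b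
    by simp
  then show ?thesis
    unfolding bidisc_nonzero_def by metis
qed

lemma bidisc_nonzero_slice:
  assumes "bidisc_nonzero p q r s" "cmod b \<le> 1"
  shows "cmod (q + s * b) < cmod (p + r * b)"
proof (rule cmod_less_if_affine_nonzero)
  fix a :: complex assume "cmod a \<le> 1"
  then have "p + q * a + r * b + s * a * b \<noteq> 0"
    using assms by (simp add: bidisc_nonzero_def)
  then show "p + r * b + (q + s * b) * a \<noteq> 0"
    by (simp add: algebra_simps)
qed

lemma cmod_parallelogram: "(cmod (x + y))\<^sup>2 + (cmod (x - y))\<^sup>2 = 2 * (cmod x)\<^sup>2 + 2 * (cmod y)\<^sup>2"
  unfolding cmod_power2 by (simp add: power2_eq_square algebra_simps)

lemma bidisc_nonzero_cmod_less:
  assumes "bidisc_nonzero p q r s"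
  shows "cmod s < cmod p"
proof -
  have half: "2 * (cmod q)\<^sup>2 + 2 * (cmod s)\<^sup>2 < 2 * (cmod p)\<^sup>2 + 2 * (cmod r)\<^sup>2"
    if "bidisc_nonzero p q r s" for q r
  proof -
    have "(cmod (q + s))\<^sup>2 < (cmod (p + r))\<^sup>2"
      using bidisc_nonzero_slice[OF that, of 1] by (intro power_strict_mono) auto
    moreover have "(cmod (q - s))\<^sup>2 < (cmod (p - r))\<^sup>2"
      using bidisc_nonzero_slice[OF that, of "- 1"] by (intro power_strict_mono) auto
    ultimately show ?thesis
      using cmod_parallelogram[of q s] cmod_parallelogram[of p r] by linarith
  qed
  have "(cmod s)\<^sup>2 < (cmod p)\<^sup>2"
    using half[OF assms] half[OF assms[unfolded bidisc_nonzero_commute[of p q]]] by argo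
  then show ?thesis
    by (rule power_less_imp_less_base) simp
qed

text \<open>
  The contraction to \<open>p\<^sub>1 p\<^sub>2 + q\<^sub>1 q\<^sub>2 + r\<^sub>1 r\<^sub>2 + s\<^sub>1 s\<^sub>2\<close> is carried out one variable
  at a time.
\<close>

lemma bidisc_nonzero_contract_left:
  assumes "bidisc_nonzero p\<^sub>1 q\<^sub>1 r\<^sub>1 s\<^sub>1" "bidisc_nonzero p\<^sub>2 q\<^sub>2 r\<^sub>2 s\<^sub>2"
  shows "bidisc_nonzero (p\<^sub>1 * p\<^sub>2 + q\<^sub>1 * q\<^sub>2) (r\<^sub>1 * p\<^sub>2 + s\<^sub>1 * q\<^sub>2)
    (p\<^sub>1 * r\<^sub>2 + q\<^sub>1 * s\<^sub>2) (r\<^sub>1 * r\<^sub>2 + s\<^sub>1 * s\<^sub>2)"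
  unfolding bidisc_nonzero_def
proof (intro allI impI)
  fix a b :: complex assume "cmod a \<le> 1" "cmod b \<le> 1"
  then have "cmod ((q\<^sub>1 + s\<^sub>1 * a) * (q\<^sub>2 + s\<^sub>2 * b)) < cmod ((p\<^sub>1 + r\<^sub>1 * a) * (p\<^sub>2 + r\<^sub>2 * b))"
    unfolding norm_mult using assms by (intro mult_strict_mono' bidisc_nonzero_slice) auto
  then have "(p\<^sub>1 + r\<^sub>1 * a) * (p\<^sub>2 + r\<^sub>2 * b) + (q\<^sub>1 + s\<^sub>1 * a) * (q\<^sub>2 + s\<^sub>2 * b) \<noteq> 0"
    by (rule add_nonzero_if_cmod_less)
  then show "p\<^sub>1 * p\<^sub>2 + q\<^sub>1 * q\<^sub>2 + (r\<^sub>1 * p\<^sub>2 + s\<^sub>1 * q\<^sub>2) * a + (p\<^sub>1 * r\<^sub>2 + q\<^sub>1 * s\<^sub>2) * b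
      + (r\<^sub>1 * r\<^sub>2 + s\<^sub>1 * s\<^sub>2) * a * b \<noteq> 0"
    by (simp add: algebra_simps)
qed

lemma bidisc_nonzero_contract:
  assumes "bidisc_nonzero p\<^sub>1 q\<^sub>1 r\<^sub>1 s\<^sub>1" "bidisc_nonzero p\<^sub>2 q\<^sub>2 r\<^sub>2 s\<^sub>2"
  shows "p\<^sub>1 * p\<^sub>2 + q\<^sub>1 * q\<^sub>2 + r\<^sub>1 * r\<^sub>2 + s\<^sub>1 * s\<^sub>2 \<noteq> 0"
  using add_nonzero_if_cmod_less[OF bidisc_nonzero_cmod_less[OF bidisc_nonzero_contract_left[OF assms]]]
  by (simp add: add.assoc)

definition zero_free :: "('a set \<Rightarrow> complex) \<Rightarrow> 'a set \<Rightarrow> ('a \<Rightarrow> complex set) \<Rightarrow> bool" where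
  "zero_free f W S \<longleftrightarrow> (\<forall>z. (\<forall>w\<in>W. z w \<in> S w) \<longrightarrow> multiaffine f W z \<noteq> 0)"

lemma zero_freeD: "zero_free f W S \<Longrightarrow> (\<And>w. w \<in> W \<Longrightarrow> z w \<in> S w) \<Longrightarrow> multiaffine f W z \<noteq> 0"
  by (simp add: zero_free_def)

lemma zero_free_subset:
  assumes "zero_free f V S" "W \<subseteq> V" "finite V" "\<And>w. w \<in> V - W \<Longrightarrow> 0 \<in> S w"
  shows "zero_free f W S"
  unfolding zero_free_def
proof (intro allI impI)
  fix z assume z_in_S: "\<forall>w\<in>W. z w \<in> S w"
  define z' where "z' w = (if w \<in> W then z w else 0)" for w
  have "multiaffine f V z' = multiaffine f W z'"
    unfolding multiaffine_def
  proof (rule sum.mono_neutral_right)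
    show "\<forall>T\<in>Pow V - Pow W. f T * prod z' T = 0"
      using assms(3) by (auto simp: z'_def intro!: prod_zero intro: finite_subset)
  qed (use assms in auto)
  also have "\<dots> = multiaffine f W z"
    by (rule multiaffine_cong) (auto simp: z'_def)
  finally show "multiaffine f W z \<noteq> 0"
    using zero_freeD[OF assms(1), of z'] z_in_S assms(4) by (auto simp: z'_def)
qed

lemma zero_free_one: "finite W \<Longrightarrow> zero_free (\<lambda>_. 1) W (\<lambda>_. - {- 1})"
  by (auto simp: zero_free_def multiaffine_one add_eq_0_iff2)

lemma zero_free_loop:
  assumes "finite W" "v \<in> W" "zero_free f W S" "ball 0 r \<subseteq> S v" "0 < t" "cmod \<gamma> * t < cmod \<beta>"
  shows "zero_free (\<lambda>T. (if v \<in> T then \<gamma> else \<beta>) * f T) W (S(v := ball 0 (r * t)))"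
  unfolding zero_free_def
proof (intro allI impI)
  have "0 \<le> cmod \<gamma> * t"
    using assms(5) by simp
  then have "\<beta> \<noteq> 0"
    using assms(6) by auto
  fix z assume z_in_S: "\<forall>w\<in>W. z w \<in> (S(v := ball 0 (r * t))) w"
  then have z_v_less: "cmod (z v) < r * t"
    using assms(2) by (auto dest: bspec[of _ _ v])
  have "cmod (\<gamma> / \<beta> * z v) \<le> cmod (z v) / t"
    using \<open>\<beta> \<noteq> 0\<close> assms(5) mult_right_mono[OF less_imp_le[OF assms(6)], of "cmod (z v)"]
    by (simp add: norm_mult norm_divide field_simps)
  also have "\<dots> < r"
    using z_v_less assms(5) by (simp add: divide_less_eq)
  finally have "multiaffine f W (z(v := \<gamma> / \<beta> * z v)) \<noteq> 0"
    using z_in_S assms(4) by (intro zero_freeD[OF assms(3)]) auto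
  moreover have "multiaffine (\<lambda>T. (if v \<in> T then \<gamma> else \<beta>) * f T) W z
      = \<beta> * multiaffine f W (z(v := \<gamma> / \<beta> * z v))"
    unfolding multiaffine_scale_var[OF assms(1)] multiaffine_scale_coeff[symmetric]
    using \<open>\<beta> \<noteq> 0\<close> by (intro multiaffine_cong) auto
  ultimately show "multiaffine (\<lambda>T. (if v \<in> T then \<gamma> else \<beta>) * f T) W z \<noteq> 0"
    using \<open>\<beta> \<noteq> 0\<close> by simp
qed

fun spin_weight :: "'b \<Rightarrow> 'b \<Rightarrow> 'a set \<Rightarrow> 'a \<times> 'a \<Rightarrow> 'b::one" where
  "spin_weight \<beta> \<gamma> T (u, v) = (if u \<in> T then (if v \<in> T then \<gamma> else 1) else if v \<in> T then 1 else \<beta>)"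

definition edge_zero_free :: "complex \<Rightarrow> complex \<Rightarrow> real \<Rightarrow> bool" where
  "edge_zero_free \<beta> \<gamma> \<rho> \<longleftrightarrow> (\<forall>a b. cmod a \<le> \<rho> \<longrightarrow> cmod b \<le> \<rho> \<longrightarrow> \<beta> + a + b + \<gamma> * a * b \<noteq> 0)"

lemma edge_zero_free_imp_bidisc_nonzero:
  assumes "edge_zero_free \<beta> \<gamma> \<rho>" "\<rho> \<ge> 0"
  shows "bidisc_nonzero \<beta> (of_real \<rho>) (of_real \<rho>) (\<gamma> * (of_real \<rho>)\<^sup>2)"
  unfolding bidisc_nonzero_def
proof (intro allI impI)
  fix a b :: complex assume "cmod a \<le> 1" "cmod b \<le> 1"
  then have "cmod (of_real \<rho> * a) \<le> \<rho>" "cmod (of_real \<rho> * b) \<le> \<rho>"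
    using assms(2) by (auto simp: norm_mult mult_left_le)
  then have "\<beta> + of_real \<rho> * a + of_real \<rho> * b + \<gamma> * (of_real \<rho> * a) * (of_real \<rho> * b) \<noteq> 0"
    using assms(1) by (simp add: edge_zero_free_def)
  then show "\<beta> + of_real \<rho> * a + of_real \<rho> * b + \<gamma> * (of_real \<rho>)\<^sup>2 * a * b \<noteq> 0"
    by (simp add: power2_eq_square ac_simps)
qed

lemma edge_zero_free_loop:
  assumes "edge_zero_free \<beta> \<gamma> \<rho>" "\<rho> \<ge> 0"
  shows "cmod \<gamma> * \<rho>\<^sup>2 < cmod \<beta>"
  using bidisc_nonzero_cmod_less[OF edge_zero_free_imp_bidisc_nonzero[OF assms]]
  by (simp add: norm_mult norm_power)

lemma multiaffine_spin_weight:
  assumes "finite W" "u \<notin> W" "v \<notin> W" "u \<noteq> v"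
  shows "multiaffine (\<lambda>T. spin_weight \<beta> \<gamma> T (u, v) * f T) (insert u (insert v W)) z =
    \<beta> * multiaffine f W z + multiaffine (\<lambda>T. f (insert u T)) W z * z u
      + multiaffine (\<lambda>T. f (insert v T)) W z * z v
      + \<gamma> * multiaffine (\<lambda>T. f (insert u (insert v T))) W z * z u * z v"
proof -
  let ?g = "\<lambda>T. spin_weight \<beta> \<gamma> T (u, v) * f T"
  have "multiaffine ?g W z = multiaffine (\<lambda>T. \<beta> * f T) W z"
    using assms by (intro multiaffine_cong) auto
  moreover have "multiaffine (\<lambda>T. ?g (insert u T)) W z = multiaffine (\<lambda>T. f (insert u T)) W z"
    using assms by (intro multiaffine_cong) auto
  moreover have "multiaffine (\<lambda>T. ?g (insert v T)) W z = multiaffine (\<lambda>T. f (insert v T)) W z"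
    using assms by (intro multiaffine_cong) auto
  moreover have "multiaffine (\<lambda>T. ?g (insert u (insert v T))) W z
      = multiaffine (\<lambda>T. \<gamma> * f (insert u (insert v T))) W z"
    using assms by (intro multiaffine_cong) auto
  ultimately show ?thesis
    unfolding multiaffine_insert2[OF assms] by (simp add: multiaffine_scale_coeff)
qed

lemma zero_free_imp_bidisc_nonzero:
  assumes "zero_free f (insert u (insert v W)) S" "finite W" "u \<notin> W" "v \<notin> W" "u \<noteq> v"
    and "\<forall>w\<in>W. z w \<in> S w" "ball 0 r\<^sub>u \<subseteq> S u" "ball 0 r\<^sub>v \<subseteq> S v" "cmod s < r\<^sub>u" "cmod t < r\<^sub>v"
  shows "bidisc_nonzero (multiaffine f W z) (multiaffine (\<lambda>T. f (insert u T)) W z * s)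
    (multiaffine (\<lambda>T. f (insert v T)) W z * t)
    (multiaffine (\<lambda>T. f (insert u (insert v T))) W z * s * t)"
  unfolding bidisc_nonzero_def
proof (intro allI impI)
  fix a b :: complex assume "cmod a \<le> 1" "cmod b \<le> 1"
  then have scaled_less: "cmod (s * a) < r\<^sub>u" "cmod (t * b) < r\<^sub>v"
    using assms(9,10) mult_left_le[of "cmod a" "cmod s"] mult_left_le[of "cmod b" "cmod t"]
    by (auto simp: norm_mult)
  define z' where "z' = z(u := s * a, v := t * b)"
  have "multiaffine f (insert u (insert v W)) z' \<noteq> 0"
    using assms(5-8) scaled_less by (intro zero_freeD[OF assms(1)]) (auto simp: z'_def)
  moreover have "multiaffine g W z' = multiaffine g W z" for g
    using assms(3,4) by (intro multiaffine_cong) (auto simp: z'_def)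
  ultimately show "multiaffine f W z + multiaffine (\<lambda>T. f (insert u T)) W z * s * a
      + multiaffine (\<lambda>T. f (insert v T)) W z * t * b
      + multiaffine (\<lambda>T. f (insert u (insert v T))) W z * s * t * a * b \<noteq> 0"
    using assms(5) unfolding multiaffine_insert2[OF assms(2-5)] by (simp add: z'_def ac_simps)
qed

lemma zero_free_edge:
  assumes "finite W" "u \<in> W" "v \<in> W" "u \<noteq> v" "zero_free f W S"
    and "ball 0 r\<^sub>u \<subseteq> S u" "ball 0 r\<^sub>v \<subseteq> S v" "edge_zero_free \<beta> \<gamma> \<rho>" "\<rho> > 0"
  shows "zero_free (\<lambda>T. spin_weight \<beta> \<gamma> T (u, v) * f T) W
    (S(u := ball 0 (r\<^sub>u * \<rho>), v := ball 0 (r\<^sub>v * \<rho>)))"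
  unfolding zero_free_def
proof (intro allI impI)
  fix z assume z_in_S: "\<forall>w\<in>W. z w \<in> (S(u := ball 0 (r\<^sub>u * \<rho>), v := ball 0 (r\<^sub>v * \<rho>))) w"
  define W\<^sub>0 where "W\<^sub>0 = W - {u, v}"
  have W_eq: "W = insert u (insert v W\<^sub>0)" "finite W\<^sub>0" "u \<notin> W\<^sub>0" "v \<notin> W\<^sub>0"
    using assms(1-4) by (auto simp: W\<^sub>0_def)
  define s t where "s = z u / of_real \<rho>" and "t = z v / of_real \<rho>"
  have z_eq: "z u = of_real \<rho> * s" "z v = of_real \<rho> * t"
    using assms(9) by (simp_all add: s_def t_def)
  have "cmod (z u) < r\<^sub>u * \<rho>" "cmod (z v) < r\<^sub>v * \<rho>"
    using z_in_S assms(2-4) by (auto dest: bspec[of _ _ u] bspec[of _ _ v])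
  then have st_less: "cmod s < r\<^sub>u" "cmod t < r\<^sub>v"
    using assms(9) by (simp_all add: s_def t_def norm_divide divide_less_eq)
  have "\<forall>w\<in>W\<^sub>0. z w \<in> S w"
    using z_in_S by (auto simp: W\<^sub>0_def split: if_splits)
  note rest = zero_free_imp_bidisc_nonzero[OF assms(5)[unfolded W_eq(1)] W_eq(2-4) assms(4)
      this assms(6,7) st_less]
  from bidisc_nonzero_contract[OF edge_zero_free_imp_bidisc_nonzero[OF assms(8)] rest]
  show "multiaffine (\<lambda>T. spin_weight \<beta> \<gamma> T (u, v) * f T) W z \<noteq> 0"
    using assms(9) unfolding W_eq(1) multiaffine_spin_weight[OF W_eq(2-4) assms(4)]
    by (simp add: z_eq power2_eq_square ac_simps)
qed

fun edge_degree :: "('a \<times> 'a) list \<Rightarrow> 'a \<Rightarrow> nat" where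
  "edge_degree [] w = 0"
| "edge_degree ((u, v) # E) w = of_bool (u = w) + of_bool (v = w) + edge_degree E w"

text \<open>
  The variable of an isolated vertex only has to avoid the zero \<open>-1\<close> of its factor \<open>1 + z\<close>, so that
  it may take the value 1.
\<close>

definition lee_yang_region :: "real \<Rightarrow> nat \<Rightarrow> complex set" where
  "lee_yang_region \<rho> n = (if n = 0 then - {- 1} else ball 0 (\<rho> ^ n))"

lemma ball_subset_lee_yang_region: "ball 0 (\<rho> ^ n) \<subseteq> lee_yang_region \<rho> n"
  by (auto simp: lee_yang_region_def)

lemma zero_in_lee_yang_region: "\<rho> > 0 \<Longrightarrow> 0 \<in> lee_yang_region \<rho> n"
  by (simp add: lee_yang_region_def)

lemma power_in_lee_yang_region: "cmod x < \<rho> \<Longrightarrow> x ^ n \<in> lee_yang_region \<rho> n"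
  by (auto simp: lee_yang_region_def norm_power intro!: power_strict_mono)

lemma zero_free_Cons_edge:
  assumes "finite W" "u \<in> W" "v \<in> W" "edge_zero_free \<beta> \<gamma> \<rho>" "\<rho> > 0"
    and "zero_free f W (\<lambda>w. lee_yang_region \<rho> (edge_degree E w))"
  shows "zero_free (\<lambda>T. spin_weight \<beta> \<gamma> T (u, v) * f T) W
    (\<lambda>w. lee_yang_region \<rho> (edge_degree ((u, v) # E) w))"
proof (cases "u = v")
  let ?S = "\<lambda>w. lee_yang_region \<rho> (edge_degree E w)"
  case True
  have "(\<lambda>w. lee_yang_region \<rho> (edge_degree ((u, v) # E) w)) = ?S(v := ball 0 (\<rho> ^ edge_degree E v * \<rho>\<^sup>2))"
    using True by (auto simp: lee_yang_region_def power2_eq_square ac_simps fun_eq_iff)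
  moreover have "spin_weight \<beta> \<gamma> T (u, v) = (if v \<in> T then \<gamma> else \<beta>)" for T
    using True by simp
  moreover have "cmod \<gamma> * \<rho>\<^sup>2 < cmod \<beta>"
    by (rule edge_zero_free_loop) (use assms(4,5) in auto)
  ultimately show ?thesis
    using zero_free_loop[OF assms(1,3,6) ball_subset_lee_yang_region, of "\<rho>\<^sup>2" \<gamma> \<beta>] assms(5)
    by simp
next
  let ?S = "\<lambda>w. lee_yang_region \<rho> (edge_degree E w)"
  case False
  have "(\<lambda>w. lee_yang_region \<rho> (edge_degree ((u, v) # E) w))
      = ?S(u := ball 0 (\<rho> ^ edge_degree E u * \<rho>), v := ball 0 (\<rho> ^ edge_degree E v * \<rho>))"
    using False by (auto simp: lee_yang_region_def ac_simps fun_eq_iff)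
  then show ?thesis
    using zero_free_edge[OF assms(1-3) False assms(6) ball_subset_lee_yang_region
        ball_subset_lee_yang_region assms(4,5)]
    by simp
qed

theorem zero_free_graph:
  assumes "finite W" "set E \<subseteq> W \<times> W" "edge_zero_free \<beta> \<gamma> \<rho>" "\<rho> > 0"
  shows "zero_free (\<lambda>T. \<Prod>e\<leftarrow>E. spin_weight \<beta> \<gamma> T e) W (\<lambda>w. lee_yang_region \<rho> (edge_degree E w))"
  using assms(2)
proof (induction E)
  case Nil
  then show ?case
    using zero_free_one[OF assms(1)] by (simp add: lee_yang_region_def)
next
  case (Cons e E)
  obtain u v where e_eq: "e = (u, v)"
    by (cases e)
  have "u \<in> W" "v \<in> W"
    using Cons.prems by (auto simp: e_eq)
  then show ?case
    using zero_free_Cons_edge[OF assms(1) _ _ assms(3,4)] Cons by (simp add: e_eq)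
qed

section \<open>The zero-free region of a single edge\<close>

lemma affine_pos:
  fixes p q x m :: real
  assumes "p + q * m > 0" "p - q * m > 0" "\<bar>x\<bar> \<le> m"
  shows "p + q * x > 0"
proof -
  have "\<bar>q * x\<bar> \<le> \<bar>q * m\<bar>"
    using assms(3) unfolding abs_mult by (intro mult_left_mono) auto
  then show ?thesis
    using assms(1,2) by linarith
qed

locale edge_region =
  fixes \<beta> \<gamma> \<rho> :: real
  assumes \<rho>_pos: "\<rho> > 0" and loop_pos: "\<beta> - \<gamma> * \<rho>\<^sup>2 > 0" and edge_pos: "\<beta> + \<gamma> * \<rho>\<^sup>2 - 2 * \<rho> > 0"
begin

lemma abs_edge_real:
  assumes "\<bar>t\<bar> \<le> \<rho>"
  shows "\<rho>\<^sup>2 * (1 + \<gamma> * t)\<^sup>2 < (\<beta> + t)\<^sup>2"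
proof -
  have "(\<beta> - \<rho>) + (1 - \<rho> * \<gamma>) * t > 0" "(\<beta> + \<rho>) + (1 + \<rho> * \<gamma>) * t > 0"
    using \<rho>_pos loop_pos edge_pos
    by (intro affine_pos[OF _ _ assms]; simp add: algebra_simps power2_eq_square)+
  then have "((\<beta> - \<rho>) + (1 - \<rho> * \<gamma>) * t) * ((\<beta> + \<rho>) + (1 + \<rho> * \<gamma>) * t) > 0"
    by simp
  also have "((\<beta> - \<rho>) + (1 - \<rho> * \<gamma>) * t) * ((\<beta> + \<rho>) + (1 + \<rho> * \<gamma>) * t)
      = (\<beta> + t)\<^sup>2 - \<rho>\<^sup>2 * (1 + \<gamma> * t)\<^sup>2"
    by (simp add: power2_eq_square algebra_simps)
  finally show ?thesis
    by simp
qed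

text \<open>
  For fixed \<open>\<bar>a\<bar>\<close> the difference \<open>\<bar>\<beta> + a\<bar>\<^sup>2 - \<rho>\<^sup>2 \<bar>1 + \<gamma> a\<bar>\<^sup>2\<close> is affine in \<open>Re a\<close>,
  hence positive if it is so for \<open>a = \<plusminus>\<bar>a\<bar>\<close>.
\<close>

lemma cmod_edge:
  assumes "cmod a \<le> \<rho>"
  shows "\<rho> * cmod (1 + of_real \<gamma> * a) < cmod (of_real \<beta> + a)"
proof -
  define m where "m = cmod a"
  let ?c = "\<beta>\<^sup>2 + m\<^sup>2 - \<rho>\<^sup>2 * (1 + \<gamma>\<^sup>2 * m\<^sup>2)" and ?k = "2 * \<beta> - \<rho>\<^sup>2 * (2 * \<gamma>)"
  have "?c + ?k * m > 0" "?c - ?k * m > 0"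
    using abs_edge_real[of m] abs_edge_real[of "- m"] assms
    by (simp_all add: m_def power2_eq_square algebra_simps)
  then have "?c + ?k * Re a > 0"
    by (rule affine_pos) (simp add: m_def abs_Re_le_cmod)
  also have "?c + ?k * Re a = (cmod (of_real \<beta> + a))\<^sup>2 - (\<rho> * cmod (1 + of_real \<gamma> * a))\<^sup>2"
    unfolding m_def power_mult_distrib cmod_power2 by (simp add: power2_eq_square algebra_simps)
  finally show ?thesis
    by (simp add: power2_less_imp_less)
qed

lemma edge_zero_free: "edge_zero_free (of_real \<beta>) (of_real \<gamma>) \<rho>"
  unfolding edge_zero_free_def
proof (intro allI impI)
  fix a b :: complex assume ab_le: "cmod a \<le> \<rho>" "cmod b \<le> \<rho>"
  have "cmod (b * (1 + of_real \<gamma> * a)) \<le> \<rho> * cmod (1 + of_real \<gamma> * a)"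
    using ab_le(2) by (simp add: norm_mult mult_right_mono)
  also have "\<dots> < cmod (of_real \<beta> + a)"
    by (rule cmod_edge[OF ab_le(1)])
  finally have "of_real \<beta> + a + b * (1 + of_real \<gamma> * a) \<noteq> 0"
    by (rule add_nonzero_if_cmod_less)
  then show "of_real \<beta> + a + b + of_real \<gamma> * a * b \<noteq> 0"
    by (simp add: algebra_simps)
qed

end

lemma edge_zero_free_minus: "edge_zero_free (- \<beta>) (- \<gamma>) \<rho> \<Longrightarrow> edge_zero_free \<beta> \<gamma> \<rho>"
  unfolding edge_zero_free_def
proof (intro allI impI)
  fix a b assume "\<forall>a b. cmod a \<le> \<rho> \<longrightarrow> cmod b \<le> \<rho> \<longrightarrow> - \<beta> + a + b + - \<gamma> * a * b \<noteq> 0"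
    and "cmod a \<le> \<rho>" "cmod b \<le> \<rho>"
  then have "- \<beta> + (- a) + (- b) + - \<gamma> * (- a) * (- b) \<noteq> 0"
    by (metis norm_minus_cancel)
  moreover have "- \<beta> + (- a) + (- b) + - \<gamma> * (- a) * (- b) = - (\<beta> + a + b + \<gamma> * a * b)"
    by (simp add: algebra_simps)
  ultimately show "\<beta> + a + b + \<gamma> * a * b \<noteq> 0"
    by (metis neg_equal_0_iff_equal)
qed

lemma eventually_edge_region:
  assumes "\<bar>\<gamma>\<bar> < \<beta>" "2 < \<beta> + \<gamma>"
  shows "eventually (edge_region \<beta> \<gamma>) (at_right 1)"
proof -
  have "((\<lambda>\<rho>. \<beta> - \<gamma> * \<rho>\<^sup>2) \<longlongrightarrow> \<beta> - \<gamma> * 1\<^sup>2) (at_right 1)"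
    by (intro tendsto_intros)
  then have "\<forall>\<^sub>F \<rho> in at_right 1. 0 < \<beta> - \<gamma> * \<rho>\<^sup>2"
    by (rule order_tendstoD) (use assms in auto)
  moreover have "((\<lambda>\<rho>. \<beta> + \<gamma> * \<rho>\<^sup>2 - 2 * \<rho>) \<longlongrightarrow> \<beta> + \<gamma> * 1\<^sup>2 - 2 * 1) (at_right 1)"
    by (intro tendsto_intros)
  then have "\<forall>\<^sub>F \<rho> in at_right 1. 0 < \<beta> + \<gamma> * \<rho>\<^sup>2 - 2 * \<rho>"
    by (rule order_tendstoD) (use assms in auto)
  moreover have "\<forall>\<^sub>F \<rho> in at_right 1. \<rho> > (1::real)"
    by (rule eventually_at_right_less)
  ultimately show ?thesis
    by eventually_elim (simp add: edge_region_def)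
qed

lemma edge_zero_free_exists:
  fixes \<beta> \<gamma> :: real
  assumes "\<bar>\<gamma>\<bar> < \<bar>\<beta>\<bar>" "2 < \<bar>\<beta> + \<gamma>\<bar>"
  obtains \<rho> where "\<rho> > 1" "edge_zero_free (of_real \<beta>) (of_real \<gamma>) \<rho>"
proof -
  have pos: "\<exists>\<rho>>1. edge_zero_free (of_real \<beta>) (of_real \<gamma>) \<rho>" if "\<bar>\<gamma>\<bar> < \<beta>" "2 < \<beta> + \<gamma>" for \<beta> \<gamma> :: real
    using eventually_happens[OF eventually_conj[OF eventually_edge_region[OF that] eventually_at_right_less]]
    by (auto dest: edge_region.edge_zero_free)
  show thesis
  proof (cases "\<beta> > 0")
    case True
    then show thesis
      using pos[of \<gamma> \<beta>] assms that by auto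
  next
    case False
    then show thesis
      using pos[of "- \<gamma>" "- \<beta>"] assms that by (auto intro: edge_zero_free_minus)
  qed
qed
section \<open>Normalised partition functions\<close>

text \<open>
  With \<open>A = x / \<beta>\<close> and \<open>G = \<gamma> x\<close> these are the edge weights \<open>\<beta>, x, x, \<gamma> x\<^sup>2\<close> divided by \<open>\<beta>\<close>; a configuration is
  given by the set \<open>T\<close> of its vertices of spin 1.
\<close>

fun edge_factor :: "'b::comm_semiring_1 \<Rightarrow> 'b \<Rightarrow> 'a set \<Rightarrow> 'a \<times> 'a \<Rightarrow> 'b" where
  "edge_factor A G T (u, v) = (if u \<in> T then (if v \<in> T then A * G else A) else if v \<in> T then A else 1)"

text \<open>
  A pin \<open>(u, f)\<close> stands for an edge from \<open>u\<close> to a deleted vertex, of spin 1 if \<open>f\<close> holds and of spin 0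
  otherwise.  The factor \<open>A\<close> due to the other end is left out.
\<close>

fun pin_factor :: "'b::comm_semiring_1 \<Rightarrow> 'b \<Rightarrow> 'a set \<Rightarrow> 'a \<times> bool \<Rightarrow> 'b" where
  "pin_factor A G T (u, f) = (if u \<in> T then (if f then G else A) else 1)"

definition pin :: "bool \<Rightarrow> 'a list \<Rightarrow> ('a \<times> bool) list" where
  "pin f us = map (\<lambda>u. (u, f)) us"

definition config_weight ::
    "'b::comm_semiring_1 \<Rightarrow> 'b \<Rightarrow> ('a \<times> 'a) list \<Rightarrow> ('a \<times> bool) list \<Rightarrow> 'a set \<Rightarrow> 'b" where
  "config_weight A G E P T = (\<Prod>e\<leftarrow>E. edge_factor A G T e) * (\<Prod>q\<leftarrow>P. pin_factor A G T q)"

definition partition_sum ::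
    "'b::comm_semiring_1 \<Rightarrow> 'b \<Rightarrow> 'a set \<Rightarrow> ('a \<times> 'a) list \<Rightarrow> ('a \<times> bool) list \<Rightarrow> 'b" where
  "partition_sum A G W E P = (\<Sum>T\<in>Pow W. config_weight A G E P T)"

definition partition_sum_at ::
    "'b::comm_semiring_1 \<Rightarrow> 'b \<Rightarrow> 'a set \<Rightarrow> 'a \<Rightarrow> ('a \<times> 'a) list \<Rightarrow> ('a \<times> bool) list \<Rightarrow> 'b" where
  "partition_sum_at A G W v E P = (\<Sum>T\<in>Pow W. config_weight A G E P (insert v T))"

lemma pin_simps [simp]: "pin f [] = []" "pin f (u # us) = (u, f) # pin f us"
  by (simp_all add: pin_def)

lemma length_pin [simp]: "length (pin f us) = length us"
  by (simp add: pin_def)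

lemma config_weight_simps:
  "config_weight A G [] [] T = 1"
  "config_weight A G (e # E) P T = edge_factor A G T e * config_weight A G E P T"
  "config_weight A G E (q # P) T = pin_factor A G T q * config_weight A G E P T"
  by (simp_all add: config_weight_def ac_simps)

lemma config_weight_pin_move:
  "config_weight A G E (P @ q # Q) T = config_weight A G E (q # P @ Q) T"
  by (simp add: config_weight_def ac_simps)

lemma config_weight_empty [simp]: "config_weight A G E P {} = 1"
proof (induction E)
  case Nil
  show ?case
    by (induction P) (auto simp: config_weight_simps)
next
  case (Cons e E)
  then show ?case
    by (cases e) (simp add: config_weight_simps)
qed

lemma partition_sum_insert:
  assumes "finite W" "v \<notin> W"
  shows "partition_sum A G (insert v W) E P = partition_sum A G W E P + partition_sum_at A G W v E P"
  using assms by (simp add: partition_sum_def partition_sum_at_def sum_Pow_insert)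

lemma partition_sum_pin:
  assumes "finite W" "u \<notin> W"
  shows "partition_sum A G (insert u W) E ((u, f) # P)
    = partition_sum A G W E P + (if f then G else A) * partition_sum_at A G W u E P"
proof -
  have "partition_sum A G W E ((u, f) # P) = partition_sum A G W E P"
    using assms(2) unfolding partition_sum_def by (intro sum.cong) (auto simp: config_weight_simps)
  moreover have "partition_sum_at A G W u E ((u, f) # P)
      = (if f then G else A) * partition_sum_at A G W u E P"
    by (simp add: partition_sum_at_def config_weight_simps sum_distrib_left)
  ultimately show ?thesis
    using assms by (simp add: partition_sum_insert)
qed

subsection \<open>Deleting a vertex\<close>

fun neighbours :: "'a \<Rightarrow> ('a \<times> 'a) list \<Rightarrow> 'a list" where
  "neighbours v [] = []"
| "neighbours v ((x, y) # E) =
     (if x = v then y # neighbours v E else if y = v then x # neighbours v E else neighbours v E)"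

definition delete_vertex :: "'a \<Rightarrow> ('a \<times> 'a) list \<Rightarrow> ('a \<times> 'a) list" where
  "delete_vertex v E = filter (\<lambda>(x, y). x \<noteq> v \<and> y \<noteq> v) E"

abbreviation loopless :: "('a \<times> 'a) list \<Rightarrow> bool" where
  "loopless E \<equiv> \<forall>(x, y) \<in> set E. x \<noteq> y"

lemma delete_vertex_simps [simp]:
  "delete_vertex v [] = []"
  "delete_vertex v ((x, y) # E) = (if x = v \<or> y = v then delete_vertex v E else (x, y) # delete_vertex v E)"
  by (simp_all add: delete_vertex_def)

lemma set_delete_vertex: "set (delete_vertex v E) = {(x, y) \<in> set E. x \<noteq> v \<and> y \<noteq> v}"
  by (auto simp: delete_vertex_def)

lemma set_neighbours: "set (neighbours v E) = {y. (v, y) \<in> set E} \<union> {x. (x, v) \<in> set E}"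
  by (induction v E rule: neighbours.induct) auto

lemma length_delete_vertex_neighbours: "length (delete_vertex v E) + length (neighbours v E) = length E"
  by (induction v E rule: neighbours.induct) auto

lemma length_neighbours_delete_vertex: "length (neighbours u (delete_vertex v E)) \<le> length (neighbours u E)"
  by (induction v E rule: neighbours.induct) auto

lemma config_weight_delete_vertex:
  assumes "v \<notin> T"
  shows "config_weight A G E P T
    = config_weight A G (delete_vertex v E) (pin False (neighbours v E) @ P) T"
proof (induction E)
  case (Cons e E)
  then show ?case
    using assms by (cases e) (auto simp: config_weight_simps ac_simps)
qed simp

lemma config_weight_insert:
  assumes "v \<notin> T" "loopless E"
  shows "config_weight A G E P (insert v T) = config_weight A G [] P {v} * A ^ length (neighbours v E)
    * config_weight A G (delete_vertex v E) (pin True (neighbours v E) @ P) T"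
  using assms(2)
proof (induction E)
  case Nil
  show ?case
  proof (induction P)
    case (Cons q P)
    then show ?case
      using assms(1) by (cases q) (auto simp: config_weight_simps ac_simps)
  qed (simp add: config_weight_simps)
next
  case (Cons e E)
  then show ?case
    using assms(1) by (cases e) (auto simp: config_weight_simps ac_simps)
qed

lemma partition_sum_delete_vertex:
  assumes "v \<notin> W"
  shows "partition_sum A G W E P
    = partition_sum A G W (delete_vertex v E) (pin False (neighbours v E) @ P)"
  unfolding partition_sum_def using assms by (intro sum.cong refl config_weight_delete_vertex) auto

lemma partition_sum_at_delete_vertex:
  assumes "v \<notin> W" "loopless E"
  shows "partition_sum_at A G W v E P = config_weight A G [] P {v} * A ^ length (neighbours v E)
    * partition_sum A G W (delete_vertex v E) (pin True (neighbours v E) @ P)"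
  unfolding partition_sum_def partition_sum_at_def sum_distrib_left
  using assms by (intro sum.cong refl config_weight_insert) auto

subsection \<open>Loops\<close>

definition proper_edges :: "('a \<times> 'a) list \<Rightarrow> ('a \<times> 'a) list" where
  "proper_edges E = filter (\<lambda>(x, y). x \<noteq> y) E"

text \<open>A loop has the normalised weight \<open>\<gamma> x\<^sup>2 / \<beta> = A G\<close>, the product of the factors of the two kinds of pins.\<close>

fun loop_pins :: "('a \<times> 'a) list \<Rightarrow> ('a \<times> bool) list" where
  "loop_pins [] = []"
| "loop_pins ((x, y) # E) = (if x = y then (x, False) # (x, True) # loop_pins E else loop_pins E)"

lemma proper_edges_simps [simp]:
  "proper_edges [] = []"
  "proper_edges ((x, y) # E) = (if x = y then proper_edges E else (x, y) # proper_edges E)"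
  by (simp_all add: proper_edges_def)

lemma loopless_proper_edges: "loopless (proper_edges E)"
  by (auto simp: proper_edges_def)

lemma length_proper_edges_loop_pins: "length (proper_edges E) + length (loop_pins E) \<le> 2 * length E"
  by (induction E rule: loop_pins.induct) auto

lemma config_weight_proper_edges:
  "config_weight A G (proper_edges E) (loop_pins E) T = config_weight A G E [] T"
  by (induction E rule: loop_pins.induct) (auto simp: config_weight_simps ac_simps)

subsection \<open>The constant coefficient of a partition function\<close>

lemma fps_nth_0_config_weight:
  fixes A G :: "'b::comm_semiring_1 fps"
  assumes "fps_nth A 0 = 0" "fps_nth G 0 = 0"
  shows "fps_nth (config_weight A G E P T) 0 = of_bool (T \<inter> (fst ` set E \<union> snd ` set E \<union> fst ` set P) = {})"
proof (induction E)
  case Nil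
  show ?case
  proof (induction P)
    case (Cons q P)
    then show ?case
      using assms by (cases q) (auto simp: config_weight_simps)
  qed (simp add: config_weight_simps)
next
  case (Cons e E)
  then show ?case
    using assms by (cases e) (auto simp: config_weight_simps)
qed

lemma fps_nth_0_partition_sum:
  fixes A G :: "'b::{comm_semiring_1, semiring_char_0} fps"
  assumes "fps_nth A 0 = 0" "fps_nth G 0 = 0" "finite W"
  shows "fps_nth (partition_sum A G W E P) 0 \<noteq> 0"
proof -
  let ?X = "fst ` set E \<union> snd ` set E \<union> fst ` set P"
  have "fps_nth (partition_sum A G W E P) 0 = of_nat (card (Pow W \<inter> {T. T \<inter> ?X = {}}))"
    using assms(3)
    by (simp add: partition_sum_def fps_sum_nth fps_nth_0_config_weight[OF assms(1,2)] sum_of_bool_eq)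
  moreover have "{} \<in> Pow W \<inter> {T. T \<inter> ?X = {}}"
    by simp
  ultimately show ?thesis
    using assms(3) by (metis card_eq_0_iff empty_iff finite_Int finite_Pow_iff of_nat_eq_0_iff)
qed

section \<open>Zero-free partition functions\<close>

lemma prod_spin_weight_eq_config_weight:
  fixes \<beta> \<gamma> x :: "'b::field"
  assumes "\<beta> \<noteq> 0" "finite T"
  shows "(\<Prod>e\<leftarrow>E. spin_weight \<beta> \<gamma> T e) * (\<Prod>v\<in>T. x ^ edge_degree E v)
    = \<beta> ^ length E * config_weight (x / \<beta>) (\<gamma> * x) E [] T"
proof (induction E)
  case Nil
  then show ?case
    by (simp add: config_weight_simps)
next
  case (Cons e E)
  obtain u v where e_eq: "e = (u, v)"
    by (cases e)
  have "(\<Prod>w\<in>T. x ^ of_bool (u = w)) = x ^ of_bool (u \<in> T)" for u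
    using prod.delta'[OF assms(2), of u "\<lambda>_. x"]
    by (simp add: of_bool_def if_distrib[of "(^) x"] cong: if_cong)
  then have "(\<Prod>w\<in>T. x ^ edge_degree (e # E) w)
      = x ^ of_bool (u \<in> T) * x ^ of_bool (v \<in> T) * (\<Prod>w\<in>T. x ^ edge_degree E w)"
    by (simp add: e_eq power_add prod.distrib)
  moreover have "spin_weight \<beta> \<gamma> T e * (x ^ of_bool (u \<in> T) * x ^ of_bool (v \<in> T))
      = \<beta> * edge_factor (x / \<beta>) (\<gamma> * x) T e"
    using assms(1) by (auto simp: e_eq)
  ultimately have "(\<Prod>e\<leftarrow>e # E. spin_weight \<beta> \<gamma> T e) * (\<Prod>v\<in>T. x ^ edge_degree (e # E) v)
      = \<beta> * edge_factor (x / \<beta>) (\<gamma> * x) T e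
        * ((\<Prod>e\<leftarrow>E. spin_weight \<beta> \<gamma> T e) * (\<Prod>v\<in>T. x ^ edge_degree E v))"
    by (simp add: ac_simps)
  then show ?case
    by (simp add: Cons.IH config_weight_simps ac_simps)
qed

locale zero_free_partition =
  fixes \<beta> \<gamma> :: complex and \<rho> :: real
  assumes \<beta>_nonzero: "\<beta> \<noteq> 0" and \<rho>_pos: "\<rho> > 0" and edge_zero_free: "edge_zero_free \<beta> \<gamma> \<rho>"
begin

text \<open>The vertices of \<open>V\<close> other than \<open>v\<close> and those in \<open>W\<close> have spin 0.\<close>

lemma partition_sums_nonzero:
  assumes "finite V" "set E \<subseteq> V \<times> V" "insert v W \<subseteq> V" "v \<notin> W" "cmod x < \<rho>"
    and c_in_region: "c * x ^ edge_degree E v \<in> lee_yang_region \<rho> (edge_degree E v)"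
  shows "partition_sum (x / \<beta>) (\<gamma> * x) W E [] + c * partition_sum_at (x / \<beta>) (\<gamma> * x) W v E [] \<noteq> 0"
proof -
  have fin_insert: "finite (insert v W)"
    using assms(1,3) by (rule rev_finite_subset)
  let ?f = "\<lambda>T. \<Prod>e\<leftarrow>E. spin_weight \<beta> \<gamma> T e" and ?z = "\<lambda>w. x ^ edge_degree E w"
    and ?w = "config_weight (x / \<beta>) (\<gamma> * x) E []"
  have "zero_free ?f (insert v W) (\<lambda>w. lee_yang_region \<rho> (edge_degree E w))"
    using zero_free_graph[OF assms(1,2) edge_zero_free \<rho>_pos] assms(3,1)
    by (rule zero_free_subset) (simp add: zero_in_lee_yang_region \<rho>_pos)
  then have "multiaffine ?f (insert v W) (?z(v := c * ?z v)) \<noteq> 0"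
    by (rule zero_freeD) (use c_in_region power_in_lee_yang_region[OF assms(5)] in auto)
  also have "multiaffine ?f (insert v W) (?z(v := c * ?z v))
      = multiaffine (\<lambda>T. (if v \<in> T then c else 1) * ?f T) (insert v W) ?z"
    by (rule multiaffine_scale_var[OF fin_insert])
  also have "\<dots> = (\<Sum>T\<in>Pow (insert v W). \<beta> ^ length E * ((if v \<in> T then c else 1) * ?w T))"
    unfolding multiaffine_def
  proof (rule sum.cong[OF refl])
    fix T assume "T \<in> Pow (insert v W)"
    then have "finite T"
      using fin_insert by (auto intro: finite_subset)
    then show "(if v \<in> T then c else 1) * ?f T * prod ?z T
        = \<beta> ^ length E * ((if v \<in> T then c else 1) * ?w T)"
      using prod_spin_weight_eq_config_weight[OF \<beta>_nonzero, of T \<gamma> E x] by (simp add: ac_simps)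
  qed
  also have "\<dots> = \<beta> ^ length E
      * ((\<Sum>T\<in>Pow W. (if v \<in> T then c else 1) * ?w T) + (\<Sum>T\<in>Pow W. c * ?w (insert v T)))"
    using fin_insert assms(4) by (simp add: sum_Pow_insert flip: sum_distrib_left)
  also have "(\<Sum>T\<in>Pow W. (if v \<in> T then c else 1) * ?w T) = partition_sum (x / \<beta>) (\<gamma> * x) W E []"
    unfolding partition_sum_def using assms(4) by (intro sum.cong) auto
  finally show ?thesis
    by (simp add: partition_sum_at_def sum_distrib_left)
qed

definition spin_sum :: "'v set \<Rightarrow> ('v \<times> 'v) list \<Rightarrow> complex \<Rightarrow> complex" where
  "spin_sum W E x = partition_sum (x / \<beta>) (\<gamma> * x) W E []"

definition spin_ratio :: "'v set \<Rightarrow> 'v \<Rightarrow> ('v \<times> 'v) list \<Rightarrow> complex \<Rightarrow> complex" where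
  "spin_ratio W v E x = partition_sum_at (x / \<beta>) (\<gamma> * x) W v E [] / spin_sum W E x"

lemma spin_sum_nonzero:
  assumes "finite V" "set E \<subseteq> V \<times> V" "insert v W \<subseteq> V" "v \<notin> W" "cmod x < \<rho>"
  shows "spin_sum W E x \<noteq> 0"
  using partition_sums_nonzero[OF assms, of 0] by (simp add: spin_sum_def zero_in_lee_yang_region \<rho>_pos)

lemma spin_sum_insert:
  assumes "finite V" "set E \<subseteq> V \<times> V" "insert v W \<subseteq> V" "v \<notin> W" "cmod x < \<rho>"
  shows "spin_sum (insert v W) E x = (1 + spin_ratio W v E x) * spin_sum W E x"
proof -
  have "finite W"
    using assms(1,3) by (auto intro: finite_subset)
  then have "spin_sum (insert v W) E x = spin_sum W E x + partition_sum_at (x / \<beta>) (\<gamma> * x) W v E []"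
    using assms(4) by (simp add: spin_sum_def partition_sum_insert)
  then show ?thesis
    using spin_sum_nonzero[OF assms] by (simp add: spin_ratio_def field_simps)
qed

lemma spin_ratio_cases:
  assumes "finite V" "set E \<subseteq> V \<times> V" "insert v W \<subseteq> V" "v \<notin> W" "cmod x < \<rho>"
  obtains "spin_ratio W v E x = 1" | "cmod (spin_ratio W v E x) \<le> cmod x / \<rho>"
proof -
  let ?R = "spin_ratio W v E x" and ?d = "edge_degree E v"
  have "?R = 1 \<or> cmod ?R \<le> cmod x / \<rho>"
  proof (cases "?R = 0")
    case False
    then have "- (1 / ?R) * x ^ ?d \<notin> lee_yang_region \<rho> ?d"
      using partition_sums_nonzero[OF assms, of "- (1 / ?R)"]
      by (auto simp: spin_ratio_def spin_sum_def)
    then consider (unit) "?R = 1" | (small) "?d > 0" "\<rho> ^ ?d \<le> cmod x ^ ?d / cmod ?R"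
      by (auto simp: lee_yang_region_def norm_mult norm_divide norm_power split: if_splits)
    then show ?thesis
    proof cases
      case small
      then have "cmod ?R \<le> (cmod x / \<rho>) ^ ?d"
        using False \<rho>_pos by (simp add: field_simps power_divide)
      also have "\<dots> \<le> cmod x / \<rho>"
        using small(1) assms(5) \<rho>_pos power_decreasing[of 1 ?d "cmod x / \<rho>"] by simp
      finally show ?thesis ..
    qed simp
  qed (use \<rho>_pos in simp)
  then show thesis
    using that by blast
qed

lemma cmod_spin_ratio_le_1:
  assumes "finite V" "set E \<subseteq> V \<times> V" "insert v W \<subseteq> V" "v \<notin> W" "cmod x < \<rho>"
  shows "cmod (spin_ratio W v E x) \<le> 1"
proof (rule spin_ratio_cases[OF assms])
  assume "cmod (spin_ratio W v E x) \<le> cmod x / \<rho>"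
  also have "\<dots> \<le> 1"
    using assms(5) \<rho>_pos by simp
  finally show ?thesis .
qed simp

lemma cmod_one_plus_spin_ratio_ge:
  assumes "finite V" "set E \<subseteq> V \<times> V" "insert v W \<subseteq> V" "v \<notin> W" "cmod x < \<rho>"
  shows "1 - cmod x / \<rho> \<le> cmod (1 + spin_ratio W v E x)"
proof (rule spin_ratio_cases[OF assms])
  assume "spin_ratio W v E x = 1"
  then show ?thesis
    using \<rho>_pos by (simp add: order_trans[of _ 1])
next
  assume "cmod (spin_ratio W v E x) \<le> cmod x / \<rho>"
  moreover have "cmod 1 - cmod (spin_ratio W v E x) \<le> cmod (1 + spin_ratio W v E x)"
    by (rule norm_diff_ineq)
  ultimately show ?thesis
    by simp
qed

lemma holomorphic_config_weight:
  "(\<lambda>x. config_weight (x / \<beta>) (\<gamma> * x) E [] T) holomorphic_on S"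
proof (induction E)
  case (Cons e E)
  have "(\<lambda>x. edge_factor (x / \<beta>) (\<gamma> * x) T e) holomorphic_on S"
    using \<beta>_nonzero by (cases e; cases "fst e \<in> T"; cases "snd e \<in> T") (auto intro!: holomorphic_intros)
  then show ?case
    unfolding config_weight_simps by (intro holomorphic_intros Cons)
qed (simp add: config_weight_simps)

lemma holomorphic_spin_ratio:
  assumes "finite V" "set E \<subseteq> V \<times> V" "insert v W \<subseteq> V" "v \<notin> W"
  shows "spin_ratio W v E holomorphic_on ball 0 \<rho>"
proof -
  have "spin_sum W E x \<noteq> 0" if "x \<in> ball 0 \<rho>" for x
    using spin_sum_nonzero[OF assms] that by simp
  then show ?thesis
    unfolding spin_ratio_def spin_sum_def partition_sum_def partition_sum_at_def
    by (intro holomorphic_intros holomorphic_config_weight) auto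
qed

end

section \<open>Truncated power series\<close>

fun series_mult :: "'a::semiring_0 list \<Rightarrow> 'a list \<Rightarrow> 'a list" where
  "series_mult [] ys = []"
| "series_mult (x # xs) ys = map2 (+) (map ((*) x) ys) (0 # series_mult xs ys)"

text \<open>The quotient of the series \<open>xs\<close> by \<open>1 + X * ys\<close>.\<close>

function series_div :: "'a::ring list \<Rightarrow> 'a list \<Rightarrow> 'a list" where
  "series_div [] ys = []"
| "series_div (x # xs) ys = x # series_div (map2 (+) xs (map ((*) (- x)) ys)) ys"
  by pat_completeness auto
termination
  by (relation "Wellfounded.measure (length \<circ> fst)") auto

definition monom_mult :: "'a::semiring_0 \<Rightarrow> 'a list \<Rightarrow> 'a list" where
  "monom_mult k xs = map ((*) k) (butlast (0 # xs))"

lemma length_series_mult [simp]: "length (series_mult xs ys) = min (length xs) (length ys)"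
  by (induction xs) auto

lemma length_series_div: "length xs \<le> Suc (length ys) \<Longrightarrow> length (series_div xs ys) = length xs"
  by (induction xs ys rule: series_div.induct) auto

lemma length_monom_mult [simp]: "length (monom_mult k xs) = length xs"
  by (simp add: monom_mult_def)

subsection \<open>Correctness\<close>

definition truncates :: "'b::ring_1 fps \<Rightarrow> int list \<Rightarrow> bool" where
  "truncates F xs \<longleftrightarrow> (\<forall>i < length xs. of_int (xs ! i) = fps_nth F i)"

lemma truncates_Nil [simp]: "truncates F []"
  by (simp add: truncates_def)

lemma truncates_Cons: "truncates F (x # xs) \<longleftrightarrow> of_int x = fps_nth F 0 \<and> truncates (fps_shift 1 F) xs"
  by (auto simp: truncates_def less_Suc_eq_0_disj)

lemma truncates_one: "truncates 1 (1 # replicate k 0)"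
  by (auto simp: truncates_def nth_Cons')

lemma truncates_scale: "truncates F xs \<Longrightarrow> truncates (fps_const (of_int k) * F) (map ((*) k) xs)"
  by (auto simp: truncates_def)

lemma truncates_add: "truncates F xs \<Longrightarrow> truncates H ys \<Longrightarrow> truncates (F + H) (map2 (+) xs ys)"
  by (auto simp: truncates_def)

lemma truncates_Cons_mult_X:
  assumes "truncates F xs"
  shows "truncates (fps_const (of_int x) + fps_X * F) (x # xs)"
proof -
  have "fps_shift 1 (fps_const (of_int x) + fps_X * F) = F"
    by (simp add: fps_eq_iff)
  then show ?thesis
    using assms by (simp add: truncates_Cons)
qed

lemma truncates_ConsE:
  assumes "truncates F (x # xs)"
  obtains H where "F = fps_const (of_int x) + fps_X * H" "truncates H xs"
proof
  show "F = fps_const (of_int x) + fps_X * fps_shift 1 F"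
    using assms by (simp add: fps_eq_iff truncates_Cons)
  show "truncates (fps_shift 1 F) xs"
    using assms by (simp add: truncates_Cons)
qed

lemma truncates_butlast: "truncates F xs \<Longrightarrow> truncates F (butlast xs)"
  by (simp add: truncates_def nth_butlast)

lemma truncates_monom_mult:
  fixes F :: "'b::comm_ring_1 fps"
  assumes "truncates F xs"
  shows "truncates (F * (fps_const (of_int k) * fps_X)) (monom_mult k xs)"
  using truncates_scale[OF truncates_butlast[OF truncates_Cons_mult_X[OF assms, of 0]], of k]
  by (simp add: monom_mult_def ac_simps)

lemma truncates_mult:
  fixes F H :: "'b::comm_ring_1 fps"
  shows "truncates F xs \<Longrightarrow> truncates H ys \<Longrightarrow> truncates (F * H) (series_mult xs ys)"
proof (induction xs arbitrary: F)
  case (Cons x xs)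
  obtain F' where F_eq: "F = fps_const (of_int x) + fps_X * F'" "truncates F' xs"
    using Cons.prems(1) by (rule truncates_ConsE)
  have "truncates (fps_X * (F' * H)) (0 # series_mult xs ys)"
    using truncates_Cons_mult_X[OF Cons.IH[OF F_eq(2) Cons.prems(2)], of 0] by simp
  then have "truncates (fps_const (of_int x) * H + fps_X * (F' * H)) (series_mult (x # xs) ys)"
    unfolding series_mult.simps by (intro truncates_add truncates_scale Cons.prems(2))
  also have "fps_const (of_int x) * H + fps_X * (F' * H) = F * H"
    by (simp add: F_eq(1) algebra_simps)
  finally show ?case .
qed simp

lemma truncates_div:
  fixes F U :: "'b::field fps"
  shows "truncates F xs \<Longrightarrow> truncates U ys \<Longrightarrow> truncates (F * inverse (1 + fps_X * U)) (series_div xs ys)"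
proof (induction xs ys arbitrary: F rule: series_div.induct)
  case (2 x xs ys)
  let ?I = "inverse (1 + fps_X * U)" and ?x = "fps_const (of_int x) :: 'b fps"
  obtain F' where F_eq: "F = ?x + fps_X * F'" "truncates F' xs"
    using "2.prems"(1) by (rule truncates_ConsE)
  have "truncates (F' + fps_const (of_int (- x)) * U) (map2 (+) xs (map ((*) (- x)) ys))"
    by (intro truncates_add truncates_scale F_eq(2) "2.prems"(2))
  from truncates_Cons_mult_X[OF "2.IH"[OF this "2.prems"(2)], of x]
  have "truncates (?x + fps_X * ((F' - ?x * U) * ?I)) (series_div (x # xs) ys)"
    by (simp flip: fps_const_neg)
  also have "?x + fps_X * ((F' - ?x * U) * ?I) = ?x * ((1 + fps_X * U) * ?I) + fps_X * ((F' - ?x * U) * ?I)"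
    by (simp add: inverse_mult_eq_1')
  also have "\<dots> = F * ?I"
    by (simp add: F_eq(1) algebra_simps)
  finally show ?case .
qed simp

subsection \<open>Weighted norms\<close>

fun weighted_norm :: "real \<Rightarrow> int list \<Rightarrow> real" where
  "weighted_norm q [] = 0"
| "weighted_norm q (x # xs) = \<bar>real_of_int x\<bar> + q * weighted_norm q xs"

lemma weighted_norm_nonneg: "0 \<le> q \<Longrightarrow> 0 \<le> weighted_norm q xs"
  by (induction xs) auto

lemma weighted_norm_scale: "weighted_norm q (map ((*) k) xs) = \<bar>real_of_int k\<bar> * weighted_norm q xs"
  by (induction xs) (auto simp: abs_mult algebra_simps)

lemma weighted_norm_zeros [simp]: "weighted_norm q (replicate k 0) = 0"
  by (induction k) auto

lemma weighted_norm_butlast: "0 \<le> q \<Longrightarrow> weighted_norm q (butlast xs) \<le> weighted_norm q xs"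
  by (induction xs) (auto simp: weighted_norm_nonneg mult_left_mono)

lemma weighted_norm_monom_mult:
  "0 \<le> q \<Longrightarrow> weighted_norm q (monom_mult k xs) \<le> \<bar>real_of_int k\<bar> * q * weighted_norm q xs"
  using weighted_norm_butlast[of q "0 # xs"]
  by (simp add: monom_mult_def weighted_norm_scale mult_left_mono mult.assoc del: butlast.simps)

lemma weighted_norm_add:
  assumes "0 \<le> q"
  shows "weighted_norm q (map2 (+) xs ys) \<le> weighted_norm q xs + weighted_norm q ys"
proof (induction xs ys rule: list_induct2')
  case (4 x xs y ys)
  have "q * weighted_norm q (map2 (+) xs ys) \<le> q * weighted_norm q xs + q * weighted_norm q ys"
    using mult_left_mono[OF 4 assms] by (simp add: distrib_left)
  then show ?case
    by simp
qed (use assms in \<open>auto simp: weighted_norm_nonneg\<close>)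

lemma weighted_norm_mult:
  assumes "0 \<le> q"
  shows "weighted_norm q (series_mult xs ys) \<le> weighted_norm q xs * weighted_norm q ys"
proof (induction xs)
  case (Cons x xs)
  have "weighted_norm q (series_mult (x # xs) ys)
      \<le> \<bar>real_of_int x\<bar> * weighted_norm q ys + q * weighted_norm q (series_mult xs ys)"
    using weighted_norm_add[OF assms, of "map ((*) x) ys" "0 # series_mult xs ys"]
    by (simp add: weighted_norm_scale)
  also have "\<dots> \<le> \<bar>real_of_int x\<bar> * weighted_norm q ys + q * (weighted_norm q xs * weighted_norm q ys)"
    using mult_left_mono[OF Cons assms] by simp
  also have "\<dots> = weighted_norm q (x # xs) * weighted_norm q ys"
    by (simp add: algebra_simps)
  finally show ?case .
qed simp

lemma weighted_norm_div_step:
  assumes "0 \<le> q"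
  shows "q * weighted_norm q (map2 (+) xs (map ((*) (- x)) ys))
    \<le> \<bar>real_of_int x\<bar> * (q * weighted_norm q ys) + q * weighted_norm q xs"
  using mult_left_mono[OF weighted_norm_add[OF assms, of xs "map ((*) (- x)) ys"] assms]
  by (simp add: weighted_norm_scale algebra_simps)

lemma weighted_norm_div_step_le:
  assumes "0 \<le> q" "q * weighted_norm q ys \<le> 1"
  shows "q * weighted_norm q (map2 (+) xs (map ((*) (- x)) ys)) \<le> weighted_norm q (x # xs)"
  using weighted_norm_div_step[OF assms(1), of xs x ys] mult_left_le[OF assms(2), of "\<bar>real_of_int x\<bar>"]
  by simp

lemma weighted_norm_div:
  assumes "0 \<le> q" "q * weighted_norm q ys \<le> 1"
  shows "weighted_norm q (series_div xs ys) * (1 - q * weighted_norm q ys) \<le> weighted_norm q xs"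
  using assms
proof (induction xs ys rule: series_div.induct)
  case (2 x xs ys)
  let ?s = "q * weighted_norm q ys" and ?h = "map2 (+) xs (map ((*) (- x)) ys)"
  have "weighted_norm q (series_div (x # xs) ys) * (1 - ?s)
      = \<bar>real_of_int x\<bar> * (1 - ?s) + q * (weighted_norm q (series_div ?h ys) * (1 - ?s))"
    by (simp add: algebra_simps)
  also have "\<dots> \<le> \<bar>real_of_int x\<bar> * (1 - ?s) + q * weighted_norm q ?h"
    using mult_left_mono[OF "2.IH"[OF "2.prems"] "2.prems"(1)] by simp
  also have "\<dots> \<le> weighted_norm q (x # xs)"
    using weighted_norm_div_step[OF "2.prems"(1), of xs x ys] by (simp add: right_diff_distrib)
  finally show ?case .
qed simp

lemma abs_le_weighted_norm:
  assumes "0 \<le> q" "q \<le> 1" "x \<in> set xs" "length xs \<le> l"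
  shows "\<bar>real_of_int x\<bar> * q ^ l \<le> weighted_norm q xs"
  using assms(3,4)
proof (induction xs arbitrary: l)
  case (Cons y xs)
  show ?case
  proof (cases "x \<in> set xs")
    case True
    obtain m where l_eq: "l = Suc m" "length xs \<le> m"
      using Cons.prems(2) by (cases l) auto
    have "\<bar>real_of_int x\<bar> * q ^ l = q * (\<bar>real_of_int x\<bar> * q ^ m)"
      by (simp add: l_eq(1))
    also have "\<dots> \<le> q * weighted_norm q xs"
      by (rule mult_left_mono[OF Cons.IH[OF True l_eq(2)] assms(1)])
    finally show ?thesis
      by simp
  next
    case False
    then have "\<bar>real_of_int x\<bar> * q ^ l \<le> \<bar>real_of_int y\<bar>"
      using Cons.prems(1) assms(1,2) by (simp add: mult_left_le power_le_one)
    then show ?thesis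
      using assms(1) by (simp add: add_increasing2 weighted_norm_nonneg)
  qed
qed simp

section \<open>The recursion for the spin ratios\<close>

text \<open>
  With \<open>1 / \<beta> = a / D\<close>, \<open>\<gamma> = g / D\<close> and \<open>x = D y\<close> the normalised weights \<open>x / \<beta> = a y\<close> and \<open>\<gamma> x = g y\<close> are power
  series in \<open>y\<close> with integer coefficients; \<open>K\<close> scales the number of coefficients that are used.
\<close>

locale spin_parameters =
  fixes a g D :: int and K :: nat
begin

definition A_series :: "complex fps" where
  "A_series = fps_const (of_int a) * fps_X"

definition G_series :: "complex fps" where
  "G_series = fps_const (of_int g) * fps_X"

definition pin_product :: "'v \<Rightarrow> ('v \<times> bool) list \<Rightarrow> int list \<Rightarrow> int list" where
  "pin_product v = fold (\<lambda>(u, f) acc. if u = v then monom_mult (if f then g else a) acc else acc)"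

definition edge_step :: "int list \<Rightarrow> int list \<Rightarrow> int list" where
  "edge_step r acc = series_div (series_mult (monom_mult a acc) (1 # map ((*) g) r)) (map ((*) a) r)"

function ratio_coeffs :: "nat \<Rightarrow> 'v \<Rightarrow> ('v \<times> 'v) list \<Rightarrow> ('v \<times> bool) list \<Rightarrow> int list"
  and ratio_loop :: "nat \<Rightarrow> ('v \<times> 'v) list \<Rightarrow> ('v \<times> bool) list \<Rightarrow> 'v list \<Rightarrow> int list \<Rightarrow> int list" where
  "ratio_coeffs 0 v E P = []"
| "ratio_coeffs (Suc k) v E P =
     ratio_loop k (delete_vertex v E) P (neighbours v E) (pin_product v P (1 # replicate k 0))"
| "ratio_loop k E P [] acc = acc"
| "ratio_loop k E P (u # us) acc =
     ratio_loop k E ((u, True) # P) us (edge_step (ratio_coeffs k u E (pin False us @ P)) acc)"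
  by pat_completeness auto
termination
  by (relation "measures [case_sum (\<lambda>(k, v, E, P). k) (\<lambda>(k, E, P, us, acc). k),
        case_sum (\<lambda>(k, v, E, P). 0) (\<lambda>(k, E, P, us, acc). length us)]") auto

text \<open>The series of \<open>Z[\<sigma>(v) = 1] / Z[\<sigma>(v) = 0]\<close>, where \<open>W\<close> is the set of the other vertices that are not pinned to 0.\<close>

definition ratio_series :: "'v set \<Rightarrow> 'v \<Rightarrow> ('v \<times> 'v) list \<Rightarrow> ('v \<times> bool) list \<Rightarrow> complex fps" where
  "ratio_series W v E P =
     partition_sum_at A_series G_series W v E P * inverse (partition_sum A_series G_series W E P)"

text \<open>The factor \<open>x (1 + \<gamma> x R) / (\<beta> + x R)\<close> of an edge to a neighbour with the spin ratio \<open>R\<close>.\<close>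

definition edge_series :: "complex fps \<Rightarrow> complex fps" where
  "edge_series R = A_series * (1 + G_series * R) * inverse (1 + A_series * R)"

lemma A_series_0 [simp]: "fps_nth A_series 0 = 0" and G_series_0 [simp]: "fps_nth G_series 0 = 0"
  by (simp_all add: A_series_def G_series_def)

lemma partition_sum_series_0: "finite W \<Longrightarrow> fps_nth (partition_sum A_series G_series W E P) 0 \<noteq> 0"
  by (simp add: fps_nth_0_partition_sum)

subsection \<open>Correctness of the recursion\<close>

lemma truncates_pin_product:
  "truncates F acc \<Longrightarrow>
   truncates (F * config_weight A_series G_series [] P {v}) (pin_product v P acc)"
proof (induction P arbitrary: F acc)
  case Nil
  then show ?case
    by (simp add: pin_product_def config_weight_simps)
next
  case (Cons q P)
  obtain u f where q_eq: "q = (u, f)"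
    by (cases q)
  define acc' where "acc' = (if u = v then monom_mult (if f then g else a) acc else acc)"
  have "truncates (F * pin_factor A_series G_series {v} q) acc'"
    using Cons.prems truncates_monom_mult[OF Cons.prems]
    by (simp add: acc'_def q_eq A_series_def G_series_def)
  from Cons.IH[OF this] show ?case
    by (simp add: pin_product_def acc'_def q_eq config_weight_simps ac_simps)
qed

lemma truncates_edge_step:
  assumes "truncates R r" "truncates F acc"
  shows "truncates (F * edge_series R) (edge_step r acc)"
proof -
  have "truncates (fps_const (of_int 1) + fps_X * (fps_const (of_int g) * R)) (1 # map ((*) g) r)"
    by (intro truncates_Cons_mult_X truncates_scale assms(1))
  then have "truncates (F * A_series * (1 + fps_X * (fps_const (of_int g) * R))
      * inverse (1 + fps_X * (fps_const (of_int a) * R))) (edge_step r acc)"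
    unfolding edge_step_def A_series_def
    by (intro truncates_div truncates_mult truncates_monom_mult truncates_scale assms) simp
  then show ?thesis
    by (simp add: edge_series_def A_series_def G_series_def ac_simps)
qed

text \<open>Replacing an edge between \<open>u\<close> and a deleted vertex of spin 0 by one to a deleted vertex of spin 1.\<close>

lemma edge_series_flip_pin:
  fixes E P
  assumes "finite W" "u \<notin> W"
  defines "R \<equiv> ratio_series W u E P"
  shows "edge_series R * inverse (partition_sum A_series G_series (insert u W) E ((u, True) # P))
    = A_series * inverse (partition_sum A_series G_series (insert u W) E ((u, False) # P))"
proof -
  define Z where "Z = partition_sum A_series G_series W E P"
  have "inverse Z * Z = 1"
    unfolding Z_def by (intro inverse_mult_eq_1 partition_sum_series_0 assms(1))
  then have "partition_sum A_series G_series (insert u W) E ((u, f) # P)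
      = Z * (1 + (if f then G_series else A_series) * R)" for f
    by (simp add: partition_sum_pin[OF assms(1,2)] R_def ratio_series_def Z_def[symmetric] algebra_simps)
  then show ?thesis
    by (simp add: edge_series_def fps_inverse_mult inverse_mult_eq_1' ac_simps)
qed

lemma ratio_series_delete_vertex:
  assumes "v \<notin> W" "loopless E"
  shows "ratio_series W v E P = config_weight A_series G_series [] P {v} * A_series ^ length (neighbours v E)
    * partition_sum A_series G_series W (delete_vertex v E) (pin True (neighbours v E) @ P)
    * inverse (partition_sum A_series G_series W (delete_vertex v E) (pin False (neighbours v E) @ P))"
  unfolding ratio_series_def partition_sum_at_delete_vertex[OF assms]
  by (simp flip: partition_sum_delete_vertex[OF assms(1)])

lemma truncates_ratio_coeffs:
  "finite W \<Longrightarrow> v \<notin> W \<Longrightarrow> set E \<subseteq> insert v W \<times> insert v W \<Longrightarrow> loopless E \<Longrightarrow>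
   truncates (ratio_series W v E P) (ratio_coeffs k v E P)"
  and truncates_ratio_loop:
  "finite W \<Longrightarrow> set E \<subseteq> W \<times> W \<Longrightarrow> set us \<subseteq> W \<Longrightarrow> loopless E \<Longrightarrow> truncates F acc \<Longrightarrow>
   truncates (F * A_series ^ length us * partition_sum A_series G_series W E (pin True us @ P)
       * inverse (partition_sum A_series G_series W E (pin False us @ P)))
     (ratio_loop k E P us acc)"
proof (induction k v E P and k E P us acc arbitrary: W and W F rule: ratio_coeffs_ratio_loop.induct)
  case (2 k v E P)
  have "truncates (1 * config_weight A_series G_series [] P {v}) (pin_product v P (1 # replicate k 0))"
    by (intro truncates_pin_product truncates_one)
  moreover have "set (delete_vertex v E) \<subseteq> W \<times> W" "set (neighbours v E) \<subseteq> W" "loopless (delete_vertex v E)"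
    using "2.prems"(3,4) by (auto simp: set_delete_vertex set_neighbours)
  ultimately show ?case
    using "2.IH" "2.prems" by (simp add: ratio_series_delete_vertex)
next
  case (3 k E P acc)
  have "partition_sum A_series G_series W E P * inverse (partition_sum A_series G_series W E P) = 1"
    by (rule inverse_mult_eq_1'[OF partition_sum_series_0[OF "3.prems"(1)]])
  then show ?case
    using "3.prems"(5) by (simp add: mult.assoc)
next
  case (4 k E P u us acc)
  define W\<^sub>0 where "W\<^sub>0 = W - {u}"
  have W_eq: "W = insert u W\<^sub>0" "finite W\<^sub>0" "u \<notin> W\<^sub>0"
    using "4.prems"(1,3) by (auto simp: W\<^sub>0_def)
  let ?P = "pin False us @ P" and ?Z = "partition_sum A_series G_series W E"
  define S where "S = edge_series (ratio_series W\<^sub>0 u E ?P)"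
  have "truncates (F * S) (edge_step (ratio_coeffs k u E ?P) acc)"
    unfolding S_def using "4.prems" W_eq by (intro truncates_edge_step "4.IH"(1)) auto
  then have "truncates (F * S * A_series ^ length us * ?Z (pin True us @ (u, True) # P)
      * inverse (?Z (pin False us @ (u, True) # P))) (ratio_loop k E P (u # us) acc)"
    using "4.IH"(2) "4.prems" by auto
  moreover have "?Z (pin f us @ (u, True) # P) = ?Z ((u, True) # pin f us @ P)" for f
    by (simp add: partition_sum_def config_weight_pin_move)
  moreover have "S * inverse (?Z ((u, True) # ?P)) = A_series * inverse (?Z ((u, False) # ?P))"
    unfolding S_def W_eq(1) by (rule edge_series_flip_pin[OF W_eq(2,3)])
  then have "F * S * A_series ^ length us * H * inverse (?Z ((u, True) # ?P))
      = F * A_series ^ length (u # us) * H * inverse (?Z ((u, False) # ?P))" for H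
    by (simp add: ac_simps)
  ultimately show ?case
    by simp
qed auto

end

section \<open>Truncation error\<close>

lemma cmod_fps_nth_le:
  fixes f :: "complex \<Rightarrow> complex"
  assumes expansion: "f has_fps_expansion F" and hol: "f holomorphic_on ball 0 R" and "0 < R"
    and bound: "\<And>z. z \<in> ball 0 R \<Longrightarrow> cmod (f z) \<le> B"
  shows "cmod (fps_nth F n) \<le> B / R ^ n"
proof -
  have "cmod (fps_nth F n) * t ^ n \<le> B" if t_less: "0 < t" "t < R" for t
  proof -
    have "cmod ((deriv ^^ n) f 0) \<le> fact n * B / t ^ n"
    proof (rule Cauchy_inequality)
      show "f holomorphic_on ball 0 t" "continuous_on (cball 0 t) f"
        using t_less by (auto intro!: holomorphic_on_imp_continuous_on holomorphic_on_subset[OF hol])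
    qed (use t_less in \<open>auto intro!: bound\<close>)
    then show ?thesis
      using t_less(1) by (simp add: fps_nth_fps_expansion[OF expansion] norm_divide field_simps)
  qed
  then have "\<forall>\<^sub>F t in at_left R. cmod (fps_nth F n) * t ^ n \<le> B"
    using eventually_at_left_real[OF assms(3)] by (auto elim!: eventually_mono)
  moreover have "((\<lambda>t. cmod (fps_nth F n) * t ^ n) \<longlongrightarrow> cmod (fps_nth F n) * R ^ n) (at_left R)"
    by (intro tendsto_intros)
  ultimately have "cmod (fps_nth F n) * R ^ n \<le> B"
    by (intro tendsto_upperbound) auto
  then show ?thesis
    using assms(3) by (simp add: field_simps)
qed

lemma cmod_fps_tail_le:
  fixes f :: "complex \<Rightarrow> complex"
  assumes expansion: "f has_fps_expansion F" and hol: "f holomorphic_on ball 0 R"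
    and bound: "\<And>z. z \<in> ball 0 R \<Longrightarrow> cmod (f z) \<le> B" and z_less: "cmod z < R"
  shows "cmod (f z - (\<Sum>j<k. fps_nth F j * z ^ j)) \<le> B * ((cmod z / R) ^ k / (1 - cmod z / R))"
proof -
  let ?q = "cmod z / R"
  have R_pos: "0 < R"
    using z_less norm_ge_zero[of z] by linarith
  have "(\<lambda>n. fps_nth F n * z ^ n) sums f z"
    using z_less by (intro has_fps_expansion_imp_sums_complex[OF expansion, of "ereal R"]) (auto simp: hol)
  then have "(\<lambda>n. fps_nth F (n + k) * z ^ (n + k)) sums (f z - (\<Sum>j<k. fps_nth F j * z ^ j))"
    by (rule sums_split_initial_segment)
  moreover have "(\<lambda>n. B * (?q ^ k * ?q ^ n)) sums (B * (?q ^ k * (1 / (1 - ?q))))"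
    using z_less R_pos by (intro sums_mult geometric_sums) auto
  moreover have "cmod (fps_nth F (n + k) * z ^ (n + k)) \<le> B * (?q ^ k * ?q ^ n)" for n
  proof -
    have "cmod (fps_nth F (n + k) * z ^ (n + k)) \<le> B / R ^ (n + k) * cmod z ^ (n + k)"
      unfolding norm_mult norm_power
      by (intro mult_right_mono cmod_fps_nth_le[OF expansion hol R_pos bound]) auto
    then show ?thesis
      by (simp add: power_divide power_add ac_simps)
  qed
  ultimately have "cmod (f z - (\<Sum>j<k. fps_nth F j * z ^ j)) \<le> B * (?q ^ k * (1 / (1 - ?q)))"
    by (rule norm_sums_le)
  then show ?thesis
    by simp
qed

lemma relative_error_prod:
  fixes x y x' y' :: "'a::real_normed_field"
  assumes "norm (y - x) \<le> \<eta> * norm x" "norm (y' - x') \<le> ((1 + \<eta>) ^ n - 1) * norm x'" "0 \<le> \<eta>"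
  shows "norm (y * y' - x * x') \<le> ((1 + \<eta>) ^ Suc n - 1) * norm (x * x')"
proof -
  have norm_y_le: "norm y \<le> (1 + \<eta>) * norm x"
    using norm_triangle_sub[of y x] assms(1) by (simp add: algebra_simps)
  have "norm (y * y' - x * x') = norm (y * (y' - x') + (y - x) * x')"
    by (simp add: algebra_simps)
  also have "\<dots> \<le> norm y * norm (y' - x') + norm (y - x) * norm x'"
    using norm_triangle_ineq[of "y * (y' - x')" "(y - x) * x'"] by (simp add: norm_mult)
  also have "\<dots> \<le> ((1 + \<eta>) * norm x) * (((1 + \<eta>) ^ n - 1) * norm x') + (\<eta> * norm x) * norm x'"
    using norm_y_le assms by (intro add_mono mult_mono) auto
  also have "\<dots> = ((1 + \<eta>) ^ Suc n - 1) * norm (x * x')"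
    by (simp add: norm_mult algebra_simps)
  finally show ?thesis .
qed

definition tail_const :: "real \<Rightarrow> real" where
  "tail_const \<rho> = 1 / (1 - 1 / \<rho>)\<^sup>2"

lemma tail_const_pos: "\<rho> > 1 \<Longrightarrow> tail_const \<rho> > 0"
  by (simp add: tail_const_def)

locale spin_system = spin_parameters +
  fixes \<beta> \<gamma> :: rat and \<rho> :: real
  assumes D_pos: "D > 0" and a_eq: "of_int a * \<beta> = of_int D" and g_eq: "of_int g = \<gamma> * of_int D"
    and \<rho>_gt_1: "\<rho> > 1" and edge: "edge_zero_free (of_rat \<beta>) (of_rat \<gamma>) \<rho>"
    and K_large: "2 * (1 + tail_const \<rho>) \<le> \<rho> ^ K"
begin

sublocale zero_free_partition "of_rat \<beta>" "of_rat \<gamma>" \<rho>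
  using D_pos a_eq \<rho>_gt_1 edge by unfold_locales auto

definition truncated_ratio :: "nat \<Rightarrow> 'v set \<Rightarrow> 'v \<Rightarrow> ('v \<times> 'v) list \<Rightarrow> complex" where
  "truncated_ratio k W v E = (\<Sum>j<k. fps_nth (ratio_series W v E []) j / of_int D ^ j)"

fun truncated_product :: "nat \<Rightarrow> ('v \<times> 'v) list \<Rightarrow> 'v list \<Rightarrow> complex" where
  "truncated_product k E [] = 1"
| "truncated_product k E (v # vs) = (1 + truncated_ratio k (set vs) v E) * truncated_product k E vs"

lemma scaled_weights:
  "of_int D * y / of_rat \<beta> = complex_of_int a * y" "of_rat \<gamma> * (of_int D * y) = complex_of_int g * y"
proof -
  have "complex_of_int D = of_int a * of_rat \<beta>"
    using arg_cong[OF a_eq, of "of_rat :: rat \<Rightarrow> complex"] by (simp add: of_rat_mult)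
  then show "of_int D * y / of_rat \<beta> = complex_of_int a * y"
    using \<beta>_nonzero by simp
  have "complex_of_int g = of_rat \<gamma> * of_int D"
    using arg_cong[OF g_eq, of "of_rat :: rat \<Rightarrow> complex"] by (simp add: of_rat_mult)
  then show "of_rat \<gamma> * (of_int D * y) = complex_of_int g * y"
    by simp
qed

lemma has_fps_expansion_config_weight:
  "(\<lambda>y. config_weight (of_int a * y) (of_int g * y) E [] T)
     has_fps_expansion config_weight A_series G_series E [] T"
proof (induction E)
  case (Cons e E)
  have "(\<lambda>y. of_int a * y) has_fps_expansion A_series" "(\<lambda>y. of_int g * y) has_fps_expansion G_series"
    unfolding A_series_def G_series_def by (intro fps_expansion_intros)+
  then have "(\<lambda>y. edge_factor (of_int a * y) (of_int g * y) T e)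
      has_fps_expansion edge_factor A_series G_series T e"
    by (cases e) (auto intro!: fps_expansion_intros)
  then show ?case
    unfolding config_weight_simps by (intro fps_expansion_intros Cons)
qed (simp add: config_weight_simps)

lemma has_fps_expansion_spin_ratio:
  assumes "finite W"
  shows "(\<lambda>y. spin_ratio W v E (of_int D * y)) has_fps_expansion ratio_series W v E []"
  unfolding spin_ratio_def spin_sum_def scaled_weights ratio_series_def
    divide_inverse[of "partition_sum_at _ _ _ _ _ _"]
  using partition_sum_series_0[OF assms, of E "[]"]
  unfolding partition_sum_def partition_sum_at_def
  by (intro fps_expansion_intros has_fps_expansion_config_weight)

lemma truncated_ratio_error:
  assumes "finite V" "set E \<subseteq> V \<times> V" "insert v W \<subseteq> V" "v \<notin> W"
  shows "cmod (spin_ratio W v E 1 - truncated_ratio k W v E) \<le> (1 / \<rho>) ^ k / (1 - 1 / \<rho>)"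
proof -
  let ?D = "complex_of_int D" and ?f = "\<lambda>y. spin_ratio W v E (of_int D * y)"
  have in_ball: "?D * y \<in> ball 0 \<rho>" if "y \<in> ball 0 (\<rho> / D)" for y
    using that D_pos by (simp add: norm_mult field_simps)
  have "finite W"
    using assms(1,3) by (auto intro: finite_subset)
  moreover have "?f holomorphic_on ball 0 (\<rho> / D)"
    by (rule holomorphic_on_compose_gen[OF _ holomorphic_spin_ratio[OF assms], unfolded comp_def])
      (use in_ball in \<open>auto intro!: holomorphic_intros\<close>)
  moreover have "cmod (?f y) \<le> 1" if "y \<in> ball 0 (\<rho> / D)" for y
    using cmod_spin_ratio_le_1[OF assms, of "?D * y"] in_ball[OF that] by simp
  moreover have "cmod (1 / ?D) < \<rho> / D"
    using D_pos \<rho>_gt_1 by (simp add: norm_divide divide_strict_right_mono)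
  ultimately have "cmod (?f (1 / ?D) - (\<Sum>j<k. fps_nth (ratio_series W v E []) j * (1 / ?D) ^ j))
      \<le> 1 * ((cmod (1 / ?D) / (\<rho> / D)) ^ k / (1 - cmod (1 / ?D) / (\<rho> / D)))"
    by (intro cmod_fps_tail_le has_fps_expansion_spin_ratio)
  moreover have "(\<Sum>j<k. fps_nth (ratio_series W v E []) j * (1 / ?D) ^ j) = truncated_ratio k W v E"
    by (simp add: truncated_ratio_def power_one_over)
  moreover have "cmod (1 / ?D) / (\<rho> / D) = 1 / \<rho>" "?D * (1 / ?D) = 1"
    using D_pos by (simp_all add: norm_divide)
  ultimately show ?thesis
    by (simp only: mult_1)
qed

theorem truncated_product_error:
  assumes "finite V" "set E \<subseteq> V \<times> V" "set vs \<subseteq> V" "distinct vs"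
  shows "cmod (truncated_product k E vs - spin_sum (set vs) E 1)
     \<le> ((1 + tail_const \<rho> * (1 / \<rho>) ^ k) ^ length vs - 1) * cmod (spin_sum (set vs) E 1)"
  using assms(3,4)
proof (induction vs)
  case Nil
  then show ?case
    by (simp add: spin_sum_def partition_sum_def)
next
  case (Cons v vs)
  let ?W = "set vs" and ?\<eta> = "tail_const \<rho> * (1 / \<rho>) ^ k"
  let ?R = "spin_ratio ?W v E 1" and ?R' = "truncated_ratio k ?W v E"
  have v_vs: "insert v ?W \<subseteq> V" "v \<notin> ?W" and one_less: "cmod 1 < \<rho>"
    using Cons.prems \<rho>_gt_1 by auto
  have "cmod ((1 + ?R') - (1 + ?R)) = cmod (?R - ?R')"
    by (simp add: norm_minus_commute)
  also have "\<dots> \<le> (1 / \<rho>) ^ k / (1 - 1 / \<rho>)"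
    by (rule truncated_ratio_error[OF assms(1,2) v_vs])
  also have "\<dots> = ?\<eta> * (1 - 1 / \<rho>)"
    using \<rho>_gt_1 by (simp add: tail_const_def power2_eq_square)
  also have "\<dots> \<le> ?\<eta> * cmod (1 + ?R)"
    using cmod_one_plus_spin_ratio_ge[OF assms(1,2) v_vs one_less] tail_const_pos[OF \<rho>_gt_1] \<rho>_gt_1
    by (intro mult_left_mono) auto
  finally have "cmod ((1 + ?R') - (1 + ?R)) \<le> ?\<eta> * cmod (1 + ?R)" .
  moreover have "cmod (truncated_product k E vs - spin_sum ?W E 1)
      \<le> ((1 + ?\<eta>) ^ length vs - 1) * cmod (spin_sum ?W E 1)"
    using Cons by auto
  moreover have "0 \<le> ?\<eta>"
    using tail_const_pos[OF \<rho>_gt_1] \<rho>_gt_1 by simp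
  ultimately show ?case
    unfolding truncated_product.simps list.set spin_sum_insert[OF assms(1,2) v_vs one_less]
      list.size(4) add_Suc_right add_0_right
    by (rule relative_error_prod)
qed

end

section \<open>Accuracy of the truncated product\<close>

abbreviation bit_length :: "nat \<Rightarrow> nat" where
  "bit_length \<equiv> floorlog 2"

lemma bit_length_0 [simp]: "bit_length 0 = 0"
  by (simp add: floorlog_eq_zero_iff)

lemma bit_length_unfold: "n > 0 \<Longrightarrow> bit_length n = Suc (bit_length (n div 2))"
  by (subst compute_floorlog) simp

lemma less_two_power_bit_length: "n < 2 ^ bit_length n"
  by (rule floorlog_leD) auto

lemma bit_length_le: "n < 2 ^ b \<Longrightarrow> bit_length n \<le> b"
  by (rule floorlog_leI) auto

lemma bit_length_le_self: "bit_length n \<le> n"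
  by (intro bit_length_le less_exp)

lemma two_power_bit_length_le: "n > 0 \<Longrightarrow> 2 ^ bit_length n \<le> 2 * n"
  using floorlog_bounds[of n 2] by (cases "bit_length n") auto

lemma bit_length_div_power: "bit_length (n div 2 ^ k) = bit_length n - k"
proof (induction k arbitrary: n)
  case (Suc k)
  have "n div 2 ^ Suc k = n div 2 div 2 ^ k"
    by (simp add: div_mult2_eq)
  then show ?case
    using Suc[of "n div 2"] by (cases "n = 0") (auto simp: bit_length_unfold[of n])
qed simp

lemma one_plus_power_le:
  fixes \<eta> :: real
  assumes "0 \<le> \<eta>" "real n * \<eta> \<le> 1"
  shows "(1 + \<eta>) ^ n - 1 \<le> 2 * (real n * \<eta>)"
proof -
  let ?x = "real n * \<eta>"
  have "(1 + \<eta>) ^ n \<le> exp \<eta> ^ n"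
    using assms(1) exp_ge_add_one_self[of \<eta>] by (intro power_mono) auto
  also have "\<dots> = exp ?x"
    by (simp add: exp_of_nat_mult)
  also have "\<dots> \<le> 1 + ?x + ?x\<^sup>2"
    using assms by (intro exp_bound) auto
  also have "?x\<^sup>2 \<le> ?x"
    using assms by (simp add: power2_eq_square mult_left_le)
  finally show ?thesis
    by (simp add: algebra_simps)
qed

lemma inverse_power_bit_length_diff_le:
  assumes "p > 0" "q > 0"
  shows "1 / 2 ^ Suc (bit_length q - bit_length p) \<le> real p / real q"
proof -
  let ?d = "bit_length q - bit_length p"
  have "q < 2 ^ bit_length q"
    by (rule less_two_power_bit_length)
  also have "\<dots> \<le> 2 ^ (?d + bit_length p)"
    by (intro power_increasing) auto
  also have "\<dots> = 2 ^ ?d * 2 ^ bit_length p"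
    by (rule power_add)
  also have "\<dots> \<le> 2 ^ ?d * (2 * p)"
    using assms by (intro mult_left_mono two_power_bit_length_le) auto
  finally have "real q \<le> real (2 ^ Suc ?d * p)"
    by (simp only: of_nat_le_iff) simp
  then show ?thesis
    using assms by (simp add: field_simps)
qed

lemma one_plus_power_error_le:
  fixes \<eta> :: real
  assumes "0 \<le> \<eta>" "\<eta> \<le> 1 / 2 ^ (bit_length n + (bit_length q - bit_length p) + 3)" "p > 0" "q > 0"
  shows "(1 + \<eta>) ^ n - 1 \<le> real p / real q"
proof -
  let ?d = "bit_length q - bit_length p"
  have "real n \<le> real (2 ^ bit_length n)"
    by (simp only: of_nat_le_iff less_imp_le less_two_power_bit_length)
  then have "real n * \<eta> \<le> 2 ^ bit_length n * (1 / 2 ^ (bit_length n + ?d + 3))"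
    using assms(1,2) by (intro mult_mono) auto
  also have "\<dots> = 1 / 2 ^ (?d + 3)"
    by (simp add: power_add)
  finally have "real n * \<eta> \<le> 1 / 2 ^ (?d + 3)" .
  moreover have "1 / 2 ^ (?d + 3) \<le> (1::real)"
    by simp
  ultimately have "(1 + \<eta>) ^ n - 1 \<le> 2 * (1 / 2 ^ (?d + 3))"
    using one_plus_power_le[of \<eta> n] assms(1) by linarith
  also have "\<dots> \<le> 1 / 2 ^ Suc ?d"
    by (simp add: power_add divide_simps)
  also have "\<dots> \<le> real p / real q"
    by (rule inverse_power_bit_length_diff_le[OF assms(3,4)])
  finally show ?thesis .
qed

lemma geometric_le_inverse_power:
  fixes C \<rho> :: real
  assumes "\<rho> > 1" "C > 0" "2 * (1 + C) \<le> \<rho> ^ K" "Q > 0"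
  shows "C * (1 / \<rho>) ^ (K * Q) \<le> 1 / 2 ^ Q"
proof -
  have "C * 2 ^ Q \<le> (1 + C) ^ Q * 2 ^ Q"
    using assms(2,4) self_le_power[of "1 + C" Q] by (intro mult_right_mono) auto
  also have "\<dots> = (2 * (1 + C)) ^ Q"
    by (simp only: power_mult_distrib mult.commute)
  also have "\<dots> \<le> (\<rho> ^ K) ^ Q"
    using assms by (intro power_mono) auto
  finally show ?thesis
    using assms(1) by (simp add: power_mult power_one_over field_simps)
qed

context spin_parameters
begin

text \<open>The number of coefficients that suffice for \<open>n\<close> vertices and the accuracy \<open>p / q\<close>.\<close>

definition num_coeffs :: "nat \<Rightarrow> nat \<Rightarrow> nat \<Rightarrow> nat" where
  "num_coeffs n p q = K * (bit_length n + (bit_length q - bit_length p) + 3)"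

end

lemma (in spin_system) truncated_product_accuracy:
  assumes "finite V" "set E \<subseteq> V \<times> V" "set vs \<subseteq> V" "distinct vs" "p > 0" "q > 0"
  shows "cmod (truncated_product (num_coeffs (length vs) p q) E vs - spin_sum (set vs) E 1)
     \<le> real p / real q * cmod (spin_sum (set vs) E 1)"
proof -
  have C_pos: "tail_const \<rho> > 0"
    by (rule tail_const_pos[OF \<rho>_gt_1])
  have "(1 + tail_const \<rho> * (1 / \<rho>) ^ num_coeffs (length vs) p q) ^ length vs - 1 \<le> real p / real q"
    using \<rho>_gt_1 C_pos assms(5,6) geometric_le_inverse_power[OF \<rho>_gt_1 C_pos K_large]
    by (intro one_plus_power_error_le) (auto simp: num_coeffs_def)
  then show ?thesis
    using truncated_product_error[OF assms(1-4)] by (meson mult_right_mono norm_ge_zero order_trans)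
qed

section \<open>The approximating fraction\<close>

context spin_parameters
begin

fun horner :: "int list \<Rightarrow> int \<times> int" where
  "horner [] = (0, 1)"
| "horner (x # xs) = (case horner xs of (n, d) \<Rightarrow> (x * (d * D) + n, d * D))"

fun ratio_product ::
    "nat \<Rightarrow> ('v \<times> 'v) list \<Rightarrow> ('v \<times> bool) list \<Rightarrow> 'v list \<Rightarrow> int \<Rightarrow> int \<Rightarrow> int \<times> int" where
  "ratio_product k E P [] num den = (num, den)"
| "ratio_product k E P (v # vs) num den =
     (case horner (ratio_coeffs k v E P) of (n, d) \<Rightarrow>
        ratio_product k (delete_vertex v E) (pin False (neighbours v E) @ P) vs (num * (d + n)) (den * d))"

definition approx_fraction :: "nat \<Rightarrow> 'v list \<Rightarrow> ('v \<times> 'v) list \<Rightarrow> int \<times> int" where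
  "approx_fraction k vs es =
     ratio_product k (proper_edges es) (loop_pins es) vs ((sgn a * D) ^ length es) (\<bar>a\<bar> ^ length es)"

lemma length_edge_step: "length acc = Suc (length r) \<Longrightarrow> length (edge_step r acc) = Suc (length r)"
  unfolding edge_step_def by (subst length_series_div) simp_all

lemma length_pin_product [simp]: "length (pin_product v P acc) = length acc"
  by (induction P arbitrary: acc) (auto simp: pin_product_def)

lemma length_ratio_coeffs [simp]: "length (ratio_coeffs k v E P) = k"
  and length_ratio_loop: "length acc = Suc k \<Longrightarrow> length (ratio_loop k E P us acc) = Suc k"
  by (induction k v E P and k E P us acc rule: ratio_coeffs_ratio_loop.induct)
    (simp_all add: length_edge_step)

lemma ratio_series_cong:
  assumes "\<And>T. T \<subseteq> insert v W \<Longrightarrow>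
    config_weight A_series G_series E' P T = config_weight A_series G_series E [] T"
  shows "ratio_series W v E' P = ratio_series W v E []"
proof -
  have "partition_sum_at A_series G_series W v E' P = partition_sum_at A_series G_series W v E []"
    unfolding partition_sum_at_def by (intro sum.cong refl assms) auto
  moreover have "partition_sum A_series G_series W E' P = partition_sum A_series G_series W E []"
    unfolding partition_sum_def by (intro sum.cong refl assms) auto
  ultimately show ?thesis
    by (simp add: ratio_series_def)
qed

end

context spin_system
begin

lemma horner_value:
  assumes "horner xs = (n, d)"
  shows "d > 0" "complex_of_int n / of_int d = (\<Sum>j<length xs. of_int (xs ! j) / of_int D ^ j)"
proof -
  have "d > 0 \<and> complex_of_int n / of_int d = (\<Sum>j<length xs. of_int (xs ! j) / of_int D ^ j)"
    using assms
  proof (induction xs arbitrary: n d)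
    case (Cons x xs)
    obtain n' d' where horner_eq: "horner xs = (n', d')"
      by (cases "horner xs")
    have d'_pos: "d' > 0"
      and IH: "complex_of_int n' / of_int d' = (\<Sum>j<length xs. of_int (xs ! j) / of_int D ^ j)"
      using Cons.IH[OF horner_eq] by auto
    have nd_eq: "n = x * (d' * D) + n'" "d = d' * D"
      using Cons.prems by (auto simp: horner_eq)
    have "(\<Sum>j<length (x # xs). complex_of_int ((x # xs) ! j) / of_int D ^ j)
        = of_int x + (\<Sum>j<length xs. of_int (xs ! j) / of_int D ^ j) / of_int D"
      by (simp add: sum.lessThan_Suc_shift sum_divide_distrib field_simps del: sum.lessThan_Suc)
    also have "\<dots> = of_int n / of_int d"
      unfolding IH[symmetric] nd_eq using d'_pos D_pos by (simp add: field_simps)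
    finally show ?case
      using d'_pos D_pos by (simp add: nd_eq(2))
  qed auto
  then show "d > 0" "complex_of_int n / of_int d = (\<Sum>j<length xs. of_int (xs ! j) / of_int D ^ j)"
    by auto
qed

lemma horner_ratio_coeffs:
  assumes "finite W" "v \<notin> W" "set E \<subseteq> insert v W \<times> insert v W" "loopless E"
    and horner_eq: "horner (ratio_coeffs k v E P) = (n, d)"
  shows "complex_of_int n / of_int d = (\<Sum>j<k. fps_nth (ratio_series W v E P) j / of_int D ^ j)"
proof -
  have "truncates (ratio_series W v E P) (ratio_coeffs k v E P)"
    by (rule truncates_ratio_coeffs[OF assms(1-4)])
  then show ?thesis
    unfolding horner_value(2)[OF horner_eq] by (simp add: truncates_def)
qed

lemma ratio_product_value:
  assumes "distinct vs" "set E' \<subseteq> set vs \<times> set vs" "loopless E'" "den > 0"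
    and "\<And>T. T \<subseteq> set vs \<Longrightarrow>
      config_weight A_series G_series E' P T = config_weight A_series G_series E [] T"
    and "ratio_product k E' P vs num den = (n, d)"
  shows "d > 0 \<and> complex_of_int n / of_int d = of_int num / of_int den * truncated_product k E vs"
  using assms
proof (induction vs arbitrary: E' P num den)
  case (Cons v vs)
  obtain m e where horner_eq: "horner (ratio_coeffs k v E' P) = (m, e)"
    by (cases "horner (ratio_coeffs k v E' P)")
  have "ratio_series (set vs) v E' P = ratio_series (set vs) v E []"
    using Cons.prems(5) by (intro ratio_series_cong) auto
  then have "complex_of_int m / of_int e = truncated_ratio k (set vs) v E"
    using horner_ratio_coeffs[OF _ _ _ _ horner_eq, of "set vs"] Cons.prems
    by (auto simp: truncated_ratio_def)
  moreover have e_pos: "e > 0"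
    by (rule horner_value(1)[OF horner_eq])
  ultimately have factor: "complex_of_int (e + m) / of_int e = 1 + truncated_ratio k (set vs) v E"
    by (simp add: add_divide_distrib)
  have "config_weight A_series G_series (delete_vertex v E') (pin False (neighbours v E') @ P) T
      = config_weight A_series G_series E [] T" if "T \<subseteq> set vs" for T
  proof -
    have "v \<notin> T" "T \<subseteq> set (v # vs)"
      using that Cons.prems(1) by auto
    then show ?thesis
      using Cons.prems(5) by (simp flip: config_weight_delete_vertex)
  qed
  then have "d > 0 \<and> complex_of_int n / of_int d
      = of_int (num * (e + m)) / of_int (den * e) * truncated_product k E vs"
    using Cons.prems e_pos by (intro Cons.IH) (auto simp: set_delete_vertex horner_eq)
  moreover have "complex_of_int (num * (e + m)) / of_int (den * e)
      = of_int num / of_int den * (complex_of_int (e + m) / of_int e)"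
    by simp
  ultimately show ?case
    by (simp only: factor truncated_product.simps mult.assoc)
qed simp

lemma approx_fraction_value:
  assumes "distinct vs" "set es \<subseteq> set vs \<times> set vs" "approx_fraction k vs es = (n, d)"
  shows "d > 0 \<and> complex_of_int n / of_int d = of_rat \<beta> ^ length es * truncated_product k es vs"
proof -
  have a_nonzero: "a \<noteq> 0"
    using a_eq D_pos by auto
  have "set (proper_edges es) \<subseteq> set vs \<times> set vs"
    using assms(2) by (auto simp: proper_edges_def)
  then have "d > 0 \<and> complex_of_int n / of_int d
      = of_int ((sgn a * D) ^ length es) / of_int (\<bar>a\<bar> ^ length es) * truncated_product k es vs"
    by (rule ratio_product_value[OF assms(1) _ loopless_proper_edges _ config_weight_proper_edges
          assms(3)[unfolded approx_fraction_def]]) (use a_nonzero in simp)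
  moreover have "of_rat \<beta> = complex_of_int (sgn a * D) / of_int \<bar>a\<bar>"
    using arg_cong[OF a_eq, of "of_rat :: rat \<Rightarrow> complex"] a_nonzero
    by (cases "a > 0") (auto simp: of_rat_mult field_simps sgn_if)
  ultimately show ?thesis
    by (simp add: power_divide)
qed

end

section \<open>The partition function of a multigraph\<close>

lemma sum_PiE_zero_one:
  assumes "finite V"
  shows "(\<Sum>\<sigma>\<in>V \<rightarrow>\<^sub>E {0, 1::nat}. f \<sigma>) = (\<Sum>T\<in>Pow V. f (\<lambda>v\<in>V. of_bool (v \<in> T)))"
proof (rule sum.reindex_bij_witness[where i = "\<lambda>T. \<lambda>v\<in>V. of_bool (v \<in> T)" and j = "\<lambda>\<sigma>. {v \<in> V. \<sigma> v = 1}"])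
  fix \<sigma> assume "\<sigma> \<in> V \<rightarrow>\<^sub>E {0, 1::nat}"
  then show "(\<lambda>v\<in>V. of_bool (v \<in> {v \<in> V. \<sigma> v = 1})) = \<sigma>"
    by (intro ext) (auto simp: PiE_iff extensional_def)
  then show "f (\<lambda>v\<in>V. of_bool (v \<in> {v \<in> V. \<sigma> v = 1})) = f \<sigma>"
    by simp
qed (auto split: if_splits)

definition enumerates_edges :: "('a \<times> 'a) list \<Rightarrow> 'a multigraph \<Rightarrow> bool" where
  "enumerates_edges es G \<longleftrightarrow> mset (map (\<lambda>(u, v). Upair u v) es) = edges G"

lemma enumerates_edges_subset:
  assumes "wf_multigraph G" "enumerates_edges es G"
  shows "set es \<subseteq> verts G \<times> verts G"
proof
  fix e assume e_in: "e \<in> set es"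
  obtain u v where e_eq: "e = (u, v)"
    by (cases e)
  have "Upair u v \<in># edges G"
    using e_in unfolding assms(2)[unfolded enumerates_edges_def, symmetric] e_eq by force
  then show "e \<in> verts G \<times> verts G"
    using assms(1) by (auto simp: wf_multigraph_def e_eq)
qed

lemma partition_function_eq_sum_spin_weight:
  assumes "wf_multigraph G" "enumerates_edges es G"
  shows "partition_function \<beta> \<gamma> G = (\<Sum>T\<in>Pow (verts G). \<Prod>e\<leftarrow>es. spin_weight \<beta> \<gamma> T e)"
proof -
  let ?V = "verts G"
  have "(\<Prod>e\<in>#edges G. edge_weight \<beta> \<gamma> (\<lambda>v\<in>?V. of_bool (v \<in> T)) e) = (\<Prod>e\<leftarrow>es. spin_weight \<beta> \<gamma> T e)" for T
  proof -
    let ?\<sigma> = "\<lambda>v\<in>?V. of_bool (v \<in> T) :: nat"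
    have "(\<Prod>e\<in>#edges G. edge_weight \<beta> \<gamma> ?\<sigma> e)
        = (\<Prod>e\<leftarrow>es. edge_weight \<beta> \<gamma> ?\<sigma> (case e of (u, v) \<Rightarrow> Upair u v))"
      unfolding assms(2)[unfolded enumerates_edges_def, symmetric]
      by (simp only: prod_mset_prod_list mset_map[symmetric] map_map comp_def)
    also have "map (\<lambda>e. edge_weight \<beta> \<gamma> ?\<sigma> (case e of (u, v) \<Rightarrow> Upair u v)) es = map (spin_weight \<beta> \<gamma> T) es"
      using enumerates_edges_subset[OF assms] by (intro map_cong) (auto simp: interaction_def)
    finally show ?thesis .
  qed
  moreover have "finite ?V"
    using assms(1) by (simp add: wf_multigraph_def)
  ultimately show ?thesis
    by (simp only: partition_function_def sum_PiE_zero_one)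
qed

lemma partition_function_swap:
  assumes "wf_multigraph G"
  shows "partition_function \<beta> \<gamma> G = partition_function \<gamma> \<beta> G"
proof -
  let ?flip = "\<lambda>\<sigma>. \<lambda>v\<in>verts G. 1 - \<sigma> v :: nat"
  have flip_flip: "?flip (?flip \<sigma>) = \<sigma>" if "\<sigma> \<in> verts G \<rightarrow>\<^sub>E {0, 1::nat}" for \<sigma>
    using that by (intro ext) (auto simp: PiE_iff extensional_def)
  have "edge_weight \<gamma> \<beta> (?flip \<sigma>) e = edge_weight \<beta> \<gamma> \<sigma> e"
    if "\<sigma> \<in> verts G \<rightarrow>\<^sub>E {0, 1}" "e \<in># edges G" for \<sigma> e
  proof (cases e)
    case (Upair u v)
    then have "u \<in> verts G" "v \<in> verts G"
      using that(2) assms by (auto simp: wf_multigraph_def)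
    then show ?thesis
      using PiE_mem[OF that(1), of u] PiE_mem[OF that(1), of v] by (auto simp: Upair interaction_def)
  qed
  then have "(\<Prod>e\<in>#edges G. edge_weight \<gamma> \<beta> (?flip \<sigma>) e) = (\<Prod>e\<in>#edges G. edge_weight \<beta> \<gamma> \<sigma> e)"
    if "\<sigma> \<in> verts G \<rightarrow>\<^sub>E {0, 1}" for \<sigma>
    using that by (intro arg_cong[where f = prod_mset] image_mset_cong)
  moreover have "?flip \<sigma> \<in> verts G \<rightarrow>\<^sub>E {0, 1}" for \<sigma>
    by auto
  ultimately show ?thesis
    unfolding partition_function_def
    by (intro sum.reindex_bij_witness[where i = ?flip and j = ?flip] flip_flip)
qed

lemma of_rat_prod_list: "of_rat (prod_list xs) = (\<Prod>x\<leftarrow>xs. of_rat x)"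
  by (induction xs) (auto simp: of_rat_mult)

lemma of_rat_spin_weight: "of_rat (spin_weight \<beta> \<gamma> T e) = spin_weight (of_rat \<beta>) (of_rat \<gamma>) T e"
  by (cases e) auto

lemma of_real_of_rat: "of_real (of_rat q) = (of_rat q :: 'a::{real_field, field_char_0})"
  by (cases q) (simp add: of_rat_rat)

context spin_system
begin

lemma of_rat_partition_function:
  assumes "wf_multigraph G" "enumerates_edges es G"
  shows "of_rat (partition_function \<beta> \<gamma> G) = of_rat \<beta> ^ length es * spin_sum (verts G) es 1"
proof -
  have "of_rat (\<Prod>e\<leftarrow>es. spin_weight \<beta> \<gamma> T e)
      = of_rat \<beta> ^ length es * config_weight (1 / of_rat \<beta>) (of_rat \<gamma> * 1 :: complex) es [] T"
    if "T \<in> Pow (verts G)" for T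
  proof -
    have "finite T"
      using that assms(1) by (auto simp: wf_multigraph_def intro: finite_subset)
    then show ?thesis
      using prod_spin_weight_eq_config_weight[OF \<beta>_nonzero, of T "of_rat \<gamma>" es 1]
      by (simp add: of_rat_prod_list of_rat_spin_weight comp_def)
  qed
  then show ?thesis
    by (simp add: partition_function_eq_sum_spin_weight[OF assms] of_rat_sum spin_sum_def
        partition_sum_def sum_distrib_left)
qed

theorem approx_fraction_accurate:
  assumes "wf_multigraph G" "enumerates_edges es G" "distinct vs" "set vs = verts G" "p > 0" "q > 0"
    and "approx_fraction (num_coeffs (length vs) p q) vs es = (n, d)"
  shows "d > 0"
    "\<bar>of_int n / of_int d - partition_function \<beta> \<gamma> G\<bar> \<le> of_nat p / of_nat q * \<bar>partition_function \<beta> \<gamma> G\<bar>"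
proof -
  let ?F = "partition_function \<beta> \<gamma> G" and ?z = "of_int n / of_int d :: rat"
    and ?b = "of_rat \<beta> ^ length es :: complex"
    and ?t = "truncated_product (num_coeffs (length vs) p q) es vs"
  have es_subset: "set es \<subseteq> set vs \<times> set vs"
    using enumerates_edges_subset[OF assms(1,2)] assms(4) by simp
  have fraction_eq: "d > 0" "complex_of_int n / of_int d = ?b * ?t"
    using approx_fraction_value[OF assms(3) es_subset assms(7)] by auto
  have F_eq: "of_rat ?F = ?b * spin_sum (set vs) es 1"
    unfolding assms(4) by (rule of_rat_partition_function[OF assms(1,2)])
  have norm_of_rat: "cmod (of_rat r) = of_rat \<bar>r\<bar>" for r
    by (metis abs_of_rat norm_of_real of_real_of_rat)
  have "of_rat \<bar>?z - ?F\<bar> = cmod (?b * (?t - spin_sum (set vs) es 1))"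
    unfolding norm_of_rat[symmetric] of_rat_diff of_rat_divide of_rat_of_int_eq
      fraction_eq(2) F_eq right_diff_distrib ..
  also have "\<dots> \<le> cmod ?b * (real p / real q * cmod (spin_sum (set vs) es 1))"
    unfolding norm_mult using es_subset assms(3,5,6)
    by (intro mult_left_mono truncated_product_accuracy[of "set vs"]) auto
  also have "\<dots> = real p / real q * cmod (of_rat ?F)"
    unfolding F_eq norm_mult by simp
  also have "\<dots> = of_rat (of_nat p / of_nat q * \<bar>?F\<bar>)"
    unfolding norm_of_rat by (simp add: of_rat_mult of_rat_divide)
  finally show "\<bar>?z - ?F\<bar> \<le> of_nat p / of_nat q * \<bar>?F\<bar>"
    unfolding of_rat_less_eq .
  show "d > 0"
    by (rule fraction_eq(1))
qed

end

section \<open>Evaluation as a partial function\<close>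

definition the_option :: "('a \<Rightarrow> bool) \<Rightarrow> 'a option" where
  "the_option R = (if \<exists>x. R x then Some (THE x. R x) else None)"

lemma the_option_eq_Some_iff:
  assumes "\<And>x y. R x \<Longrightarrow> R y \<Longrightarrow> x = y"
  shows "the_option R = Some x \<longleftrightarrow> R x"
proof -
  have "(THE x. R x) = x" if "R x" for x
    using that by (intro the_equality assms)
  then show ?thesis
    by (auto simp: the_option_def)
qed

definition exec :: "program \<Rightarrow> data list \<Rightarrow> expr \<Rightarrow> (nat \<times> data) option" where
  "exec p env e = the_option (\<lambda>(t, y). eval p env e t y)"

definition exec_list :: "program \<Rightarrow> data list \<Rightarrow> expr list \<Rightarrow> (nat \<times> data list) option" where
  "exec_list p env es = the_option (\<lambda>(t, ys). evals p env es t ys)"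

lemma exec_eq_Some_iff: "exec p env e = Some (t, y) \<longleftrightarrow> eval p env e t y"
  unfolding exec_def by (subst the_option_eq_Some_iff) (auto dest: eval_deterministic(1))

lemma exec_list_eq_Some_iff: "exec_list p env es = Some (t, ys) \<longleftrightarrow> evals p env es t ys"
  unfolding exec_list_def by (subst the_option_eq_Some_iff) (auto dest: eval_deterministic(2))

lemma eval_iff:
  "eval p env (Var i) r z \<longleftrightarrow> i < length env \<and> r = 1 \<and> z = env ! i"
  "eval p env Nil_E r z \<longleftrightarrow> r = 1 \<and> z = Atom"
  "eval p env (Cons_E a b) r z \<longleftrightarrow>
     (\<exists>s t x y. eval p env a s x \<and> eval p env b t y \<and> r = s + t + 1 \<and> z = Cell x y)"
  "eval p env (Hd_E a) r z \<longleftrightarrow> (\<exists>t x. eval p env a t x \<and> r = t + 1 \<and> z = left x)"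
  "eval p env (Tl_E a) r z \<longleftrightarrow> (\<exists>t x. eval p env a t x \<and> r = t + 1 \<and> z = right x)"
  "eval p env (If_E c a b) r z \<longleftrightarrow>
     (\<exists>s t x. eval p env c s x \<and> x \<noteq> Atom \<and> eval p env a t z \<and> r = s + t + 1) \<or>
     (\<exists>s t. eval p env c s Atom \<and> eval p env b t z \<and> r = s + t + 1)"
  "eval p env (Let_E a b) r z \<longleftrightarrow>
     (\<exists>s t x. eval p env a s x \<and> eval p (x # env) b t z \<and> r = s + t + 1)"
  "eval p env (Call_E f es) r z \<longleftrightarrow>
     (\<exists>s t xs. evals p env es s xs \<and> f < length p \<and> eval p xs (p ! f) t z \<and> r = s + t + 1)"
  "evals p env [] r zs \<longleftrightarrow> r = 0 \<and> zs = []"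
  "evals p env (a # es) r zs \<longleftrightarrow>
     (\<exists>s t x xs. eval p env a s x \<and> evals p env es t xs \<and> r = s + t \<and> zs = x # xs)"
  by (auto elim!: eval_VarE eval_NilE eval_ConsE eval_HdE eval_TlE eval_IfE eval_LetE eval_CallE
        evals_NilE evals_ConsE
      intro: eval_evals.intros eval_evals.intros[simplified])

lemma option_pair_eqI:
  assumes "\<And>t y. u = Some (t, y) \<longleftrightarrow> v = Some (t, y)"
  shows "u = v"
  using assms by (metis not_Some_eq surj_pair)

lemmas exec_iff = eval_iff[folded exec_eq_Some_iff exec_list_eq_Some_iff]

lemma exec_simps:
  "exec p env (Var i) = (if i < length env then Some (1, env ! i) else None)"
  "exec p env Nil_E = Some (1, Atom)"
  "exec p env (Cons_E a b) =
     (case exec p env a of None \<Rightarrow> None | Some (s, x) \<Rightarrow>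
       (case exec p env b of None \<Rightarrow> None | Some (t, y) \<Rightarrow> Some (s + t + 1, Cell x y)))"
  "exec p env (Hd_E a) = (case exec p env a of None \<Rightarrow> None | Some (t, x) \<Rightarrow> Some (t + 1, left x))"
  "exec p env (Tl_E a) = (case exec p env a of None \<Rightarrow> None | Some (t, x) \<Rightarrow> Some (t + 1, right x))"
  "exec p env (If_E c a b) =
     (case exec p env c of None \<Rightarrow> None | Some (s, x) \<Rightarrow>
       (case exec p env (if x = Atom then b else a) of None \<Rightarrow> None | Some (t, y) \<Rightarrow> Some (s + t + 1, y)))"
  "exec p env (Let_E a b) =
     (case exec p env a of None \<Rightarrow> None | Some (s, x) \<Rightarrow>
       (case exec p (x # env) b of None \<Rightarrow> None | Some (t, y) \<Rightarrow> Some (s + t + 1, y)))"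
  by (rule option_pair_eqI; force simp: exec_iff split: option.splits)+

lemma exec_list_simps:
  "exec_list p env [] = Some (0, [])"
  "exec_list p env (a # es) =
     (case exec p env a of None \<Rightarrow> None | Some (s, x) \<Rightarrow>
       (case exec_list p env es of None \<Rightarrow> None | Some (t, xs) \<Rightarrow> Some (s + t, x # xs)))"
  by (rule option_pair_eqI; force simp: exec_iff split: option.splits)+

lemma exec_Call_E:
  assumes "f < length p"
  shows "exec p env (Call_E f es) =
     (case exec_list p env es of None \<Rightarrow> None | Some (s, xs) \<Rightarrow>
       (case exec p xs (p ! f) of None \<Rightarrow> None | Some (t, y) \<Rightarrow> Some (s + t + 1, y)))"
  by (rule option_pair_eqI) (use assms in \<open>force simp: exec_iff split: option.splits\<close>)

section \<open>The program\<close>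

fun quote :: "data \<Rightarrow> expr" where
  "quote Atom = Nil_E"
| "quote (Cell x y) = Cons_E (quote x) (quote y)"

fun unary_code :: "nat \<Rightarrow> data" where
  "unary_code 0 = Atom"
| "unary_code (Suc k) = Cell Atom (unary_code k)"

datatype fun_name =
    Main_F | Bit_F | Add_F | Sub_F | Less_F | Mul_F | Eq_F | Diff_F | Int_Add_F | Int_Mul_F
  | Scale_F | Series_Add_F | Series_Mult_F | Series_Div_F | Butlast_F | Zeros_F | Power_F | Length_F
  | Drop_F | Fuel_F | Neighbours_F | Delete_Vertex_F | Pin_F | Proper_Edges_F | Loop_Pins_F
  | Pin_Product_F | Edge_Step_F | Ratio_F | Ratio_Loop_F | Horner_F | Ratio_Product_F

definition fun_names :: "fun_name list" where
  "fun_names = [Main_F, Bit_F, Add_F, Sub_F, Less_F, Mul_F, Eq_F, Diff_F, Int_Add_F, Int_Mul_F,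
     Scale_F, Series_Add_F, Series_Mult_F, Series_Div_F, Butlast_F, Zeros_F, Power_F, Length_F,
     Drop_F, Fuel_F, Neighbours_F, Delete_Vertex_F, Pin_F, Proper_Edges_F, Loop_Pins_F,
     Pin_Product_F, Edge_Step_F, Ratio_F, Ratio_Loop_F, Horner_F, Ratio_Product_F]"

definition index :: "fun_name \<Rightarrow> nat" where
  "index f = length (takeWhile (\<lambda>h. h \<noteq> f) fun_names)"

lemma index_less: "index f < length fun_names"
  and nth_index: "fun_names ! index f = f"
  by (cases f; simp add: index_def fun_names_def)+

abbreviation "call_E f es \<equiv> Call_E (index f) es"
abbreviation "True_E \<equiv> Cons_E Nil_E Nil_E"
abbreviation "not_E b \<equiv> If_E b Nil_E True_E"
abbreviation "and_E b c \<equiv> If_E b c Nil_E"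
abbreviation "or_E b c \<equiv> If_E b True_E c"
abbreviation "xor_E b c \<equiv> If_E b (not_E c) c"
abbreviation "int_E i \<equiv> quote (int_code i)"

text \<open>
  In each body, and after each binder \<^const>\<open>Let_E\<close>, the variables get names by means of a \<open>let\<close> of the logic.  The
  digits of numbers come least significant first; \<open>c\<close> is a carry or borrow flag.
\<close>

primrec (in spin_parameters) body :: "fun_name \<Rightarrow> expr" where
  "body Main_F = (let input = Var 0;
      vs = Hd_E (Hd_E input); es = Tl_E (Hd_E input);
      p = Tl_E (Hd_E (Tl_E input)); q = Tl_E (Tl_E input);
      k = call_E Fuel_F [call_E Length_F [vs],
        call_E Fuel_F [call_E Drop_F [q, p], quote (unary_code (3 * K))]] in
    Let_E (call_E Ratio_Product_F [k, call_E Proper_Edges_F [es], call_E Loop_Pins_F [es], vs,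
        call_E Power_F [int_E (sgn a * D), es], call_E Power_F [int_E \<bar>a\<bar>, es]])
      (let result = Var 0 in Cons_E (Hd_E result) (Tl_E (Tl_E result))))"
| "body Bit_F = (let b = Var 0; x = Var 1 in
    If_E b (Cons_E True_E x) (If_E x (Cons_E Nil_E x) Nil_E))"
| "body Add_F = (let c = Var 0; x = Var 1; y = Var 2;
      carry = If_E c (or_E (Hd_E x) (Hd_E y)) (and_E (Hd_E x) (Hd_E y));
      sum = call_E Bit_F [xor_E (xor_E c (Hd_E x)) (Hd_E y), call_E Add_F [carry, Tl_E x, Tl_E y]] in
    If_E x sum (If_E y sum (If_E c (Cons_E True_E Nil_E) Nil_E)))"
| "body Sub_F = (let c = Var 0; x = Var 1; y = Var 2;
      borrow = If_E (Hd_E x) (and_E (Hd_E y) c) (or_E (Hd_E y) c) in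
    If_E x
      (call_E Bit_F [xor_E (xor_E c (Hd_E x)) (Hd_E y), call_E Sub_F [borrow, Tl_E x, Tl_E y]])
      Nil_E)"
| "body Less_F = (let c = Var 0; x = Var 1; y = Var 2;
      borrow = If_E (Hd_E x) (and_E (Hd_E y) c) (or_E (Hd_E y) c) in
    If_E x (call_E Less_F [borrow, Tl_E x, Tl_E y]) (If_E y True_E c))"
| "body Mul_F = (let x = Var 0; y = Var 1 in
    If_E x
      (Let_E (call_E Bit_F [Nil_E, call_E Mul_F [Tl_E x, y]])
        (let z = Var 0; x = Var 1; y = Var 2 in If_E (Hd_E x) (call_E Add_F [Nil_E, z, y]) z))
      Nil_E)"
| "body Eq_F = (let x = Var 0; y = Var 1 in
    If_E (call_E Less_F [Nil_E, x, y]) Nil_E (not_E (call_E Less_F [Nil_E, y, x])))"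
| "body Diff_F = (let x = Var 0; y = Var 1 in
    If_E (call_E Less_F [Nil_E, x, y])
      (Cons_E True_E (call_E Sub_F [Nil_E, y, x]))
      (Cons_E Nil_E (call_E Sub_F [Nil_E, x, y])))"
| "body Int_Add_F = (let i = Var 0; j = Var 1 in
    If_E (Hd_E i)
      (If_E (Hd_E j)
        (Cons_E True_E (call_E Add_F [Nil_E, Tl_E i, Tl_E j]))
        (call_E Diff_F [Tl_E j, Tl_E i]))
      (If_E (Hd_E j)
        (call_E Diff_F [Tl_E i, Tl_E j])
        (Cons_E Nil_E (call_E Add_F [Nil_E, Tl_E i, Tl_E j]))))"
| "body Int_Mul_F = (let i = Var 0; j = Var 1 in
    Let_E (call_E Mul_F [Tl_E i, Tl_E j])
      (let z = Var 0; i = Var 1; j = Var 2 in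
        If_E z (Cons_E (xor_E (Hd_E i) (Hd_E j)) z) (Cons_E Nil_E Nil_E)))"
| "body Scale_F = (let k = Var 0; xs = Var 1 in
    If_E xs (Cons_E (call_E Int_Mul_F [k, Hd_E xs]) (call_E Scale_F [k, Tl_E xs])) Nil_E)"
| "body Series_Add_F = (let xs = Var 0; ys = Var 1 in
    If_E xs
      (If_E ys
        (Cons_E (call_E Int_Add_F [Hd_E xs, Hd_E ys]) (call_E Series_Add_F [Tl_E xs, Tl_E ys]))
        Nil_E)
      Nil_E)"
| "body Series_Mult_F = (let xs = Var 0; ys = Var 1 in
    If_E xs
      (call_E Series_Add_F [call_E Scale_F [Hd_E xs, ys],
        Cons_E (int_E 0) (call_E Series_Mult_F [Tl_E xs, ys])])
      Nil_E)"
| "body Series_Div_F = (let xs = Var 0; ys = Var 1 in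
    If_E xs
      (Cons_E (Hd_E xs)
        (call_E Series_Div_F [call_E Series_Add_F [Tl_E xs,
          call_E Scale_F [call_E Int_Mul_F [int_E (- 1), Hd_E xs], ys]], ys]))
      Nil_E)"
| "body Butlast_F = (let x = Var 0; xs = Var 1 in
    If_E xs (Cons_E x (call_E Butlast_F [Hd_E xs, Tl_E xs])) Nil_E)"
| "body Zeros_F = (let k = Var 0 in If_E k (Cons_E (int_E 0) (call_E Zeros_F [Tl_E k])) Nil_E)"
| "body Power_F = (let i = Var 0; xs = Var 1 in
    If_E xs (call_E Int_Mul_F [i, call_E Power_F [i, Tl_E xs]]) (int_E 1))"
| "body Length_F = (let xs = Var 0 in
    If_E xs (call_E Add_F [True_E, call_E Length_F [Tl_E xs], Nil_E]) Nil_E)"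
| "body Drop_F = (let xs = Var 0; ys = Var 1 in
    If_E ys (call_E Drop_F [Tl_E xs, Tl_E ys]) xs)"
| "body Fuel_F = (let xs = Var 0; k = Var 1 in
    If_E xs ((Cons_E Nil_E ^^ K) (call_E Fuel_F [Tl_E xs, k])) k)"
| "body Neighbours_F = (let v = Var 0; es = Var 1; x = Hd_E (Hd_E es); y = Tl_E (Hd_E es);
      vs = call_E Neighbours_F [v, Tl_E es] in
    If_E es
      (If_E (call_E Eq_F [x, v]) (Cons_E y vs) (If_E (call_E Eq_F [y, v]) (Cons_E x vs) vs))
      Nil_E)"
| "body Delete_Vertex_F = (let v = Var 0; es = Var 1; x = Hd_E (Hd_E es); y = Tl_E (Hd_E es);
      rest = call_E Delete_Vertex_F [v, Tl_E es] in
    If_E es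
      (If_E (call_E Eq_F [x, v]) rest (If_E (call_E Eq_F [y, v]) rest (Cons_E (Hd_E es) rest)))
      Nil_E)"
| "body Pin_F = (let us = Var 0; ps = Var 1 in
    If_E us (Cons_E (Cons_E (Hd_E us) Nil_E) (call_E Pin_F [Tl_E us, ps])) ps)"
| "body Proper_Edges_F = (let es = Var 0; x = Hd_E (Hd_E es); y = Tl_E (Hd_E es);
      rest = call_E Proper_Edges_F [Tl_E es] in
    If_E es (If_E (call_E Eq_F [x, y]) rest (Cons_E (Hd_E es) rest)) Nil_E)"
| "body Loop_Pins_F = (let es = Var 0; x = Hd_E (Hd_E es); y = Tl_E (Hd_E es);
      rest = call_E Loop_Pins_F [Tl_E es] in
    If_E es
      (If_E (call_E Eq_F [x, y]) (Cons_E (Cons_E x Nil_E) (Cons_E (Cons_E x True_E) rest)) rest)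
      Nil_E)"
| "body Pin_Product_F = (let v = Var 0; ps = Var 1; acc = Var 2; u = Hd_E (Hd_E ps); f = Tl_E (Hd_E ps) in
    If_E ps
      (If_E (call_E Eq_F [u, v])
        (call_E Pin_Product_F [v, Tl_E ps,
          call_E Scale_F [If_E f (int_E g) (int_E a), call_E Butlast_F [int_E 0, acc]]])
        (call_E Pin_Product_F [v, Tl_E ps, acc]))
      acc)"
| "body Edge_Step_F = (let r = Var 0; acc = Var 1 in
    call_E Series_Div_F [
      call_E Series_Mult_F [call_E Scale_F [int_E a, call_E Butlast_F [int_E 0, acc]],
        Cons_E (int_E 1) (call_E Scale_F [int_E g, r])],
      call_E Scale_F [int_E a, r]])"
| "body Ratio_F = (let k = Var 0; v = Var 1; es = Var 2; ps = Var 3 in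
    If_E k
      (call_E Ratio_Loop_F [Tl_E k, call_E Delete_Vertex_F [v, es], ps, call_E Neighbours_F [v, es],
        call_E Pin_Product_F [v, ps, Cons_E (int_E 1) (call_E Zeros_F [Tl_E k])]])
      Nil_E)"
| "body Ratio_Loop_F = (let k = Var 0; es = Var 1; ps = Var 2; us = Var 3; acc = Var 4 in
    If_E us
      (call_E Ratio_Loop_F [k, es, Cons_E (Cons_E (Hd_E us) True_E) ps, Tl_E us,
        call_E Edge_Step_F [call_E Ratio_F [k, Hd_E us, es, call_E Pin_F [Tl_E us, ps]], acc]])
      acc)"
| "body Horner_F = (let xs = Var 0 in
    If_E xs
      (Let_E (call_E Horner_F [Tl_E xs])
        (let nd = Var 0 in
          Let_E (call_E Int_Mul_F [Tl_E nd, int_E D])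
            (let d = Var 0; nd = Var 1; xs = Var 2 in
              Cons_E (call_E Int_Add_F [call_E Int_Mul_F [Hd_E xs, d], Hd_E nd]) d)))
      (Cons_E (int_E 0) (int_E 1)))"
| "body Ratio_Product_F =
    (let k = Var 0; es = Var 1; ps = Var 2; vs = Var 3; num = Var 4; den = Var 5 in
    If_E vs
      (Let_E (call_E Horner_F [call_E Ratio_F [k, Hd_E vs, es, ps]])
        (let nd = Var 0; k = Var 1; es = Var 2; ps = Var 3; vs = Var 4; num = Var 5; den = Var 6 in
          call_E Ratio_Product_F [k, call_E Delete_Vertex_F [Hd_E vs, es],
            call_E Pin_F [call_E Neighbours_F [Hd_E vs, es], ps], Tl_E vs,
            call_E Int_Mul_F [num, call_E Int_Add_F [Tl_E nd, Hd_E nd]],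
            call_E Int_Mul_F [den, Tl_E nd]]))
      (Cons_E num den))"

context spin_parameters
begin

definition prog :: program where
  "prog = map body fun_names"

definition call :: "fun_name \<Rightarrow> data list \<Rightarrow> (nat \<times> data) option" where
  "call f xs = exec prog xs (body f)"

definition computes :: "fun_name \<Rightarrow> data list \<Rightarrow> nat \<Rightarrow> data \<Rightarrow> bool" where
  "computes f xs T y \<longleftrightarrow> (\<exists>t. call f xs = Some (t, y) \<and> t \<le> T)"

definition steps :: "fun_name \<Rightarrow> data list \<Rightarrow> nat" where
  "steps f xs = fst (the (call f xs))"

lemma computesD:
  assumes "computes f xs T y"
  shows "call f xs = Some (steps f xs, y)" "steps f xs \<le> T"
  using assms by (auto simp: computes_def steps_def)

lemma computes_mono: "computes f xs T y \<Longrightarrow> T \<le> T' \<Longrightarrow> computes f xs T' y"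
  by (auto simp: computes_def)

lemma exec_call_E:
  "exec prog env (call_E f es) =
     (case exec_list prog env es of None \<Rightarrow> None | Some (s, xs) \<Rightarrow>
       (case call f xs of None \<Rightarrow> None | Some (t, y) \<Rightarrow> Some (s + t + 1, y)))"
proof -
  have "index f < length prog" "prog ! index f = body f"
    by (simp_all add: prog_def index_less nth_index)
  then show ?thesis
    by (simp only: exec_Call_E call_def)
qed

lemma computes_Main_imp_runs:
  assumes "computes Main_F [x] T y"
  obtains t where "runs prog x t y" "t \<le> T"
proof -
  obtain t where "call Main_F [x] = Some (t, y)" "t \<le> T"
    using assms by (auto simp: computes_def)
  moreover have "prog \<noteq> []" "prog ! 0 = body Main_F"
    by (simp_all add: prog_def fun_names_def)
  ultimately show thesis
    using that by (simp add: runs_def call_def exec_eq_Some_iff)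
qed

end

section \<open>Arithmetic\<close>

lemma bool_code_eq_Atom [simp]: "bool_code b = Atom \<longleftrightarrow> \<not> b"
  by (simp add: bool_code_def)

lemma bool_code_simps: "bool_code True = Cell Atom Atom" "bool_code False = Atom"
  by (simp_all add: bool_code_def)

lemma nat_code_0 [simp]: "nat_code 0 = Atom"
  by (simp add: nat_code_def list_code_def bits.simps)

lemma nat_code_unfold: "n > 0 \<Longrightarrow> nat_code n = Cell (bool_code (odd n)) (nat_code (n div 2))"
  by (subst nat_code_def, subst bits.simps) (simp add: nat_code_def list_code_def)

lemma nat_code_eq_Atom [simp]: "nat_code n = Atom \<longleftrightarrow> n = 0"
  using nat_code_unfold[of n] by (cases "n = 0") auto

lemma left_nat_code [simp]: "left (nat_code n) = bool_code (odd n)"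
  using nat_code_unfold[of n] by (cases "n = 0") (auto simp: bool_code_def)

lemma right_nat_code [simp]: "right (nat_code n) = nat_code (n div 2)"
  using nat_code_unfold[of n] by (cases "n = 0") auto

lemma int_code_simps [simp]:
  "left (int_code i) = bool_code (i < 0)" "right (int_code i) = nat_code (nat \<bar>i\<bar>)"
  "int_code i \<noteq> Atom"
  by (simp_all add: int_code_def)

lemma cells_int_code [simp]:
  "cells (int_code 0) = 1" "cells (int_code 1) = 3" "cells (int_code (- 1)) = 4"
  by (simp_all add: int_code_def bool_code_def nat_code_unfold)

lemma exec_quote [simp]: "exec p env (quote d) = Some (2 * cells d + 1, d)"
  by (induction d) (simp_all add: exec_simps)

lemmas (in spin_parameters) run_simps = exec_simps exec_list_simps exec_call_E bool_code_simps Let_def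

lemma add_carry:
  "2 * (m div 2 + n div 2 + of_bool (if c then odd m \<or> odd n else odd m \<and> odd n))
     + of_bool ((c \<noteq> odd m) \<noteq> odd n) = m + n + of_bool c" for m n :: nat
  by (cases c; cases "odd m"; cases "odd n") (auto elim!: oddE evenE)

lemma sub_borrow:
  fixes m n :: nat
  assumes "n + of_bool c \<le> m"
  defines "c' \<equiv> if odd m then odd n \<and> c else odd n \<or> c"
  shows "n div 2 + of_bool c' \<le> m div 2"
    "2 * (m div 2 - (n div 2 + of_bool c')) + of_bool ((c \<noteq> odd m) \<noteq> odd n) = m - (n + of_bool c)"
  using assms by (cases c; cases "odd m"; cases "odd n"; auto elim!: oddE evenE)+

lemma less_borrow:
  fixes m n :: nat
  shows "m div 2 < n div 2 + of_bool (if odd m then odd n \<and> c else odd n \<or> c) \<longleftrightarrow> m < n + of_bool c"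
  by (cases c; cases "odd m"; cases "odd n"; auto elim!: oddE evenE)

definition fits :: "nat \<Rightarrow> int \<Rightarrow> bool" where
  "fits b i \<longleftrightarrow> \<bar>i\<bar> < 2 ^ b"

lemma fits_mono:
  assumes "fits b i" "b \<le> c"
  shows "fits c i"
proof -
  have "(2::int) ^ b \<le> 2 ^ c"
    using assms(2) by (intro power_increasing) auto
  with assms(1) show ?thesis
    unfolding fits_def by (rule order_less_le_trans)
qed

lemma fits_minus [simp]: "fits b (- i) \<longleftrightarrow> fits b i"
  by (simp add: fits_def)

lemma fits_0 [simp]: "fits b 0"
  by (simp add: fits_def)

lemma fits_1 [simp]: "0 < b \<Longrightarrow> fits b 1"
  by (simp add: fits_def)

lemma fits_add: "fits b i \<Longrightarrow> fits b j \<Longrightarrow> fits (Suc b) (i + j)"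
  by (simp add: fits_def)

lemma fits_mult: "fits b i \<Longrightarrow> fits c j \<Longrightarrow> fits (b + c) (i * j)"
  by (auto simp: fits_def abs_mult power_add intro!: mult_strict_mono)

lemma fits_power: "fits b i \<Longrightarrow> fits (b * n + 1) (i ^ n)"
proof (induction n)
  case (Suc n)
  then have "fits (b + (b * n + 1)) (i * i ^ n)"
    by (intro fits_mult) auto
  then show ?case
    by simp
qed simp

lemma fits_bit_length: "fits b i \<longleftrightarrow> nat \<bar>i\<bar> < 2 ^ b"
  by (simp add: fits_def nat_less_iff)

context spin_parameters
begin

lemma computes_bit: "computes Bit_F [bool_code b, nat_code n] 10 (nat_code (2 * n + of_bool b))"
  by (cases b; cases "n = 0")
    (simp_all add: computes_def call_def run_simps
      nat_code_unfold[of "Suc (2 * n)"] nat_code_unfold[of "2 * n"] nat_code_unfold[of "Suc 0"])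

lemma computes_add:
  "computes Add_F [bool_code c, nat_code m, nat_code n] (60 * (bit_length m + bit_length n) + 60)
     (nat_code (m + n + of_bool c))"
proof (induction "m + n" arbitrary: m n c rule: less_induct)
  case less
  show ?case
  proof (cases "m = 0 \<and> n = 0")
    case True
    then show ?thesis
      by (cases c) (simp_all add: computes_def call_def run_simps nat_code_unfold[of "Suc 0"])
  next
    case False
    define c' where "c' = (if c then odd m \<or> odd n else odd m \<and> odd n)"
    have time: "bit_length (m div 2) + bit_length (n div 2) + 1 \<le> bit_length m + bit_length n"
      using False bit_length_unfold[of m] bit_length_unfold[of n] by (cases "m = 0"; cases "n = 0") auto
    have "m div 2 + n div 2 < m + n"
      using False by linarith
    note IH = computesD[OF less[OF this, of c']]
    note digit = computesD[OF computes_bit[of "(c \<noteq> odd m) \<noteq> odd n" "m div 2 + n div 2 + of_bool c'"],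
        unfolded c'_def add_carry, folded c'_def]
    show ?thesis
      unfolding computes_def call_def using IH digit False time
      by (cases c; cases "odd m"; cases "odd n"; cases "m = 0") (simp_all add: run_simps c'_def)
  qed
qed

lemma computes_sub:
  "n + of_bool c \<le> m \<Longrightarrow>
   computes Sub_F [bool_code c, nat_code m, nat_code n] (60 * bit_length m + 60)
     (nat_code (m - (n + of_bool c)))"
proof (induction m arbitrary: n c rule: less_induct)
  case (less m)
  show ?case
  proof (cases "m = 0")
    case True
    then show ?thesis
      using less.prems by (simp add: computes_def call_def run_simps)
  next
    case False
    define c' where "c' = (if odd m then odd n \<and> c else odd n \<or> c)"
    note borrow = sub_borrow[OF less.prems, folded c'_def]
    note IH = computesD[OF less.IH[OF _ borrow(1)]]
    note digit = computesD[OF computes_bit[of "(c \<noteq> odd m) \<noteq> odd n" "m div 2 - (n div 2 + of_bool c')"],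
        unfolded borrow(2)]
    show ?thesis
      unfolding computes_def call_def using IH digit False bit_length_unfold[of m]
      by (cases c; cases "odd m"; cases "odd n") (simp_all add: run_simps c'_def)
  qed
qed

lemma computes_less:
  "computes Less_F [bool_code c, nat_code m, nat_code n] (30 * bit_length m + 30)
     (bool_code (m < n + of_bool c))"
proof (induction m arbitrary: n c rule: less_induct)
  case (less m)
  show ?case
  proof (cases "m = 0")
    case True
    then show ?thesis
      by (cases "n = 0") (simp_all add: computes_def call_def run_simps)
  next
    case False
    define c' where "c' = (if odd m then odd n \<and> c else odd n \<or> c)"
    note IH = computesD[OF less[of "m div 2" c' "n div 2", unfolded c'_def less_borrow, folded c'_def]]
    show ?thesis
      unfolding computes_def call_def using IH False bit_length_unfold[of m]
      by (cases c; cases "odd m"; cases "odd n") (simp_all add: run_simps c'_def)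
  qed
qed

lemma computes_mul:
  assumes "m < 2 ^ b" "n < 2 ^ c"
  shows "computes Mul_F [nat_code m, nat_code n] (b * (60 * (b + 2 * c) + 100) + 10) (nat_code (m * n))"
  using assms(1)
proof (induction b arbitrary: m)
  case 0
  then show ?case
    by (simp add: computes_def call_def run_simps)
next
  case (Suc b)
  show ?case
  proof (cases "m = 0")
    case True
    then show ?thesis
      by (simp add: computes_def call_def run_simps)
  next
    case False
    have half: "m div 2 < 2 ^ b"
      using Suc.prems by auto
    note IH = computesD[OF Suc.IH[OF half]]
    note double = computesD[OF computes_bit[of False "m div 2 * n"]]
    note sum = computesD[OF computes_add[of False "2 * (m div 2 * n)" n]]
    have "m div 2 * n < 2 ^ b * 2 ^ c"
      using half assms(2) by (intro mult_strict_mono) auto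
    then have time: "bit_length (2 * (m div 2 * n)) \<le> Suc (b + c)" "bit_length n \<le> c"
      using assms(2) by (auto intro!: bit_length_le simp: power_add)
    have "odd m \<Longrightarrow> 2 * (m div 2 * n) + n = m * n" "even m \<Longrightarrow> 2 * (m div 2 * n) = m * n"
      by (auto elim!: oddE evenE simp: algebra_simps)
    then show ?thesis
      unfolding computes_def call_def using IH double sum False time
      by (cases "odd m") (simp_all add: run_simps algebra_simps)
  qed
qed

lemma computes_eq:
  "computes Eq_F [nat_code m, nat_code n] (30 * (bit_length m + bit_length n) + 80) (bool_code (m = n))"
proof -
  note less = computesD[OF computes_less[of False m n]] computesD[OF computes_less[of False n m]]
  consider "m < n" | "n < m" | "m = n"
    by linarith
  then show ?thesis
    unfolding computes_def call_def using less by cases (simp_all add: run_simps)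
qed

lemma computes_eq_below:
  assumes "m < 2 ^ b" "n < 2 ^ b"
  shows "computes Eq_F [nat_code m, nat_code n] (60 * b + 80) (bool_code (m = n))"
  by (rule computes_mono[OF computes_eq]) (use assms[THEN bit_length_le] in simp)

lemma computes_diff:
  "computes Diff_F [nat_code m, nat_code n] (90 * (bit_length m + bit_length n) + 120)
     (int_code (int m - int n))"
proof -
  note less = computesD[OF computes_less[of False m n]]
  note diff = computesD[OF computes_sub[of m False n]] computesD[OF computes_sub[of n False m]]
  show ?thesis
    unfolding computes_def call_def using less diff
    by (cases "m < n") (simp_all add: run_simps int_code_def nat_diff_distrib)
qed

lemma computes_int_add:
  assumes "fits b i" "fits b j"
  shows "computes Int_Add_F [int_code i, int_code j] (180 * b + 200) (int_code (i + j))"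
proof -
  have time: "bit_length (nat \<bar>i\<bar>) \<le> b" "bit_length (nat \<bar>j\<bar>) \<le> b"
    using assms by (auto intro!: bit_length_le simp: fits_bit_length)
  note sum = computesD[OF computes_add[of False "nat \<bar>i\<bar>" "nat \<bar>j\<bar>"]]
  note diff = computesD[OF computes_diff[of "nat \<bar>i\<bar>" "nat \<bar>j\<bar>"]]
    computesD[OF computes_diff[of "nat \<bar>j\<bar>" "nat \<bar>i\<bar>"]]
  show ?thesis
    unfolding computes_def call_def using sum diff time
    by (cases "i < 0"; cases "j < 0")
      (simp_all add: run_simps int_code_def nat_add_distrib[symmetric] algebra_simps)
qed

definition int_mul_time :: "nat \<Rightarrow> nat" where
  "int_mul_time b = b * (180 * b + 100) + 50"

lemma computes_int_mul:
  assumes "fits b i" "fits b j"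
  shows "computes Int_Mul_F [int_code i, int_code j] (int_mul_time b) (int_code (i * j))"
proof -
  have "nat \<bar>i\<bar> * nat \<bar>j\<bar> = nat \<bar>i * j\<bar>"
    by (simp add: abs_mult nat_mult_distrib)
  note product = computesD[OF computes_mul[OF assms[unfolded fits_bit_length]], unfolded this]
  show ?thesis
    unfolding computes_def call_def using product
    by (cases "i < 0"; cases "j < 0"; cases "i = 0"; cases "j = 0")
      (simp_all add: run_simps int_code_def int_mul_time_def mult_less_0_iff)
qed

end

section \<open>Lists and power series\<close>

lemma list_code_simps [simp]:
  "list_code c [] = Atom" "list_code c (x # xs) = Cell (c x) (list_code c xs)"
  by (simp_all add: list_code_def)

lemma list_code_eq_Atom [simp]: "list_code c xs = Atom \<longleftrightarrow> xs = []"
  by (cases xs) auto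

lemma unary_code_eq_Atom [simp]: "unary_code k = Atom \<longleftrightarrow> k = 0"
  by (cases k) auto

lemma right_unary_code [simp]: "right (unary_code k) = unary_code (k - 1)"
  by (cases k) auto

lemma cells_unary_code [simp]: "cells (unary_code k) = k"
  by (induction k) auto

lemma funpow_Cell_unary_code: "(Cell Atom ^^ n) (unary_code k) = unary_code (n + k)"
  by (induction n) auto

lemma exec_funpow_Cons_E:
  "exec p env e = Some (t, x) \<Longrightarrow>
   exec p env ((Cons_E Nil_E ^^ n) e) = Some (t + 2 * n, (Cell Atom ^^ n) x)"
  by (induction n) (auto simp: exec_simps)

abbreviation "ints_code \<equiv> list_code int_code"

abbreviation all_fit :: "nat \<Rightarrow> int list \<Rightarrow> bool" where
  "all_fit b xs \<equiv> \<forall>x\<in>set xs. fits b x"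

lemma all_fit_mono: "all_fit b xs \<Longrightarrow> b \<le> c \<Longrightarrow> all_fit c xs"
  by (auto intro: fits_mono)

lemma all_fit_scale: "fits b k \<Longrightarrow> all_fit c xs \<Longrightarrow> all_fit (b + c) (map ((*) k) xs)"
  by (auto intro: fits_mult)

lemma all_fit_add:
  assumes "all_fit b xs" "all_fit b ys"
  shows "all_fit (Suc b) (map2 (+) xs ys)"
  using assms by (auto intro!: fits_add dest: set_zip_leftD set_zip_rightD)

lemma all_fit_series_mult:
  assumes "all_fit b xs" "all_fit c ys"
  shows "all_fit (b + c + length xs) (series_mult xs ys)"
  using assms(1)
proof (induction xs)
  case (Cons x xs)
  have "all_fit (b + c + length xs) (map ((*) x) ys)"
    using Cons.prems assms(2) by (intro all_fit_mono[OF all_fit_scale]) auto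
  moreover have "all_fit (b + c + length xs) (0 # series_mult xs ys)"
    using Cons by simp
  ultimately show ?case
    unfolding series_mult.simps list.size add_Suc_right add_0_right by (rule all_fit_add)
qed simp

lemma all_fit_weighted_norm:
  assumes "weighted_norm (1 / 2 ^ c) xs \<le> 2 ^ j" "length xs \<le> l" "c * l + j < b"
  shows "all_fit b xs"
proof
  fix x assume "x \<in> set xs"
  then have "\<bar>real_of_int x\<bar> * (1 / 2 ^ c) ^ l \<le> 2 ^ j"
    using abs_le_weighted_norm[of "1 / 2 ^ c" x xs l] assms(1,2) by simp
  then have "\<bar>real_of_int x\<bar> \<le> 2 ^ (c * l + j)"
    by (simp add: power_divide power_mult power_add field_simps)
  also have "\<dots> < 2 ^ b"
    using assms(3) by (intro power_strict_increasing) auto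
  finally have "real_of_int \<bar>x\<bar> < real_of_int (2 ^ b)"
    by simp
  then show "fits b x"
    unfolding fits_def by (simp only: of_int_less_iff)
qed

context spin_parameters
begin

lemma computes_list:
  assumes "\<forall>x\<in>set xs. P x" "length xs \<le> n"
    and Nil: "computes f (args []) T (out [])"
    and Cons: "\<And>x xs U. P x \<Longrightarrow> \<forall>x\<in>set xs. P x \<Longrightarrow> length xs < n \<Longrightarrow> computes f (args xs) U (out xs) \<Longrightarrow>
      computes f (args (x # xs)) (U + T) (out (x # xs))"
  shows "computes f (args xs) ((n + 1) * T) (out xs)"
proof -
  have "computes f (args xs) ((length xs + 1) * T) (out xs)"
    using assms(1,2)
  proof (induction xs)
    case (Cons x xs)
    then have "computes f (args (x # xs)) ((length xs + 1) * T + T) (out (x # xs))"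
      by (intro assms(4)) auto
    then show ?case
      by (simp add: algebra_simps)
  qed (simp add: Nil)
  then show ?thesis
    by (rule computes_mono) (use assms(2) in \<open>intro mult_right_mono, auto\<close>)
qed

definition scale_time :: "nat \<Rightarrow> nat \<Rightarrow> nat" where
  "scale_time l b = (l + 1) * (int_mul_time b + 20)"

lemma computes_scale:
  assumes "fits b k" "all_fit b xs" "length xs \<le> l"
  shows "computes Scale_F [int_code k, ints_code xs] (scale_time l b) (ints_code (map ((*) k) xs))"
  unfolding scale_time_def using assms(2,3)
proof (rule computes_list[where args = "\<lambda>xs. [int_code k, ints_code xs]"])
  fix x xs U
  assume x_fits: "fits b x"
    and rec: "computes Scale_F [int_code k, ints_code xs] U (ints_code (map ((*) k) xs))"
  note rec = computesD[OF rec]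
  note product = computesD[OF computes_int_mul[OF assms(1) x_fits]]
  show "computes Scale_F [int_code k, ints_code (x # xs)] (U + (int_mul_time b + 20))
      (ints_code (map ((*) k) (x # xs)))"
    unfolding computes_def call_def using rec product by (simp add: run_simps)
qed (simp add: computes_def call_def run_simps)

definition series_add_time :: "nat \<Rightarrow> nat \<Rightarrow> nat" where
  "series_add_time l b = (l + 1) * (180 * b + 230)"

lemma computes_series_add:
  assumes "all_fit b xs" "all_fit b ys" "length xs \<le> l"
  shows "computes Series_Add_F [ints_code xs, ints_code ys] (series_add_time l b)
    (ints_code (map2 (+) xs ys))"
proof -
  have "computes Series_Add_F [ints_code xs, ints_code ys] ((length xs + 1) * (180 * b + 230))
      (ints_code (map2 (+) xs ys))"
    using assms(1,2)
  proof (induction xs ys rule: list_induct2')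
    case (4 x xs y ys)
    then have xy_fit: "fits b x" "fits b y" and xs_ys_fit: "all_fit b xs" "all_fit b ys"
      by auto
    note sum = computesD[OF computes_int_add[OF xy_fit]]
    note IH = computesD[OF "4.IH"[OF xs_ys_fit]]
    show ?case
      unfolding computes_def call_def using IH sum by (simp add: run_simps)
  qed (simp_all add: computes_def call_def run_simps)
  then show ?thesis
    by (rule computes_mono) (use assms(3) in \<open>simp add: series_add_time_def\<close>)
qed

definition series_mult_time :: "nat \<Rightarrow> nat \<Rightarrow> nat" where
  "series_mult_time l b = scale_time l b + series_add_time l (2 * b + l) + 40"

lemma computes_series_mult:
  assumes "all_fit b xs" "all_fit b ys" "length xs \<le> l" "length ys \<le> l"
  shows "computes Series_Mult_F [ints_code xs, ints_code ys] ((l + 1) * series_mult_time l b)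
    (ints_code (series_mult xs ys))"
  using assms(1,3)
proof (rule computes_list[where args = "\<lambda>xs. [ints_code xs, ints_code ys]"])
  fix x xs U
  assume x_fits: "fits b x" and xs_fit: "all_fit b xs" "length xs < l"
    and rec: "computes Series_Mult_F [ints_code xs, ints_code ys] U (ints_code (series_mult xs ys))"
  note rec = computesD[OF rec]
  note scale = computesD[OF computes_scale[OF x_fits assms(2,4)]]
  have "all_fit (2 * b + l) (map ((*) x) ys)"
    by (rule all_fit_mono[OF all_fit_scale[OF x_fits assms(2)]]) simp
  moreover have "all_fit (2 * b + l) (0 # series_mult xs ys)"
    using all_fit_mono[OF all_fit_series_mult[OF xs_fit(1) assms(2)], of "2 * b + l"] xs_fit(2) by simp
  moreover have "length (map ((*) x) ys) \<le> l"
    using assms(4) by simp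
  ultimately have "computes Series_Add_F [ints_code (map ((*) x) ys), ints_code (0 # series_mult xs ys)]
      (series_add_time l (2 * b + l)) (ints_code (series_mult (x # xs) ys))"
    unfolding series_mult.simps by (rule computes_series_add)
  note sum = computesD[OF this, unfolded list_code_simps]
  show "computes Series_Mult_F [ints_code (x # xs), ints_code ys] (U + series_mult_time l b)
      (ints_code (series_mult (x # xs) ys))"
    unfolding computes_def call_def using rec(2) scale(2) sum(2)
    by (simp add: run_simps rec(1) scale(1) sum(1) series_mult_time_def[of l b] del: series_mult.simps)
qed (simp add: computes_def call_def run_simps series_mult_time_def)

definition series_div_time :: "nat \<Rightarrow> nat \<Rightarrow> nat" where
  "series_div_time l b = int_mul_time b + scale_time l b + series_add_time l (2 * b) + 60"

lemma computes_series_div_Cons: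
  assumes "fits b x" "all_fit b xs" "0 < b" "all_fit b ys" "length ys \<le> l" "length xs \<le> l"
    and rec: "computes Series_Div_F [ints_code (map2 (+) xs (map ((*) (- x)) ys)), ints_code ys] T y"
  shows "computes Series_Div_F [ints_code (x # xs), ints_code ys] (T + series_div_time l b)
    (Cell (int_code x) y)"
proof -
  have minus_fit: "fits b (- 1)" "fits b (- x)"
    using assms(1,3) by simp_all
  note rec = computesD[OF rec]
  note minus = computesD[OF computes_int_mul[OF minus_fit(1) assms(1)], unfolded mult_minus1]
  note scale = computesD[OF computes_scale[OF minus_fit(2) assms(4,5)]]
  have "all_fit (2 * b) xs" "all_fit (2 * b) (map ((*) (- x)) ys)"
    using all_fit_mono[OF assms(2)] all_fit_mono[OF all_fit_scale[OF minus_fit(2) assms(4)]] by auto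
  note sum = computesD[OF computes_series_add[OF this assms(6)]]
  show ?thesis
    unfolding computes_def call_def using rec(2) scale(2) sum(2) minus(2)
    by (simp add: run_simps rec(1) scale(1) sum(1) minus(1) series_div_time_def)
qed

lemma computes_series_div:
  assumes "weighted_norm (1 / 2 ^ c) xs \<le> 2 ^ (c * j)" "weighted_norm (1 / 2 ^ c) ys \<le> 2 ^ c"
    and "c * (j + length xs) < b" "all_fit b ys" "length ys \<le> l" "length xs \<le> Suc l"
  shows "computes Series_Div_F [ints_code xs, ints_code ys] ((length xs + 1) * series_div_time l b)
    (ints_code (series_div xs ys))"
  using assms
proof (induction xs ys arbitrary: j rule: series_div.induct)
  case (1 ys)
  then show ?case
    by (simp add: computes_def call_def run_simps series_div_time_def)
next
  case (2 x xs ys)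
  let ?q = "1 / 2 ^ c :: real" and ?h = "map2 (+) xs (map ((*) (- x)) ys)"
  have x_xs_fit: "all_fit b (x # xs)"
    by (rule all_fit_weighted_norm[OF "2.prems"(1) order_refl])
      (use "2.prems"(3) in \<open>simp add: algebra_simps\<close>)
  have "?q * weighted_norm ?q ?h \<le> weighted_norm ?q (x # xs)"
    using "2.prems"(2) by (intro weighted_norm_div_step_le) (simp_all add: field_simps)
  then have "?q * weighted_norm ?q ?h \<le> 2 ^ (c * j)"
    using "2.prems"(1) by linarith
  then have norm: "weighted_norm ?q ?h \<le> 2 ^ (c * Suc j)"
    by (simp add: field_simps power_add)
  have "c * (Suc j + length ?h) \<le> c * (j + length (x # xs))"
    by (intro mult_left_mono) auto
  then have "c * (Suc j + length ?h) < b"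
    using "2.prems"(3) by linarith
  then have "computes Series_Div_F [ints_code ?h, ints_code ys] ((length ?h + 1) * series_div_time l b)
      (ints_code (series_div ?h ys))"
    by (rule "2.IH"[OF norm "2.prems"(2) _ "2.prems"(4,5)]) (use "2.prems"(6) in simp)
  then have "computes Series_Div_F [ints_code ?h, ints_code ys] ((length xs + 1) * series_div_time l b)
      (ints_code (series_div ?h ys))"
    by (rule computes_mono) (intro mult_right_mono, auto)
  then have "computes Series_Div_F [ints_code (x # xs), ints_code ys]
      ((length xs + 1) * series_div_time l b + series_div_time l b)
      (Cell (int_code x) (ints_code (series_div ?h ys)))"
    using x_xs_fit "2.prems"(3-6) by (intro computes_series_div_Cons) auto
  then show ?case
    by (simp add: add.commute)
qed

lemma computes_butlast:
  "computes Butlast_F [int_code x, ints_code xs] (20 * length xs + 20) (ints_code (butlast (x # xs)))"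
proof (induction xs arbitrary: x)
  case Nil
  then show ?case
    by (simp add: computes_def call_def run_simps)
next
  case (Cons y xs)
  note IH = computesD[OF Cons.IH[of y]]
  show ?case
    unfolding computes_def call_def using IH by (simp add: run_simps)
qed

lemma computes_zeros: "computes Zeros_F [unary_code k] (20 * k + 20) (ints_code (replicate k 0))"
proof (induction k)
  case 0
  then show ?case
    by (simp add: computes_def call_def run_simps)
next
  case (Suc k)
  note IH = computesD[OF Suc.IH]
  show ?case
    unfolding computes_def call_def using IH by (simp add: run_simps)
qed

lemma computes_power:
  assumes "fits c i" "c * n + c < b" "length xs \<le> n"
  shows "computes Power_F [int_code i, list_code f xs] ((n + 1) * (int_mul_time b + 30))
    (int_code (i ^ length xs))"
  using _ assms(3)
proof (rule computes_list[where P = "\<lambda>_. True" and args = "\<lambda>xs. [int_code i, list_code f xs]"])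
  fix x and xs :: "'a list" and U
  assume "length xs < n"
    and rec: "computes Power_F [int_code i, list_code f xs] U (int_code (i ^ length xs))"
  note rec = computesD[OF rec]
  have "c * length xs \<le> c * n"
    using \<open>length xs < n\<close> by (intro mult_left_mono) auto
  then have "c \<le> b" "c * length xs + 1 \<le> b"
    using assms(2) by linarith+
  then have "fits b i" "fits b (i ^ length xs)"
    using fits_mono[OF assms(1)] fits_mono[OF fits_power[OF assms(1)]] by auto
  note product = computesD[OF computes_int_mul[OF this]]
  show "computes Power_F [int_code i, list_code f (x # xs)] (U + (int_mul_time b + 30))
      (int_code (i ^ length (x # xs)))"
    unfolding computes_def call_def using rec product by (simp add: run_simps)
qed (simp_all add: computes_def call_def run_simps)

lemma computes_length:
  assumes "length xs \<le> n"
  shows "computes Length_F [list_code f xs] ((n + 1) * (60 * n + 100)) (nat_code (length xs))"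
  using _ assms
proof (rule computes_list[where P = "\<lambda>_. True" and args = "\<lambda>xs. [list_code f xs]"])
  fix x and xs :: "'a list" and U
  assume "length xs < n" and rec: "computes Length_F [list_code f xs] U (nat_code (length xs))"
  note rec = computesD[OF rec]
  note sum = computesD[OF computes_add[of True "length xs" 0]]
  have "bit_length (length xs) \<le> n"
    using bit_length_le_self[of "length xs"] \<open>length xs < n\<close> by simp
  then show "computes Length_F [list_code f (x # xs)] (U + (60 * n + 100)) (nat_code (length (x # xs)))"
    unfolding computes_def call_def using rec sum by (simp add: run_simps)
qed (simp_all add: computes_def call_def run_simps)

lemma computes_drop:
  "computes Drop_F [nat_code n, nat_code m] (20 * bit_length m + 20) (nat_code (n div 2 ^ bit_length m))"
proof (induction m arbitrary: n rule: less_induct)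
  case (less m)
  show ?case
  proof (cases "m = 0")
    case True
    then show ?thesis
      by (simp add: computes_def call_def run_simps)
  next
    case False
    then have "m div 2 < m"
      by simp
    moreover have "n div 2 div 2 ^ bit_length (m div 2) = n div 2 ^ bit_length m"
      using False by (simp add: bit_length_unfold[of m] div_mult2_eq)
    ultimately have "computes Drop_F [nat_code (n div 2), nat_code (m div 2)]
        (20 * bit_length (m div 2) + 20) (nat_code (n div 2 ^ bit_length m))"
      using less.IH[of "m div 2" "n div 2"] by simp
    note IH = computesD[OF this]
    show ?thesis
      unfolding computes_def call_def using IH False by (simp add: run_simps bit_length_unfold[of m])
  qed
qed

lemma computes_fuel:
  "computes Fuel_F [nat_code n, unary_code k] (bit_length n * (2 * K + 20) + 20)
     (unary_code (K * bit_length n + k))"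
proof (induction n rule: less_induct)
  case (less n)
  show ?case
  proof (cases "n = 0")
    case True
    then show ?thesis
      by (simp add: computes_def call_def run_simps)
  next
    case False
    then have "n div 2 < n"
      by simp
    note IH = computesD[OF less[OF this]]
    have "exec prog [nat_code n, unary_code k] (call_E Fuel_F [Tl_E (Var 0), Var 1])
       = Some (4 + steps Fuel_F [nat_code (n div 2), unary_code k],
           unary_code (K * bit_length (n div 2) + k))"
      by (simp add: run_simps IH(1))
    note push = exec_funpow_Cons_E[OF this, of K, unfolded funpow_Cell_unary_code]
    show ?thesis
      unfolding computes_def call_def using IH(2) push False
      by (simp add: Let_def exec_simps(1,6) bit_length_unfold[of n] algebra_simps)
  qed
qed

end

section \<open>Edge lists\<close>

abbreviation "edges_code \<equiv> list_code (\<lambda>(u, v). Cell (nat_code u) (nat_code v))"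
abbreviation "pins_code \<equiv> list_code (\<lambda>(u, f). Cell (nat_code u) (bool_code f))"

definition edges_below :: "nat \<Rightarrow> (nat \<times> nat) list \<Rightarrow> bool" where
  "edges_below n E \<longleftrightarrow> (\<forall>(x, y) \<in> set E. x < n \<and> y < n)"

definition pins_below :: "nat \<Rightarrow> (nat \<times> bool) list \<Rightarrow> bool" where
  "pins_below n P \<longleftrightarrow> (\<forall>(x, f) \<in> set P. x < n)"

lemma edges_below_Cons [simp]: "edges_below n ((x, y) # E) \<longleftrightarrow> x < n \<and> y < n \<and> edges_below n E"
  by (auto simp: edges_below_def)

lemma pins_below_Cons [simp]: "pins_below n ((x, f) # P) \<longleftrightarrow> x < n \<and> pins_below n P"
  by (auto simp: pins_below_def)

lemma pins_below_pin: "pins_below n P \<Longrightarrow> \<forall>u\<in>set us. u < n \<Longrightarrow> pins_below n (pin f us @ P)"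
  by (induction us) auto

lemma edges_below_delete_vertex: "edges_below n E \<Longrightarrow> edges_below n (delete_vertex v E)"
  by (auto simp: edges_below_def set_delete_vertex)

lemma edges_below_neighbours: "edges_below n E \<Longrightarrow> \<forall>u\<in>set (neighbours v E). u < n"
  by (auto simp: edges_below_def set_neighbours)

lemma edges_below_proper_edges: "edges_below n E \<Longrightarrow> edges_below n (proper_edges E)"
  by (auto simp: edges_below_def proper_edges_def)

lemma pins_below_loop_pins: "edges_below n E \<Longrightarrow> pins_below n (loop_pins E)"
  by (induction E rule: loop_pins.induct) (auto simp: pins_below_def)

context spin_parameters
begin

definition edge_scan_time :: "nat \<Rightarrow> nat \<Rightarrow> nat" where
  "edge_scan_time n w = (n + 1) * (120 * w + 250)"

lemma computes_edge_scan:
  assumes "edges_below (2 ^ w) E" "length E \<le> n"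
    and Nil: "computes f (args []) (120 * w + 250) (out [])"
    and Cons: "\<And>x y E U. x < 2 ^ w \<Longrightarrow> y < 2 ^ w \<Longrightarrow> computes f (args E) U (out E) \<Longrightarrow>
      computes f (args ((x, y) # E)) (U + (120 * w + 250)) (out ((x, y) # E))"
  shows "computes f (args E) (edge_scan_time n w) (out E)"
  unfolding edge_scan_time_def using assms(1,2) unfolding edges_below_def
  by (rule computes_list[where args = args and out = out]) (auto intro: Nil Cons)

lemma computes_neighbours:
  assumes "v < 2 ^ w" "edges_below (2 ^ w) E" "length E \<le> n"
  shows "computes Neighbours_F [nat_code v, edges_code E] (edge_scan_time n w)
    (list_code nat_code (neighbours v E))"
  using assms(2,3)
proof (rule computes_edge_scan[where args = "\<lambda>E. [nat_code v, edges_code E]"])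
  fix x y :: nat and E U
  assume below: "x < 2 ^ w" "y < 2 ^ w"
    and rec: "computes Neighbours_F [nat_code v, edges_code E] U (list_code nat_code (neighbours v E))"
  note rec = computesD[OF rec]
  note eq = computesD[OF computes_eq_below[OF below(1) assms(1)]]
    computesD[OF computes_eq_below[OF below(2) assms(1)]]
  show "computes Neighbours_F [nat_code v, edges_code ((x, y) # E)] (U + (120 * w + 250))
      (list_code nat_code (neighbours v ((x, y) # E)))"
    unfolding computes_def call_def using rec eq
    by (cases "x = v"; cases "y = v") (simp_all add: run_simps)
qed (simp add: computes_def call_def run_simps)

lemma computes_delete_vertex:
  assumes "v < 2 ^ w" "edges_below (2 ^ w) E" "length E \<le> n"
  shows "computes Delete_Vertex_F [nat_code v, edges_code E] (edge_scan_time n w)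
    (edges_code (delete_vertex v E))"
  using assms(2,3)
proof (rule computes_edge_scan[where args = "\<lambda>E. [nat_code v, edges_code E]"])
  fix x y :: nat and E U
  assume below: "x < 2 ^ w" "y < 2 ^ w"
    and rec: "computes Delete_Vertex_F [nat_code v, edges_code E] U (edges_code (delete_vertex v E))"
  note rec = computesD[OF rec]
  note eq = computesD[OF computes_eq_below[OF below(1) assms(1)]]
    computesD[OF computes_eq_below[OF below(2) assms(1)]]
  show "computes Delete_Vertex_F [nat_code v, edges_code ((x, y) # E)] (U + (120 * w + 250))
      (edges_code (delete_vertex v ((x, y) # E)))"
    unfolding computes_def call_def using rec eq
    by (cases "x = v"; cases "y = v") (simp_all add: run_simps)
qed (simp add: computes_def call_def run_simps)

lemma computes_proper_edges:
  assumes "edges_below (2 ^ w) E" "length E \<le> n"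
  shows "computes Proper_Edges_F [edges_code E] (edge_scan_time n w) (edges_code (proper_edges E))"
  using assms
proof (rule computes_edge_scan[where args = "\<lambda>E. [edges_code E]"])
  fix x y :: nat and E U
  assume below: "x < 2 ^ w" "y < 2 ^ w"
    and rec: "computes Proper_Edges_F [edges_code E] U (edges_code (proper_edges E))"
  note rec = computesD[OF rec]
  note eq = computesD[OF computes_eq_below[OF below]]
  show "computes Proper_Edges_F [edges_code ((x, y) # E)] (U + (120 * w + 250))
      (edges_code (proper_edges ((x, y) # E)))"
    unfolding computes_def call_def using rec eq by (cases "x = y") (simp_all add: run_simps)
qed (simp add: computes_def call_def run_simps)

lemma computes_loop_pins:
  assumes "edges_below (2 ^ w) E" "length E \<le> n"
  shows "computes Loop_Pins_F [edges_code E] (edge_scan_time n w) (pins_code (loop_pins E))"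
  using assms
proof (rule computes_edge_scan[where args = "\<lambda>E. [edges_code E]"])
  fix x y :: nat and E U
  assume below: "x < 2 ^ w" "y < 2 ^ w"
    and rec: "computes Loop_Pins_F [edges_code E] U (pins_code (loop_pins E))"
  note rec = computesD[OF rec]
  note eq = computesD[OF computes_eq_below[OF below]]
  show "computes Loop_Pins_F [edges_code ((x, y) # E)] (U + (120 * w + 250))
      (pins_code (loop_pins ((x, y) # E)))"
    unfolding computes_def call_def using rec eq by (cases "x = y") (simp_all add: run_simps)
qed (simp add: computes_def call_def run_simps)

lemma computes_pin:
  "computes Pin_F [list_code nat_code us, pins_code P] (20 * length us + 20) (pins_code (pin False us @ P))"
proof (induction us)
  case Nil
  then show ?case
    by (simp add: computes_def call_def run_simps)
next
  case (Cons u us)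
  note IH = computesD[OF Cons.IH]
  show ?case
    unfolding computes_def call_def using IH by (simp add: run_simps)
qed

end

section \<open>Computing the spin ratios\<close>

context spin_parameters
begin

definition coeff_bits :: nat where
  "coeff_bits = bit_length (nat (4 * \<bar>a\<bar> + 4 * \<bar>g\<bar> + \<bar>D\<bar>))"

definition radius :: real where
  "radius = 1 / 2 ^ coeff_bits"

abbreviation coeff_norm :: "int list \<Rightarrow> real" where
  "coeff_norm \<equiv> weighted_norm radius"

lemma parameters_less: "4 * \<bar>a\<bar> + 4 * \<bar>g\<bar> + \<bar>D\<bar> < 2 ^ coeff_bits"
proof -
  have "int (nat (4 * \<bar>a\<bar> + 4 * \<bar>g\<bar> + \<bar>D\<bar>)) < int (2 ^ coeff_bits)"
    unfolding coeff_bits_def of_nat_less_iff by (rule less_two_power_bit_length)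
  then show ?thesis
    by simp
qed

lemma fits_parameters: "fits coeff_bits a" "fits coeff_bits g" "fits coeff_bits D"
  using parameters_less by (simp_all add: fits_def)

lemma radius_nonneg: "0 \<le> radius" and radius_le_1: "radius \<le> 1"
  by (simp_all add: radius_def)

lemma parameter_radius_le: "\<bar>real_of_int a\<bar> * radius \<le> 1 / 4" "\<bar>real_of_int g\<bar> * radius \<le> 1 / 4"
proof -
  have "real_of_int (4 * \<bar>a\<bar>) \<le> real_of_int (2 ^ coeff_bits)"
    "real_of_int (4 * \<bar>g\<bar>) \<le> real_of_int (2 ^ coeff_bits)"
    using parameters_less by (simp_all only: of_int_le_iff)
  then show "\<bar>real_of_int a\<bar> * radius \<le> 1 / 4" "\<bar>real_of_int g\<bar> * radius \<le> 1 / 4"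
    by (simp_all add: radius_def field_simps)
qed

subsection \<open>The size of the coefficients\<close>

lemma coeff_norm_scale:
  assumes "\<bar>real_of_int k\<bar> * radius \<le> 1 / 4" "coeff_norm xs \<le> 1"
  shows "radius * coeff_norm (map ((*) k) xs) \<le> 1 / 4"
proof -
  have "(\<bar>real_of_int k\<bar> * radius) * coeff_norm xs \<le> 1 / 4 * 1"
    using assms radius_nonneg by (intro mult_mono) (auto simp: weighted_norm_nonneg)
  then show ?thesis
    by (simp add: weighted_norm_scale ac_simps)
qed

lemma coeff_norm_monom_mult:
  assumes "\<bar>real_of_int k\<bar> * radius \<le> 1 / 4" "coeff_norm xs \<le> 1"
  shows "coeff_norm (monom_mult k xs) \<le> 1 / 4"
  using weighted_norm_monom_mult[OF radius_nonneg, of k xs] coeff_norm_scale[OF assms]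
  by (simp add: weighted_norm_scale ac_simps)

lemma coeff_norm_one_plus: "coeff_norm r \<le> 1 \<Longrightarrow> coeff_norm (1 # map ((*) g) r) \<le> 5 / 4"
  using coeff_norm_scale[OF parameter_radius_le(2)] by fastforce

lemma coeff_norm_edge_numerator:
  assumes "coeff_norm r \<le> 1" "coeff_norm acc \<le> 1"
  shows "coeff_norm (series_mult (monom_mult a acc) (1 # map ((*) g) r)) \<le> 1 / 2"
proof -
  have "coeff_norm (series_mult (monom_mult a acc) (1 # map ((*) g) r))
      \<le> coeff_norm (monom_mult a acc) * coeff_norm (1 # map ((*) g) r)"
    by (rule weighted_norm_mult[OF radius_nonneg])
  also have "\<dots> \<le> 1 / 4 * (5 / 4)"
    using coeff_norm_monom_mult[OF parameter_radius_le(1) assms(2)] coeff_norm_one_plus[OF assms(1)]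
    by (intro mult_mono) (auto simp: weighted_norm_nonneg radius_nonneg simp del: weighted_norm.simps)
  finally show ?thesis
    by simp
qed

lemma coeff_norm_edge_step:
  assumes "coeff_norm r \<le> 1" "coeff_norm acc \<le> 1"
  shows "coeff_norm (edge_step r acc) \<le> 1"
proof -
  let ?s = "radius * coeff_norm (map ((*) a) r)"
  have s_le: "?s \<le> 1 / 4"
    by (rule coeff_norm_scale[OF parameter_radius_le(1) assms(1)])
  have "coeff_norm (edge_step r acc) * (3 / 4) \<le> coeff_norm (edge_step r acc) * (1 - ?s)"
    using s_le by (intro mult_left_mono weighted_norm_nonneg radius_nonneg) simp
  also have "\<dots> \<le> coeff_norm (series_mult (monom_mult a acc) (1 # map ((*) g) r))"
    unfolding edge_step_def using s_le by (intro weighted_norm_div radius_nonneg) simp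
  also have "\<dots> \<le> 1 / 2"
    by (rule coeff_norm_edge_numerator[OF assms])
  finally show ?thesis
    by simp
qed

lemma coeff_norm_monom_mult_le_1:
  "k \<in> {a, g} \<Longrightarrow> coeff_norm xs \<le> 1 \<Longrightarrow> coeff_norm (monom_mult k xs) \<le> 1"
  using coeff_norm_monom_mult[of k xs] parameter_radius_le by auto

lemma coeff_norm_pin_product: "coeff_norm acc \<le> 1 \<Longrightarrow> coeff_norm (pin_product v P acc) \<le> 1"
  unfolding pin_product_def
  by (induction P arbitrary: acc) (auto simp: coeff_norm_monom_mult_le_1)

lemma coeff_norm_ratio_coeffs: "coeff_norm (ratio_coeffs k v E P) \<le> 1"
  and "coeff_norm acc \<le> 1 \<Longrightarrow> coeff_norm (ratio_loop k E P us acc) \<le> 1"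
  by (induction k v E P and k E P us acc rule: ratio_coeffs_ratio_loop.induct)
    (simp_all add: coeff_norm_pin_product coeff_norm_edge_step)

definition entry_bits :: "nat \<Rightarrow> nat" where
  "entry_bits l = coeff_bits * (l + 2) + 3"

lemma all_fit_entry_bits:
  assumes "coeff_norm xs \<le> 2 ^ j" "length xs \<le> l" "j \<le> coeff_bits + 1"
  shows "all_fit (entry_bits l) xs"
  using assms(1,2) unfolding radius_def
  by (rule all_fit_weighted_norm) (use assms(3) in \<open>simp add: entry_bits_def algebra_simps\<close>)

lemma fits_entry_bits: "fits coeff_bits i \<Longrightarrow> fits (entry_bits l) i"
  by (erule fits_mono) (simp add: entry_bits_def)

subsection \<open>The factor of a pin\<close>

definition coeff_scale_time :: "nat \<Rightarrow> nat" where
  "coeff_scale_time l = scale_time l (entry_bits l)"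

lemma computes_coeff_scale:
  assumes "coeff_norm xs \<le> 1" "length xs \<le> l" "fits coeff_bits k"
  shows "computes Scale_F [int_code k, ints_code xs] (coeff_scale_time l) (ints_code (map ((*) k) xs))"
  unfolding coeff_scale_time_def
  using assms all_fit_entry_bits[of xs 0 l] by (intro computes_scale fits_entry_bits) auto

lemma computes_monom_mult:
  assumes "coeff_norm acc \<le> 1" "length acc \<le> l" "fits coeff_bits k"
  shows "computes Scale_F [int_code k, ints_code (butlast (0 # acc))] (coeff_scale_time l)
    (ints_code (monom_mult k acc))"
proof -
  have "coeff_norm (butlast (0 # acc)) \<le> radius * coeff_norm acc"
    using weighted_norm_butlast[OF radius_nonneg, of "0 # acc"] by simp
  also have "\<dots> \<le> 1"
    using assms(1) radius_le_1 radius_nonneg by (intro mult_le_one) (auto simp: weighted_norm_nonneg)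
  finally show ?thesis
    unfolding monom_mult_def using assms(2,3) by (intro computes_coeff_scale) auto
qed

definition pin_time :: "nat \<Rightarrow> nat \<Rightarrow> nat" where
  "pin_time l w =
     60 * w + 20 * l + coeff_scale_time l + 2 * cells (int_code a) + 2 * cells (int_code g) + 200"

lemma computes_pin_product_Cons:
  assumes "v < 2 ^ w" "u < 2 ^ w" "coeff_norm acc \<le> 1" "length acc \<le> l"
    and rec: "computes Pin_Product_F [nat_code v, pins_code P,
      ints_code (if u = v then monom_mult (if f then g else a) acc else acc)] T y"
  shows "computes Pin_Product_F [nat_code v, pins_code ((u, f) # P), ints_code acc] (T + pin_time l w) y"
proof -
  define k where "k = (if f then g else a)"
  have exec_k: "exec prog env (if bool_code f = Atom then int_E a else int_E g)
      = Some (2 * cells (int_code k) + 1, int_code k)" for env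
    by (simp add: k_def)
  have k_time: "cells (int_code k) \<le> cells (int_code a) + cells (int_code g)"
    by (simp add: k_def)
  have "fits coeff_bits k"
    using fits_parameters by (simp add: k_def)
  note scale = computesD[OF computes_monom_mult[OF assms(3,4) this]]
  note butlast = computesD[OF computes_butlast[of 0 acc]]
  note eq = computesD[OF computes_eq_below[OF assms(2,1)]]
  note rec = computesD[OF rec[folded k_def]]
  show ?thesis
  proof (cases "u = v")
    case True
    then show ?thesis
      unfolding computes_def call_def
      using eq(2) butlast(2) scale(2) rec(2) k_time assms(4)
      by (simp add: run_simps eq(1)[unfolded True] butlast(1) scale(1) rec(1)[unfolded if_P[OF True]]
          exec_k pin_time_def
          del: bool_code_eq_Atom butlast.simps)
  next
    case False
    then show ?thesis
      unfolding computes_def call_def using eq rec by (simp add: run_simps pin_time_def)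
  qed
qed

lemma computes_pin_product:
  assumes "v < 2 ^ w" "pins_below (2 ^ w) P" "coeff_norm acc \<le> 1" "length acc \<le> l" "length P \<le> n"
  shows "computes Pin_Product_F [nat_code v, pins_code P, ints_code acc] ((n + 1) * pin_time l w)
     (ints_code (pin_product v P acc))"
proof -
  have "computes Pin_Product_F [nat_code v, pins_code P, ints_code acc] ((length P + 1) * pin_time l w)
     (ints_code (pin_product v P acc))"
    using assms(2-4)
  proof (induction P arbitrary: acc)
    case Nil
    then show ?case
      by (simp add: computes_def call_def run_simps pin_time_def pin_product_def)
  next
    case (Cons q P)
    obtain u f where q_eq: "q = (u, f)"
      by (cases q)
    let ?acc = "if u = v then monom_mult (if f then g else a) acc else acc"
    have "coeff_norm ?acc \<le> 1" "length ?acc \<le> l"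
      using Cons.prems coeff_norm_monom_mult_le_1[of _ acc] by auto
    then have "computes Pin_Product_F [nat_code v, pins_code P, ints_code ?acc]
        ((length P + 1) * pin_time l w) (ints_code (pin_product v P ?acc))"
      using Cons.prems(1) by (intro Cons.IH) (simp_all add: q_eq)
    then have "computes Pin_Product_F [nat_code v, pins_code ((u, f) # P), ints_code acc]
        ((length P + 1) * pin_time l w + pin_time l w) (ints_code (pin_product v P ?acc))"
      using Cons.prems by (intro computes_pin_product_Cons assms(1)) (simp_all add: q_eq)
    moreover have "pin_product v (q # P) acc = pin_product v P ?acc"
      by (simp add: q_eq pin_product_def)
    moreover have "(length (q # P) + 1) * pin_time l w = (length P + 1) * pin_time l w + pin_time l w"
      by simp
    ultimately show ?case
      by (simp only: q_eq)
  qed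
  then show ?thesis
    by (rule computes_mono) (use assms(5) in \<open>intro mult_right_mono, auto\<close>)
qed

subsection \<open>The factor of an edge\<close>

definition edge_step_time :: "nat \<Rightarrow> nat" where
  "edge_step_time l = 20 * l + 3 * coeff_scale_time l + (l + 1) * series_mult_time l (entry_bits l)
     + (l + 2) * series_div_time l (entry_bits l)
     + 10 * cells (int_code a) + 10 * cells (int_code g) + 100"

lemma computes_edge_numerator:
  assumes "coeff_norm r \<le> 1" "coeff_norm acc \<le> 1" "length r < l" "length acc \<le> l"
  shows "computes Series_Mult_F [ints_code (monom_mult a acc), ints_code (1 # map ((*) g) r)]
    ((l + 1) * series_mult_time l (entry_bits l))
    (ints_code (series_mult (monom_mult a acc) (1 # map ((*) g) r)))"
proof (rule computes_series_mult)
  show "all_fit (entry_bits l) (monom_mult a acc)"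
    using coeff_norm_monom_mult[OF parameter_radius_le(1) assms(2)] assms(4)
    by (intro all_fit_entry_bits[of _ 0]) auto
  show "all_fit (entry_bits l) (1 # map ((*) g) r)"
    using order_trans[OF coeff_norm_one_plus[OF assms(1)], of "2 ^ 1"] assms(3)
    by (intro all_fit_entry_bits[of _ 1]) (auto simp del: weighted_norm.simps)
qed (use assms in auto)

lemma computes_edge_quotient:
  assumes "coeff_norm r \<le> 1" "coeff_norm xs \<le> 1" "length r \<le> l" "length xs \<le> l"
  shows "computes Series_Div_F [ints_code xs, ints_code (map ((*) a) r)]
    ((l + 2) * series_div_time l (entry_bits l)) (ints_code (series_div xs (map ((*) a) r)))"
proof -
  have a_r: "coeff_norm (map ((*) a) r) \<le> 2 ^ coeff_bits"
    using coeff_norm_scale[OF parameter_radius_le(1) assms(1)]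
      weighted_norm_nonneg[OF radius_nonneg, of "map ((*) a) r"]
    by (simp add: radius_def field_simps)
  have "coeff_bits * (0 + length xs) \<le> coeff_bits * (l + 2)"
    using assms(4) by (intro mult_left_mono) auto
  then have "coeff_bits * (0 + length xs) < entry_bits l"
    by (simp add: entry_bits_def)
  then have "computes Series_Div_F [ints_code xs, ints_code (map ((*) a) r)]
      ((length xs + 1) * series_div_time l (entry_bits l)) (ints_code (series_div xs (map ((*) a) r)))"
    using a_r assms all_fit_entry_bits[OF a_r]
    by (intro computes_series_div[where c = coeff_bits and j = 0]) (auto simp: radius_def)
  then show ?thesis
    by (rule computes_mono) (use assms(4) in \<open>intro mult_right_mono, auto\<close>)
qed

lemma computes_edge_step:
  assumes "coeff_norm r \<le> 1" "coeff_norm acc \<le> 1" "length r < l" "length acc \<le> l"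
  shows "computes Edge_Step_F [ints_code r, ints_code acc] (edge_step_time l) (ints_code (edge_step r acc))"
proof -
  have length_r: "length r \<le> l"
    using assms(3) by simp
  let ?num = "series_mult (monom_mult a acc) (1 # map ((*) g) r)"
  have "coeff_norm ?num \<le> 1" "length ?num \<le> l"
    using coeff_norm_edge_numerator[OF assms(1,2)] assms(4) by auto
  note quotient = computesD[OF computes_edge_quotient[OF assms(1) this(1) length_r this(2)],
      folded edge_step_def]
  note butlast = computesD[OF computes_butlast[of 0 acc]]
  note scale_acc = computesD[OF computes_monom_mult[OF assms(2,4) fits_parameters(1)]]
  note scale_r = computesD[OF computes_coeff_scale[OF assms(1) length_r fits_parameters(1)]]
    computesD[OF computes_coeff_scale[OF assms(1) length_r fits_parameters(2)]]
  note product = computesD[OF computes_edge_numerator[OF assms], unfolded list_code_simps]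
  show ?thesis
    unfolding computes_def call_def
    by (simp add: run_simps butlast(1) scale_acc(1) scale_r(1,3) product(1) quotient(1)
        del: series_mult.simps butlast.simps)
      (use butlast(2) scale_acc(2) scale_r(2,4) product(2) quotient(2) assms(4)
        in \<open>unfold edge_step_time_def; linarith\<close>)
qed

subsection \<open>The recursion\<close>

definition overhead :: "nat \<Rightarrow> nat \<Rightarrow> nat \<Rightarrow> nat" where
  "overhead l n w =
     2 * edge_scan_time n w + (n + 1) * pin_time l w + 20 * l + 20 * n + edge_step_time l + 200"

text \<open>The cost of \<^const>\<open>ratio_coeffs\<close> for \<open>k\<close> coefficients and \<open>d\<close> neighbours at each vertex, if a single call costs \<open>W\<close>.\<close>

fun ratio_time :: "nat \<Rightarrow> nat \<Rightarrow> nat \<Rightarrow> nat" where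
  "ratio_time W d 0 = W"
| "ratio_time W d (Suc k) = 2 * W + d * (W + ratio_time W d k)"

lemma ratio_time_le: "ratio_time W d k \<le> 2 * W * (d + 2) ^ k"
proof -
  have "ratio_time W d k + W \<le> 2 * W * (d + 2) ^ k"
  proof (induction k)
    case (Suc k)
    have "3 * W \<le> 4 * W * 1"
      by simp
    also have "\<dots> \<le> 4 * W * (d + 2) ^ k"
      by (intro mult_left_mono) auto
    finally have "ratio_time W d (Suc k) + W \<le> 4 * W * (d + 2) ^ k + d * (W + ratio_time W d k)"
      by simp
    also have "\<dots> \<le> 4 * W * (d + 2) ^ k + d * (2 * W * (d + 2) ^ k)"
      using Suc by (intro add_left_mono mult_left_mono) (auto simp: add.commute)
    also have "\<dots> = 2 * W * (d + 2) ^ Suc k"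
      by (simp add: algebra_simps)
    finally show ?case .
  qed simp
  then show ?thesis
    by simp
qed

abbreviation ratio_args :: "nat \<Rightarrow> nat \<Rightarrow> (nat \<times> nat) list \<Rightarrow> (nat \<times> bool) list \<Rightarrow> data list" where
  "ratio_args k v E P \<equiv> [unary_code k, nat_code v, edges_code E, pins_code P]"

abbreviation ratio_loop_args ::
    "nat \<Rightarrow> (nat \<times> nat) list \<Rightarrow> (nat \<times> bool) list \<Rightarrow> nat list \<Rightarrow> int list \<Rightarrow> data list" where
  "ratio_loop_args k E P us acc \<equiv>
     [unary_code k, edges_code E, pins_code P, list_code nat_code us, ints_code acc]"

lemma computes_ratio_Suc:
  assumes "k < l" "v < 2 ^ w" "edges_below (2 ^ w) E" "pins_below (2 ^ w) P" "length E + length P \<le> n"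
    and rec: "computes Ratio_Loop_F (ratio_loop_args k (delete_vertex v E) P (neighbours v E)
      (pin_product v P (1 # replicate k 0))) T y"
  shows "computes Ratio_F (ratio_args (Suc k) v E P) (T + overhead l n w) y"
proof -
  have lengths_le: "length E \<le> n" "length P \<le> n"
    using assms(5) by simp_all
  have unit: "coeff_norm (1 # replicate k 0) \<le> 1" "length (1 # replicate k (0::int)) \<le> l"
    using assms(1) by auto
  note loop = computesD[OF rec]
  note rest = computesD[OF computes_delete_vertex[OF assms(2,3) lengths_le(1)]]
  note nbrs = computesD[OF computes_neighbours[OF assms(2,3) lengths_le(1)]]
  note zeros = computesD[OF computes_zeros[of k]]
  note pins = computesD[OF computes_pin_product[OF assms(2,4) unit lengths_le(2)], unfolded list_code_simps]
  show ?thesis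
    unfolding computes_def call_def
    by (simp add: run_simps loop(1) rest(1) nbrs(1) zeros(1) pins(1))
      (use loop(2) rest(2) nbrs(2) zeros(2) pins(2) assms(1) in \<open>unfold overhead_def; linarith\<close>)
qed

lemma computes_ratio_loop_Cons:
  assumes "coeff_norm r \<le> 1" "coeff_norm acc \<le> 1" "length r < l" "length acc \<le> l" "length us \<le> n"
    and ratio: "computes Ratio_F (ratio_args k u E (pin False us @ P)) T (ints_code r)"
    and rec: "computes Ratio_Loop_F (ratio_loop_args k E ((u, True) # P) us (edge_step r acc)) T' y"
  shows "computes Ratio_Loop_F (ratio_loop_args k E P (u # us) acc) (T + T' + overhead l n w) y"
proof -
  note ratio = computesD[OF ratio]
  note step = computesD[OF computes_edge_step[OF assms(1-4)]]
  note loop = computesD[OF rec, unfolded list_code_simps prod.case bool_code_simps]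
  note pins = computesD[OF computes_pin[of us P]]
  show ?thesis
    unfolding computes_def call_def
    by (simp add: run_simps ratio(1) step(1) loop(1) pins(1))
      (use ratio(2) step(2) loop(2) pins(2) assms(5) in \<open>unfold overhead_def; linarith\<close>)
qed

lemma computes_ratio:
  "k \<le> l \<Longrightarrow> v < 2 ^ w \<Longrightarrow> edges_below (2 ^ w) E \<Longrightarrow> pins_below (2 ^ w) P \<Longrightarrow>
   length E + length P \<le> n \<Longrightarrow> \<forall>u. length (neighbours u E) \<le> d \<Longrightarrow>
   computes Ratio_F (ratio_args k v E P) (ratio_time (overhead l n w) d k)
     (ints_code (ratio_coeffs k v E P))"
  and computes_ratio_loop:
  "k < l \<Longrightarrow> coeff_norm acc \<le> 1 \<Longrightarrow> length acc = Suc k \<Longrightarrow> edges_below (2 ^ w) E \<Longrightarrow> pins_below (2 ^ w) P \<Longrightarrow>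
   \<forall>u\<in>set us. u < 2 ^ w \<Longrightarrow> length E + length us + length P \<le> n \<Longrightarrow> \<forall>u. length (neighbours u E) \<le> d \<Longrightarrow>
   computes Ratio_Loop_F (ratio_loop_args k E P us acc)
     (overhead l n w + length us * (overhead l n w + ratio_time (overhead l n w) d k))
     (ints_code (ratio_loop k E P us acc))"
proof (induction k v E P and k E P us acc rule: ratio_coeffs_ratio_loop.induct)
  case (2 k v E P)
  let ?E = "delete_vertex v E" and ?us = "neighbours v E"
  define X where "X = overhead l n w + ratio_time (overhead l n w) d k"
  have "length (neighbours u ?E) \<le> d" for u
    using length_neighbours_delete_vertex[of u v E] "2.prems"(6) order_trans by blast
  then have "computes Ratio_Loop_F (ratio_loop_args k ?E P ?us (pin_product v P (1 # replicate k 0)))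
      (overhead l n w + length ?us * X) (ints_code (ratio_coeffs (Suc k) v E P))"
    unfolding X_def ratio_coeffs.simps
    using "2.prems" length_delete_vertex_neighbours[of v E]
    by (intro "2.IH" edges_below_delete_vertex edges_below_neighbours coeff_norm_pin_product) auto
  then have "computes Ratio_F (ratio_args (Suc k) v E P)
      (overhead l n w + length ?us * X + overhead l n w) (ints_code (ratio_coeffs (Suc k) v E P))"
    using "2.prems" by (intro computes_ratio_Suc) auto
  moreover have "length ?us * X \<le> d * X"
    using "2.prems"(6) by (intro mult_right_mono) auto
  ultimately show ?case
    by (elim computes_mono) (simp add: X_def)
next
  case (4 k E P u us acc)
  let ?r = "ratio_coeffs k u E (pin False us @ P)"
  have ratio: "computes Ratio_F (ratio_args k u E (pin False us @ P)) (ratio_time (overhead l n w) d k)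
      (ints_code ?r)"
    using "4.prems" by (intro "4.IH"(1) pins_below_pin) auto
  have rec: "computes Ratio_Loop_F (ratio_loop_args k E ((u, True) # P) us (edge_step ?r acc))
      (overhead l n w + length us * (overhead l n w + ratio_time (overhead l n w) d k))
      (ints_code (ratio_loop k E P (u # us) acc))"
    unfolding ratio_loop.simps using "4.prems"
    by (intro "4.IH"(2)) (auto simp: length_edge_step coeff_norm_edge_step coeff_norm_ratio_coeffs)
  show ?case
    by (rule computes_mono[OF computes_ratio_loop_Cons[where l = l and n = n and w = w,
          OF coeff_norm_ratio_coeffs _ _ _ _ ratio rec]])
      (use "4.prems" in auto)
qed (simp_all add: computes_def call_def run_simps overhead_def)

end

section \<open>Computing the fraction\<close>

context spin_parameters
begin

subsection \<open>Evaluating a truncated series\<close>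

lemma snd_horner: "snd (horner xs) = D ^ length xs"
  by (induction xs) (auto simp: case_prod_beta)

lemma horner_Cons: "horner (x # xs) = (x * (snd (horner xs) * D) + fst (horner xs), snd (horner xs) * D)"
  by (simp add: case_prod_beta)

lemma fits_snd_horner: "fits (coeff_bits * length xs + 1) (snd (horner xs))"
  unfolding snd_horner by (rule fits_power[OF fits_parameters(3)])

lemma fits_fst_horner:
  assumes "all_fit b xs"
  shows "fits (b + coeff_bits * length xs + 1 + length xs) (fst (horner xs))"
  using assms
proof (induction xs)
  case (Cons x xs)
  let ?b = "b + coeff_bits * length (x # xs) + 1 + length xs"
  have "fits (b + (coeff_bits * length (x # xs) + 1)) (x * snd (horner (x # xs)))"
    using Cons.prems by (intro fits_mult fits_snd_horner) simp
  then have "fits ?b (x * (snd (horner xs) * D))"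
    unfolding horner_Cons snd_conv by (rule fits_mono) simp
  moreover have "fits ?b (fst (horner xs))"
    by (rule fits_mono[OF Cons.IH]) (use Cons.prems in auto)
  ultimately have "fits (Suc ?b) (x * (snd (horner xs) * D) + fst (horner xs))"
    by (rule fits_add)
  then show ?case
    by (simp add: horner_Cons del: horner.simps)
qed simp

definition horner_bits :: "nat \<Rightarrow> nat" where
  "horner_bits l = entry_bits l + coeff_bits * l + 1 + l"

lemma fits_horner:
  assumes "all_fit (entry_bits l) xs" "length xs \<le> l"
  shows "fits (horner_bits l) (fst (horner xs))" "fits (horner_bits l) (snd (horner xs))"
proof -
  have coeff_bits_le: "coeff_bits * length xs \<le> coeff_bits * l"
    using assms(2) by (rule mult_left_mono) simp
  show "fits (horner_bits l) (fst (horner xs))"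
    by (rule fits_mono[OF fits_fst_horner[OF assms(1)]])
      (use assms(2) coeff_bits_le in \<open>unfold horner_bits_def; linarith\<close>)
  show "fits (horner_bits l) (snd (horner xs))"
    by (rule fits_mono[OF fits_snd_horner]) (use coeff_bits_le in \<open>unfold horner_bits_def; linarith\<close>)
qed

definition horner_time :: "nat \<Rightarrow> nat" where
  "horner_time l =
     2 * int_mul_time (horner_bits l) + 180 * horner_bits l + 2 * cells (int_code D) + 300"

abbreviation fraction_code :: "int \<times> int \<Rightarrow> data" where
  "fraction_code nd \<equiv> Cell (int_code (fst nd)) (int_code (snd nd))"

lemma computes_horner_Cons:
  assumes "all_fit (entry_bits l) (x # xs)" "length (x # xs) \<le> l"
    and rec: "computes Horner_F [ints_code xs] T (fraction_code (horner xs))"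
  shows "computes Horner_F [ints_code (x # xs)] (T + horner_time l) (fraction_code (horner (x # xs)))"
proof -
  let ?h = "horner_bits l" and ?d = "snd (horner xs)"
  have xs_fit: "all_fit (entry_bits l) xs" "length xs \<le> l"
    using assms(1,2) by auto
  have x_D_fit: "fits ?h x" "fits ?h D"
    using assms(1) fits_entry_bits[OF fits_parameters(3)]
    by (auto intro: fits_mono[of "entry_bits l"] simp: horner_bits_def)
  have d_D_fit: "fits ?h (?d * D)"
    using fits_horner(2)[OF assms(1,2)] by (simp add: horner_Cons del: horner.simps)
  have x_d_D_fit: "fits ?h (x * (?d * D))"
  proof -
    have "fits (entry_bits l + (coeff_bits * length (x # xs) + 1)) (x * snd (horner (x # xs)))"
      using assms(1) fits_snd_horner[of "x # xs"] by (intro fits_mult) auto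
    moreover have "coeff_bits * length (x # xs) \<le> coeff_bits * l"
      using assms(2) by (rule mult_left_mono) simp
    ultimately show ?thesis
      by (auto intro: fits_mono simp: horner_bits_def horner_Cons simp del: horner.simps)
  qed
  note tail = computesD[OF rec]
  note products = computesD[OF computes_int_mul[OF fits_horner(2)[OF xs_fit] x_D_fit(2)]]
    computesD[OF computes_int_mul[OF x_D_fit(1) d_D_fit]]
  note sum = computesD[OF computes_int_add[OF x_d_D_fit fits_horner(1)[OF xs_fit]]]
  show ?thesis
    unfolding computes_def call_def horner_Cons fst_conv snd_conv
    by (simp add: run_simps tail(1) products(1,3) sum(1))
      (use tail(2) products(2,4) sum(2) in \<open>unfold horner_time_def; linarith\<close>)
qed

lemma computes_horner:
  assumes "all_fit (entry_bits l) xs" "length xs \<le> l"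
  shows "computes Horner_F [ints_code xs] ((l + 1) * horner_time l) (fraction_code (horner xs))"
  using assms
proof (rule computes_list[where args = "\<lambda>xs. [ints_code xs]"])
  show "computes Horner_F [ints_code []] (horner_time l) (fraction_code (horner []))"
    by (simp add: computes_def call_def run_simps horner_time_def)
next
  fix x xs T
  assume "fits (entry_bits l) x" "all_fit (entry_bits l) xs" "length xs < l"
    and rec: "computes Horner_F [ints_code xs] T (fraction_code (horner xs))"
  then show "computes Horner_F [ints_code (x # xs)] (T + horner_time l) (fraction_code (horner (x # xs)))"
    by (intro computes_horner_Cons[OF _ _ rec]) auto
qed

subsection \<open>The product over all vertices\<close>

lemma computes_ratio_fraction:
  assumes "v < 2 ^ w" "edges_below (2 ^ w) E" "pins_below (2 ^ w) P" "length E + length P \<le> n"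
    "\<forall>u. length (neighbours u E) \<le> d"
  shows "computes Ratio_F (ratio_args l v E P)
      (2 * overhead l n w * (d + 2) ^ l) (ints_code (ratio_coeffs l v E P))"
    "computes Horner_F [ints_code (ratio_coeffs l v E P)] ((l + 1) * horner_time l)
      (fraction_code (horner (ratio_coeffs l v E P)))"
    "fits (horner_bits l) (fst (horner (ratio_coeffs l v E P)))"
    "fits (horner_bits l) (snd (horner (ratio_coeffs l v E P)))"
proof -
  let ?r = "ratio_coeffs l v E P"
  show "computes Ratio_F (ratio_args l v E P)
      (2 * overhead l n w * (d + 2) ^ l) (ints_code ?r)"
    using computes_ratio[OF order_refl assms] ratio_time_le by (rule computes_mono)
  have coeffs_fit: "all_fit (entry_bits l) ?r"
    using coeff_norm_ratio_coeffs[of l v E P] by (intro all_fit_entry_bits[of _ 0]) auto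
  then show "fits (horner_bits l) (fst (horner ?r))" "fits (horner_bits l) (snd (horner ?r))"
    by (auto intro: fits_horner)
  show "computes Horner_F [ints_code ?r] ((l + 1) * horner_time l) (fraction_code (horner ?r))"
    by (rule computes_horner[OF coeffs_fit]) simp
qed

abbreviation ratio_product_args ::
    "nat \<Rightarrow> (nat \<times> nat) list \<Rightarrow> (nat \<times> bool) list \<Rightarrow> nat list \<Rightarrow> int \<Rightarrow> int \<Rightarrow> data list" where
  "ratio_product_args k E P vs num den \<equiv>
     [unary_code k, edges_code E, pins_code P, list_code nat_code vs, int_code num, int_code den]"

definition vertex_time :: "nat \<Rightarrow> nat \<Rightarrow> nat \<Rightarrow> nat \<Rightarrow> nat" where
  "vertex_time l n w b = 2 * overhead l n w + (l + 1) * horner_time l + 2 * edge_scan_time n w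
     + 20 * n + 180 * horner_bits l + 2 * int_mul_time b + 500"

lemma vertex_time_mult_ge:
  assumes "1 \<le> X"
  shows "2 * overhead l n w * X + ((l + 1) * horner_time l + 2 * edge_scan_time n w
     + 20 * n + 180 * horner_bits l + 2 * int_mul_time b + 500) \<le> vertex_time l n w b * X"
proof -
  have "R \<le> R * X" for R
    using assms by simp
  then show ?thesis
    unfolding vertex_time_def by (simp only: add.assoc distrib_right) (intro add_mono order_refl)
qed

lemma computes_ratio_product_Cons:
  assumes "v < 2 ^ w" "edges_below (2 ^ w) E" "pins_below (2 ^ w) P" "length E + length P \<le> n"
    "\<forall>u. length (neighbours u E) \<le> d" "fits b num" "fits b den" "horner_bits l + 1 \<le> b"
    and horner_eq: "horner (ratio_coeffs l v E P) = (m, e)"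
    and rec: "computes Ratio_Product_F (ratio_product_args l (delete_vertex v E)
      (pin False (neighbours v E) @ P) vs (num * (e + m)) (den * e)) T y"
  shows "computes Ratio_Product_F (ratio_product_args l E P (v # vs) num den)
    (T + vertex_time l n w b * (d + 2) ^ l) y"
proof -
  have edge_bounds: "length E \<le> n" "length (neighbours v E) \<le> n"
    using assms(4) length_delete_vertex_neighbours[of v E] by linarith+
  note ratio = computes_ratio_fraction[OF assms(1-5), of l, unfolded horner_eq fst_conv snd_conv]
  have factors: "fits b (e + m)" "fits b e"
    using fits_mono[OF fits_add[OF ratio(4,3)]] fits_mono[OF ratio(4)] assms(8) by auto
  note coeffs = computesD[OF ratio(1)] and fraction = computesD[OF ratio(2)]
  note sum = computesD[OF computes_int_add[OF ratio(4,3)]]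
  note products = computesD[OF computes_int_mul[OF assms(6) factors(1)]]
    computesD[OF computes_int_mul[OF assms(7) factors(2)]]
  note rest = computesD[OF computes_delete_vertex[OF assms(1,2) edge_bounds(1)]]
  note nbrs = computesD[OF computes_neighbours[OF assms(1,2) edge_bounds(1)]]
  note pins = computesD[OF computes_pin[of "neighbours v E" P]]
  note others = computesD[OF rec]
  define X where "X = (d + 2) ^ l"
  have "1 \<le> X"
    by (simp add: X_def)
  note time = vertex_time_mult_ge[OF this, of l n w b]
  note coeffs = coeffs[folded X_def]
  show ?thesis
    unfolding computes_def call_def X_def[symmetric]
    by (simp add: run_simps coeffs(1) fraction(1) sum(1) products(1,3) rest(1) nbrs(1) pins(1) others(1))
      (use coeffs(2) fraction(2) sum(2) products(2,4) rest(2) nbrs(2) pins(2) others(2)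
          edge_bounds(2) time in linarith)
qed

lemma computes_ratio_product:
  assumes "\<forall>v\<in>set vs. v < 2 ^ w" "edges_below (2 ^ w) E" "pins_below (2 ^ w) P" "length E + length P \<le> n"
    "\<forall>u. length (neighbours u E) \<le> d" "fits j num" "fits j den"
    "j + (length vs + 1) * (horner_bits l + 1) \<le> b"
  shows "computes Ratio_Product_F (ratio_product_args l E P vs num den)
     ((length vs + 1) * (vertex_time l n w b * (d + 2) ^ l))
     (fraction_code (ratio_product l E P vs num den))"
  using assms
proof (induction vs arbitrary: E P num den j)
  case Nil
  have "500 \<le> vertex_time l n w b * (d + 2) ^ l"
    using vertex_time_mult_ge[of "(d + 2) ^ l" l n w b] by simp
  then show ?case
    by (simp add: computes_def call_def run_simps)
next
  case (Cons v vs)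
  let ?E = "delete_vertex v E" and ?P = "pin False (neighbours v E) @ P" and ?h = "horner_bits l + 1"
  obtain m e where horner_eq: "horner (ratio_coeffs l v E P) = (m, e)"
    by (cases "horner (ratio_coeffs l v E P)")
  have vs_below: "v < 2 ^ w" "\<forall>v\<in>set vs. v < 2 ^ w"
    using Cons.prems(1) by auto
  have "fits (horner_bits l) m" "fits (horner_bits l) e"
    using computes_ratio_fraction(3,4)[OF vs_below(1) Cons.prems(2-5), of l] by (simp_all add: horner_eq)
  then have "fits (j + ?h) (num * (e + m))" "fits (j + ?h) (den * e)"
    using Cons.prems(6,7) by (auto intro!: fits_mult fits_mono[OF fits_add] intro: fits_mono)
  moreover have "j + ?h + (length vs + 1) * ?h \<le> b"
    using Cons.prems(8) by simp
  moreover have "length (neighbours u ?E) \<le> d" for u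
    using length_neighbours_delete_vertex[of u v E] Cons.prems(5) order_trans by blast
  moreover have "length ?E + length ?P \<le> n"
    using length_delete_vertex_neighbours[of v E] Cons.prems(4) by simp
  ultimately have "computes Ratio_Product_F (ratio_product_args l ?E ?P vs (num * (e + m)) (den * e))
      ((length vs + 1) * (vertex_time l n w b * (d + 2) ^ l))
      (fraction_code (ratio_product l E P (v # vs) num den))"
    unfolding ratio_product.simps horner_eq prod.case using Cons.prems vs_below
    by (intro Cons.IH edges_below_delete_vertex edges_below_neighbours pins_below_pin) auto
  moreover have "fits b num" "fits b den" "?h \<le> b"
    using Cons.prems(6-8) by (auto intro: fits_mono)
  ultimately have "computes Ratio_Product_F (ratio_product_args l E P (v # vs) num den)
      ((length vs + 1) * (vertex_time l n w b * (d + 2) ^ l) + vertex_time l n w b * (d + 2) ^ l)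
      (fraction_code (ratio_product l E P (v # vs) num den))"
    using Cons.prems vs_below horner_eq by (intro computes_ratio_product_Cons) auto
  then show ?case
    by (rule computes_mono) simp
qed

subsection \<open>The entry point\<close>

definition power_bits :: "nat \<Rightarrow> nat" where
  "power_bits n = coeff_bits * n + coeff_bits + 1"

definition product_bits :: "nat \<Rightarrow> nat \<Rightarrow> nat" where
  "product_bits n l = power_bits n + (n + 1) * (horner_bits l + 1)"

definition setup_time :: "nat \<Rightarrow> nat" where
  "setup_time n = (n + 1) * (60 * n + 100) + 2 * (n * (2 * K + 20)) + 2 * edge_scan_time n n
     + 2 * ((n + 1) * (int_mul_time (power_bits n) + 30)) + 20 * n + 20 * K
     + 10 * cells (int_code (sgn a * D)) + 10 * cells (int_code \<bar>a\<bar>) + 500"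

definition main_factor :: "nat \<Rightarrow> nat \<Rightarrow> nat" where
  "main_factor n l = (n + 1) * vertex_time l (2 * n) n (product_bits n l) + setup_time n"

lemma fits_initial_fraction: "fits coeff_bits (sgn a * D)" "fits coeff_bits \<bar>a\<bar>"
  using fits_parameters by (auto simp: fits_def abs_mult sgn_if)

lemma computes_num_coeffs:
  assumes "length vs \<le> n" "bit_length q \<le> n" "bit_length p \<le> n"
  shows "computes Length_F [list_code nat_code vs] ((n + 1) * (60 * n + 100)) (nat_code (length vs))"
    and "computes Drop_F [nat_code q, nat_code p] (20 * n + 20) (nat_code (q div 2 ^ bit_length p))"
    and "computes Fuel_F [nat_code (q div 2 ^ bit_length p), unary_code (3 * K)] (n * (2 * K + 20) + 20)
      (unary_code (K * (bit_length q - bit_length p) + 3 * K))"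
    and "computes Fuel_F [nat_code (length vs), unary_code (K * (bit_length q - bit_length p) + 3 * K)]
      (n * (2 * K + 20) + 20) (unary_code (num_coeffs (length vs) p q))"
proof -
  show "computes Length_F [list_code nat_code vs] ((n + 1) * (60 * n + 100)) (nat_code (length vs))"
    by (rule computes_length[OF assms(1)])
  show "computes Drop_F [nat_code q, nat_code p] (20 * n + 20) (nat_code (q div 2 ^ bit_length p))"
    by (rule computes_mono[OF computes_drop]) (use assms(3) in simp)
  have fuel: "computes Fuel_F [nat_code m, unary_code k] (n * (2 * K + 20) + 20)
      (unary_code (K * bit_length m + k))" if "bit_length m \<le> n" for m k
    by (rule computes_mono[OF computes_fuel]) (use that in \<open>intro add_right_mono mult_right_mono, auto\<close>)
  show "computes Fuel_F [nat_code (q div 2 ^ bit_length p), unary_code (3 * K)] (n * (2 * K + 20) + 20)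
      (unary_code (K * (bit_length q - bit_length p) + 3 * K))"
    using fuel[of "q div 2 ^ bit_length p" "3 * K"] assms(2) by (simp add: bit_length_div_power)
  have "bit_length (length vs) \<le> n"
    using bit_length_le_self[of "length vs"] assms(1) by simp
  moreover have "num_coeffs (length vs) p q
      = K * bit_length (length vs) + (K * (bit_length q - bit_length p) + 3 * K)"
    by (simp add: num_coeffs_def distrib_left)
  ultimately show "computes Fuel_F
      [nat_code (length vs), unary_code (K * (bit_length q - bit_length p) + 3 * K)]
      (n * (2 * K + 20) + 20) (unary_code (num_coeffs (length vs) p q))"
    by (simp only: fuel)
qed

lemma computes_approx_fraction:
  assumes "length vs \<le> n" "length es \<le> n" "\<forall>v\<in>set vs. v < 2 ^ n" "edges_below (2 ^ n) es"
    "\<forall>u. length (neighbours u (proper_edges es)) \<le> d"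
  shows "computes Ratio_Product_F (ratio_product_args l (proper_edges es) (loop_pins es) vs
        ((sgn a * D) ^ length es) (\<bar>a\<bar> ^ length es))
      ((n + 1) * vertex_time l (2 * n) n (product_bits n l) * (d + 2) ^ l)
      (fraction_code (approx_fraction l vs es))"
proof -
  have "fits (power_bits n) (i ^ length es)" if "fits coeff_bits i" for i
    using that assms(2) by (intro fits_mono[OF fits_power]) (auto simp: power_bits_def trans_le_add1)
  then have "fits (power_bits n) ((sgn a * D) ^ length es)" "fits (power_bits n) (\<bar>a\<bar> ^ length es)"
    using fits_initial_fraction by auto
  moreover have "length (proper_edges es) + length (loop_pins es) \<le> 2 * n"
    using length_proper_edges_loop_pins[of es] assms(2) by linarith
  moreover have "power_bits n + (length vs + 1) * (horner_bits l + 1) \<le> product_bits n l"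
    unfolding product_bits_def using assms(1) by (intro add_left_mono mult_right_mono) auto
  ultimately have "computes Ratio_Product_F (ratio_product_args l (proper_edges es) (loop_pins es) vs
        ((sgn a * D) ^ length es) (\<bar>a\<bar> ^ length es))
      ((length vs + 1) * (vertex_time l (2 * n) n (product_bits n l) * (d + 2) ^ l))
      (fraction_code (approx_fraction l vs es))"
    unfolding approx_fraction_def using assms
    by (intro computes_ratio_product edges_below_proper_edges pins_below_loop_pins) auto
  then show ?thesis
    unfolding mult.assoc by (rule computes_mono) (use assms(1) in \<open>intro mult_right_mono, auto\<close>)
qed

theorem computes_main:
  assumes "length vs \<le> n" "length es \<le> n" "\<forall>v\<in>set vs. v < 2 ^ n" "edges_below (2 ^ n) es"
    "\<forall>u. length (neighbours u (proper_edges es)) \<le> d" "bit_length p \<le> n" "bit_length q \<le> n"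
  defines "l \<equiv> num_coeffs (length vs) p q"
  shows "computes Main_F
     [Cell (Cell (list_code nat_code vs) (edges_code es)) (Cell (int_code (int p)) (nat_code q))]
     (main_factor n l * (d + 2) ^ l)
     (Cell (int_code (fst (approx_fraction l vs es))) (nat_code (nat \<bar>snd (approx_fraction l vs es)\<bar>)))"
proof -
  note count = computes_num_coeffs[OF assms(1,7,6), THEN computesD(1)]
    and count_time = computes_num_coeffs[OF assms(1,7,6), THEN computesD(2)]
  note proper = computesD[OF computes_proper_edges[OF assms(4,2)]]
  note loops = computesD[OF computes_loop_pins[OF assms(4,2)]]
  have "computes Power_F [int_code i, edges_code es] ((n + 1) * (int_mul_time (power_bits n) + 30))
      (int_code (i ^ length es))" if "fits coeff_bits i" for i
    using that assms(2) by (intro computes_power[where c = coeff_bits]) (auto simp: power_bits_def)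
  note powers = computesD[OF this[OF fits_initial_fraction(1)]]
    computesD[OF this[OF fits_initial_fraction(2)]]
  note product = computesD[OF computes_approx_fraction[OF assms(1-5), of l]]
  define X where "X = (d + 2) ^ l"
  have "setup_time n * 1 \<le> setup_time n * X"
    unfolding X_def by (intro mult_left_mono) auto
  then have time: "(n + 1) * vertex_time l (2 * n) n (product_bits n l) * X + setup_time n
      \<le> main_factor n l * X"
    by (simp add: main_factor_def distrib_right)
  note product = product[folded X_def]
  show ?thesis
    unfolding computes_def call_def X_def[symmetric]
    by (simp add: run_simps count[folded l_def] proper(1) loops(1) powers(1,3) product(1))
      (use count_time proper(2) loops(2) powers(2,4) product(2) time in \<open>unfold setup_time_def; linarith\<close>)
qed

end

section \<open>Approximation schemes\<close>

lemma length_le_cells: "length xs \<le> cells (list_code f xs)"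
  by (induction xs) auto

lemma cells_le_list_code: "x \<in> set xs \<Longrightarrow> cells (f x) \<le> cells (list_code f xs)"
  by (induction xs) auto

lemma length_bits: "length (bits n) = bit_length n"
proof (induction n rule: bits.induct)
  case (1 n)
  then show ?case
    by (cases "n = 0") (auto simp: bits.simps[of n] bits.simps[of 0] bit_length_unfold[of n])
qed

lemma bit_length_le_cells: "bit_length n \<le> cells (nat_code n)"
  unfolding length_bits[symmetric] nat_code_def by (rule length_le_cells)

lemma less_two_power_cells:
  assumes "cells (nat_code v) \<le> n"
  shows "v < 2 ^ n"
proof -
  have "v < 2 ^ bit_length v"
    by (rule less_two_power_bit_length)
  also have "\<dots> \<le> 2 ^ n"
    using assms bit_length_le_cells[of v] by (intro power_increasing) auto
  finally show ?thesis .
qed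

lemma encodes_graphE:
  assumes "encodes_graph G x"
  obtains vs es where "distinct vs" "set vs = verts G" "enumerates_edges es G"
    "x = Cell (list_code nat_code vs) (edges_code es)"
  using assms unfolding encodes_graph_def enumerates_edges_def by blast

lemma encodes_rat_posE:
  assumes "encodes_rat \<epsilon> x" "\<epsilon> > 0"
  obtains p q where "p > 0" "q > 0" "\<epsilon> = of_nat p / of_nat q" "x = Cell (int_code (int p)) (nat_code q)"
proof -
  obtain i q where q_eq: "q > 0" "\<epsilon> = of_int i / of_nat q" "x = Cell (int_code i) (nat_code q)"
    using assms(1) unfolding encodes_rat_def by blast
  then have "i > 0"
    using assms(2) by (simp add: zero_less_divide_iff)
  then show thesis
    using q_eq that[of "nat i" q] by simp
qed

lemma input_size_bounds:
  assumes "n = cells (Cell (Cell (list_code nat_code vs) (edges_code es))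
      (Cell (int_code (int p)) (nat_code q)))"
    and "p > 0" "q > 0"
  shows "4 \<le> n" "length vs \<le> n" "length es \<le> n" "\<forall>v\<in>set vs. v < 2 ^ n" "edges_below (2 ^ n) es"
    "bit_length p \<le> n" "bit_length q \<le> n"
proof -
  have n_eq: "n = 4 + cells (list_code nat_code vs) + cells (edges_code es)
      + cells (nat_code p) + cells (nat_code q)"
    using assms(1) by (simp add: int_code_def bool_code_def)
  show "4 \<le> n"
    by (simp add: n_eq)
  show "length vs \<le> n" "length es \<le> n" "bit_length p \<le> n" "bit_length q \<le> n"
    using length_le_cells[of vs nat_code] length_le_cells[of es "\<lambda>(u, v). Cell (nat_code u) (nat_code v)"]
      bit_length_le_cells[of p] bit_length_le_cells[of q]
    unfolding n_eq by linarith+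
  show "\<forall>v\<in>set vs. v < 2 ^ n"
    using cells_le_list_code[of _ vs nat_code] unfolding n_eq
    by (intro ballI less_two_power_cells) (simp add: trans_le_add1 trans_le_add2)
  show "edges_below (2 ^ n) es"
    unfolding edges_below_def
  proof (intro ballI, clarify)
    fix u v assume "(u, v) \<in> set es"
    then have "cells (nat_code u) + cells (nat_code v) < cells (edges_code es)"
      using cells_le_list_code[of "(u, v)" es "\<lambda>(u, v). Cell (nat_code u) (nat_code v)"] by simp
    then show "u < 2 ^ n \<and> v < 2 ^ n"
      by (intro conjI less_two_power_cells) (simp_all add: n_eq)
  qed
qed

lemma length_neighbours_le_degree:
  "length (neighbours u (proper_edges es))
    \<le> length (filter (\<lambda>e. u \<in> set_uprod e) (map (\<lambda>(u, v). Upair u v) es))"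
  by (induction es rule: loop_pins.induct) auto

lemma length_neighbours_le_max_degree:
  assumes "wf_multigraph G" "max_degree_le G \<Delta>" "enumerates_edges es G"
  shows "length (neighbours u (proper_edges es)) \<le> \<Delta>"
proof (cases "u \<in> verts G")
  case True
  have "length (filter (\<lambda>e. u \<in> set_uprod e) (map (\<lambda>(u, v). Upair u v) es))
      = size {#e \<in># edges G. u \<in> set_uprod e#}"
    using assms(3) unfolding enumerates_edges_def by (metis mset_filter size_mset)
  also have "\<dots> \<le> vertex_degree G u"
    by (simp add: vertex_degree_def)
  also have "\<dots> \<le> \<Delta>"
    using assms(2) True by (simp add: max_degree_le_def)
  finally show ?thesis
    using length_neighbours_le_degree[of u es] by simp
next
  case False
  then have "set (neighbours u (proper_edges es)) = {}"
    using enumerates_edges_subset[OF assms(1,3)] unfolding set_neighbours by (auto simp: proper_edges_def)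
  then show ?thesis
    by simp
qed

lemma length_neighbours_le_size:
  assumes "enumerates_edges es G"
  shows "length (neighbours u (proper_edges es)) \<le> size (edges G)"
proof -
  have "length (neighbours u (proper_edges es)) \<le> length (proper_edges es)"
    using length_delete_vertex_neighbours[of u "proper_edges es"] by linarith
  also have "\<dots> \<le> length es"
    by (simp add: proper_edges_def)
  also have "\<dots> = size (edges G)"
    using assms unfolding enumerates_edges_def by (metis length_map size_mset)
  finally show ?thesis .
qed

lemma (in spin_parameters) num_coeffs_le_log:
  assumes "n \<le> N" "4 \<le> N" "p > 0" "q > 0"
  shows "real (num_coeffs n p q) \<le> real (5 * K) * log 2 (real N + real q / real p)"
proof -
  define L where "L = log 2 (real N + real q / real p)"
  have ratio_pos: "real q / real p > 0"
    using assms by simp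
  have L_ge: "2 \<le> L"
    unfolding L_def using assms(2) ratio_pos by (subst le_log_iff) auto
  have bit_length_le_log: "real (bit_length m) \<le> 1 + log 2 m" "log 2 m \<le> real (bit_length m)" if "m > 0" for m
    using that by (simp_all add: floorlog_def) linarith+
  have "real (bit_length n) \<le> 1 + L"
  proof (cases "n = 0")
    case False
    then have "log 2 n \<le> L"
      unfolding L_def using assms(1) ratio_pos by (subst log_le_cancel_iff) auto
    then show ?thesis
      using bit_length_le_log(1)[of n] False by simp
  qed (use L_ge in simp)
  moreover have "real (bit_length q - bit_length p) \<le> 1 + L"
  proof (cases "bit_length q \<le> bit_length p")
    case False
    have "log 2 q - log 2 p = log 2 (real q / real p)"
      using assms(3,4) by (simp add: log_divide)
    also have "\<dots> \<le> L"
      unfolding L_def using ratio_pos by (subst log_le_cancel_iff) auto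
    finally show ?thesis
      using False bit_length_le_log(1)[OF assms(4)] bit_length_le_log(2)[OF assms(3)]
      by (simp add: of_nat_diff)
  qed (use L_ge in simp)
  ultimately have "real (bit_length n + (bit_length q - bit_length p) + 3) \<le> 5 * L"
    using L_ge by simp
  then have "real K * real (bit_length n + (bit_length q - bit_length p) + 3) \<le> real K * (5 * L)"
    by (intro mult_left_mono) auto
  then show ?thesis
    by (simp add: num_coeffs_def L_def ac_simps)
qed

lemma (in spin_system) run_approximates:
  fixes x\<^sub>G x\<^sub>\<epsilon> and G :: "nat multigraph"
  defines "N \<equiv> cells (Cell x\<^sub>G x\<^sub>\<epsilon>)"
  assumes "wf_multigraph G" "encodes_graph G x\<^sub>G" "\<epsilon> > 0" "encodes_rat \<epsilon> x\<^sub>\<epsilon>"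
    and degree: "\<And>es u. enumerates_edges es G \<Longrightarrow> length (neighbours u (proper_edges es)) \<le> d"
  obtains t y z l where "runs prog (Cell x\<^sub>G x\<^sub>\<epsilon>) t y" "encodes_rat z y"
    "\<bar>z - partition_function \<beta> \<gamma> G\<bar> \<le> \<epsilon> * \<bar>partition_function \<beta> \<gamma> G\<bar>"
    "t \<le> main_factor N l * (d + 2) ^ l" "real l \<le> real (5 * K) * log 2 (real N + 1 / of_rat \<epsilon>)"
    "4 \<le> N" "size (edges G) \<le> N"
proof -
  obtain vs es where vs_verts: "distinct vs" "set vs = verts G" and es_edges: "enumerates_edges es G"
    and x\<^sub>G_eq: "x\<^sub>G = Cell (list_code nat_code vs) (edges_code es)"
    using assms(3) by (rule encodes_graphE)
  obtain p q where pq_pos: "p > 0" "q > 0" and \<epsilon>_eq: "\<epsilon> = of_nat p / of_nat q"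
    and x\<^sub>\<epsilon>_eq: "x\<^sub>\<epsilon> = Cell (int_code (int p)) (nat_code q)"
    using assms(5,4) by (rule encodes_rat_posE)
  note input_bounds = input_size_bounds[OF N_def[unfolded x\<^sub>G_eq x\<^sub>\<epsilon>_eq, THEN meta_eq_to_obj_eq] pq_pos]
  define l where "l = num_coeffs (length vs) p q"
  obtain n e where fraction_eq: "approx_fraction l vs es = (n, e)"
    by (cases "approx_fraction l vs es")
  note accurate = approx_fraction_accurate[OF assms(2) es_edges vs_verts pq_pos
      fraction_eq[unfolded l_def], folded \<epsilon>_eq]
  have "computes Main_F [Cell x\<^sub>G x\<^sub>\<epsilon>] (main_factor N l * (d + 2) ^ l)
      (Cell (int_code n) (nat_code (nat \<bar>e\<bar>)))"
    using computes_main[OF input_bounds(2-5) _ input_bounds(6,7), of d, folded l_def] degree[OF es_edges]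
    by (simp add: x\<^sub>G_eq x\<^sub>\<epsilon>_eq fraction_eq)
  then obtain t where "runs prog (Cell x\<^sub>G x\<^sub>\<epsilon>) t (Cell (int_code n) (nat_code (nat \<bar>e\<bar>)))"
    "t \<le> main_factor N l * (d + 2) ^ l"
    by (rule computes_Main_imp_runs)
  moreover have "encodes_rat (of_int n / of_int e) (Cell (int_code n) (nat_code (nat \<bar>e\<bar>)))"
    unfolding encodes_rat_def using accurate(1) by (intro exI[of _ n] exI[of _ "nat \<bar>e\<bar>"]) auto
  moreover have "real l \<le> real (5 * K) * log 2 (real N + 1 / of_rat \<epsilon>)"
    using num_coeffs_le_log[OF input_bounds(2,1) pq_pos] by (simp add: l_def \<epsilon>_eq of_rat_divide)
  moreover have "size (edges G) \<le> N"
    using es_edges input_bounds(3) unfolding enumerates_edges_def by (metis length_map size_mset)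
  ultimately show thesis
    using that accurate(2) input_bounds(1) by blast
qed

subsection \<open>Polynomial bounds\<close>

definition poly_bounded :: "(nat \<Rightarrow> nat \<Rightarrow> nat) \<Rightarrow> bool" where
  "poly_bounded f \<longleftrightarrow> (\<exists>c k. \<forall>n l. f n l \<le> c * (n + l + 1) ^ k)"

lemma poly_bounded_const: "poly_bounded (\<lambda>n l. m)"
  unfolding poly_bounded_def by (rule exI[of _ m], rule exI[of _ 0]) simp

lemma poly_bounded_fst: "poly_bounded (\<lambda>n l. n)" and poly_bounded_snd: "poly_bounded (\<lambda>n l. l)"
  unfolding poly_bounded_def by (rule exI[of _ 1], rule exI[of _ 1], simp)+

lemma poly_bounded_add:
  assumes "poly_bounded f" "poly_bounded g"
  shows "poly_bounded (\<lambda>n l. f n l + g n l)"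
proof -
  obtain b j c k where f_le: "\<And>n l. f n l \<le> b * (n + l + 1) ^ j" and g_le: "\<And>n l. g n l \<le> c * (n + l + 1) ^ k"
    using assms unfolding poly_bounded_def by blast
  have "f n l + g n l \<le> (b + c) * (n + l + 1) ^ (j + k)" for n l
  proof -
    have "b * (n + l + 1) ^ j \<le> b * (n + l + 1) ^ (j + k)" "c * (n + l + 1) ^ k \<le> c * (n + l + 1) ^ (j + k)"
      by (intro mult_left_mono power_increasing; simp)+
    then show ?thesis
      using f_le[of n l] g_le[of n l] unfolding distrib_right by linarith
  qed
  then show ?thesis
    unfolding poly_bounded_def by blast
qed

lemma poly_bounded_mult:
  assumes "poly_bounded f" "poly_bounded g"
  shows "poly_bounded (\<lambda>n l. f n l * g n l)"
proof -
  obtain b j c k where f_le: "\<And>n l. f n l \<le> b * (n + l + 1) ^ j" and g_le: "\<And>n l. g n l \<le> c * (n + l + 1) ^ k"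
    using assms unfolding poly_bounded_def by blast
  have "f n l * g n l \<le> (b * c) * (n + l + 1) ^ (j + k)" for n l
    using mult_mono[OF f_le[of n l] g_le[of n l]] by (simp add: power_add ac_simps)
  then show ?thesis
    unfolding poly_bounded_def by blast
qed

lemmas poly_bounded_intros =
  poly_bounded_const poly_bounded_fst poly_bounded_snd poly_bounded_add poly_bounded_mult

lemma (in spin_parameters) poly_bounded_main_factor: "poly_bounded main_factor"
  unfolding main_factor_def vertex_time_def setup_time_def product_bits_def power_bits_def
    overhead_def horner_time_def horner_bits_def edge_scan_time_def pin_time_def edge_step_time_def
    series_mult_time_def series_div_time_def coeff_scale_time_def scale_time_def series_add_time_def
    int_mul_time_def entry_bits_def
  by (intro poly_bounded_intros)

lemma two_power_le_power_if_le_log: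
  assumes "0 < X" "real l \<le> real m * log 2 X"
  shows "2 ^ l \<le> X ^ m"
proof -
  have "(2::real) ^ l = 2 powr real l"
    by (simp add: powr_realpow)
  also have "\<dots> \<le> 2 powr (log 2 X * real m)"
    using assms(2) by (intro powr_mono) (simp_all add: mult.commute)
  also have "\<dots> = X ^ m"
    unfolding powr_powr[symmetric] using assms(1) by (simp add: powr_realpow)
  finally show ?thesis .
qed

lemma size_le_power_if_le_log:
  assumes "2 \<le> X" "real n \<le> X" "real l \<le> real m * log 2 X"
  shows "real (n + l + 1) \<le> X ^ (m + 2)"
proof -
  have "l + 1 \<le> 2 ^ l"
    using less_exp[of l] by (simp add: Suc_leI)
  then have "real (l + 1) \<le> 2 ^ l"
    by (metis of_nat_le_iff of_nat_numeral of_nat_power)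
  also have "\<dots> \<le> X ^ m"
    using assms by (intro two_power_le_power_if_le_log) auto
  also have "\<dots> \<le> X ^ (m + 1)"
    using assms(1) by (intro power_increasing) auto
  finally have "real (l + 1) \<le> X ^ (m + 1)" .
  moreover have "X \<le> X ^ (m + 1)"
    using assms(1) by (intro self_le_power) auto
  ultimately have "real (n + l + 1) \<le> 2 * X ^ (m + 1)"
    using assms(2) by simp
  also have "\<dots> \<le> X * X ^ (m + 1)"
    using assms(1) by (intro mult_right_mono) auto
  finally show ?thesis
    by simp
qed

lemma bounded_degree_time_le:
  assumes "2 \<le> X" "real n \<le> X" "real l \<le> real m * log 2 X"
  shows "real (c * (n + l + 1) ^ k * (d + 2) ^ l) \<le> real c * X ^ ((m + 2) * k + m * (d + 1))"
proof -
  have "d + 2 \<le> 2 ^ (d + 1)"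
    using less_exp[of "d + 1"] by simp
  then have "real (d + 2) \<le> 2 ^ (d + 1)"
    by (metis of_nat_le_iff of_nat_numeral of_nat_power)
  then have "real (d + 2) ^ l \<le> (2 ^ (d + 1)) ^ l"
    by (intro power_mono) auto
  also have "\<dots> = (2 ^ l) ^ (d + 1)"
    by (simp only: power_mult[symmetric] mult.commute)
  also have "\<dots> \<le> (X ^ m) ^ (d + 1)"
    using assms by (intro power_mono two_power_le_power_if_le_log) auto
  finally have "real (d + 2) ^ l \<le> X ^ (m * (d + 1))"
    by (simp only: power_mult)
  moreover have "real (n + l + 1) ^ k \<le> X ^ ((m + 2) * k)"
    unfolding power_mult using size_le_power_if_le_log[OF assms] by (intro power_mono) auto
  ultimately have "real c * (real (n + l + 1) ^ k * real (d + 2) ^ l)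
      \<le> real c * (X ^ ((m + 2) * k) * X ^ (m * (d + 1)))"
    using assms(1) by (intro mult_left_mono mult_mono) auto
  then show ?thesis
    by (simp only: of_nat_mult of_nat_power power_add mult.assoc)
qed

lemma degree_power_le_powr_log:
  assumes "4 \<le> X" "real d \<le> X" "real l \<le> real m * log 2 X"
  shows "real (d + 2) ^ l \<le> 2 powr (2 * real m * log 2 X ^ 2)"
proof -
  have "real (d + 2) \<le> 2 * X"
    using assms(1,2) by simp
  also have "\<dots> \<le> X * X"
    using assms(1) by (intro mult_right_mono) auto
  also have "\<dots> = 2 powr (log 2 X + log 2 X)"
    unfolding powr_add using assms(1) by simp
  also have "log 2 X + log 2 X = 2 * log 2 X"
    by simp
  finally have "real (d + 2) ^ l \<le> (2 powr (2 * log 2 X)) ^ l"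
    by (intro power_mono) auto
  also have "\<dots> = 2 powr (2 * log 2 X * real l)"
    by (simp add: powr_realpow[symmetric] powr_powr)
  also have "\<dots> \<le> 2 powr (2 * real m * log 2 X ^ 2)"
    using assms(1) mult_left_mono[OF assms(3), of "2 * log 2 X"]
    by (intro powr_mono) (auto simp: power2_eq_square ac_simps)
  finally show ?thesis .
qed

lemma power_le_powr_log:
  assumes "2 \<le> X"
  shows "X ^ j \<le> 2 powr (real j * log 2 X ^ 2)"
proof -
  have "1 \<le> log 2 X"
    using assms by (simp add: le_log_iff)
  then have "log 2 X * real j \<le> log 2 X ^ 2 * real j"
    by (intro mult_right_mono) (auto simp: power2_eq_square)
  then have "2 powr (log 2 X * real j) \<le> 2 powr (real j * log 2 X ^ 2)"
    by (intro powr_mono) (simp_all add: mult.commute)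
  also have "2 powr (log 2 X * real j) = X powr real j"
    using assms by (simp only: powr_powr[symmetric] powr_log_cancel)
  also have "\<dots> = X ^ j"
    using assms by (simp add: powr_realpow)
  finally show ?thesis .
qed

lemma unbounded_degree_time_le:
  assumes "4 \<le> n" "real n \<le> X" "d \<le> n" "real l \<le> real m * log 2 X"
  shows "real (c * (n + l + 1) ^ k * (d + 2) ^ l)
    \<le> 2 powr ((real c + real ((m + 2) * k) + 2 * real m) * log 2 X ^ 2)"
proof -
  define L where "L = log 2 X"
  have X_ge: "4 \<le> X" "real d \<le> X"
    using assms(1-3) by simp_all
  then have L_ge: "1 \<le> L"
    by (simp add: L_def le_log_iff)
  have degree: "real (d + 2) ^ l \<le> 2 powr (2 * real m * L ^ 2)"
    unfolding L_def using X_ge assms(4) by (rule degree_power_le_powr_log)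
  have "real (n + l + 1) ^ k \<le> X ^ ((m + 2) * k)"
    unfolding power_mult using size_le_power_if_le_log[of X n l m] assms X_ge(1) by (intro power_mono) auto
  also have "\<dots> \<le> 2 powr (real ((m + 2) * k) * L ^ 2)"
    unfolding L_def using X_ge(1) by (intro power_le_powr_log) simp
  finally have size: "real (n + l + 1) ^ k \<le> 2 powr (real ((m + 2) * k) * L ^ 2)" .
  have "real c \<le> 2 powr real c"
    using less_exp[of c]
    by (metis less_imp_le of_nat_le_iff of_nat_numeral of_nat_power powr_realpow zero_less_numeral)
  also have "\<dots> \<le> 2 powr (real c * L ^ 2)"
    using L_ge by (intro powr_mono) (auto simp: mult_le_cancel_left1)
  finally have "real c * (real (n + l + 1) ^ k * real (d + 2) ^ l)
      \<le> 2 powr (real c * L ^ 2) * (2 powr (real ((m + 2) * k) * L ^ 2) * 2 powr (2 * real m * L ^ 2))"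
    using size degree by (intro mult_mono) auto
  also have "\<dots> = 2 powr ((real c + real ((m + 2) * k) + 2 * real m) * L ^ 2)"
    by (simp only: powr_add[symmetric]) (simp add: algebra_simps)
  finally show ?thesis
    by (simp only: of_nat_mult of_nat_power mult.assoc L_def)
qed

subsection \<open>The two schemes\<close>

context spin_system
begin

lemma approximates_within_prog:
  assumes wf: "\<And>G. G \<in> \<G> \<Longrightarrow> wf_multigraph G"
    and degree: "\<And>G es u. G \<in> \<G> \<Longrightarrow> enumerates_edges es G \<Longrightarrow> length (neighbours u (proper_edges es)) \<le> d G"
    and factor: "\<And>n l. main_factor n l \<le> c * (n + l + 1) ^ k"
    and time: "\<And>G n l s. G \<in> \<G> \<Longrightarrow> size (edges G) \<le> n \<Longrightarrow> 4 \<le> n \<Longrightarrow> 0 < s \<Longrightarrow>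
      real l \<le> real (5 * K) * log 2 (real n + s) \<Longrightarrow> real (c * (n + l + 1) ^ k * (d G + 2) ^ l) \<le> T n s"
  shows "approximates_within prog (partition_function \<beta> \<gamma>) \<G> T"
  unfolding approximates_within_def
proof (intro ballI allI impI)
  fix G \<epsilon> x\<^sub>G x\<^sub>\<epsilon>
  assume G_in: "G \<in> \<G>" and encodes_G: "encodes_graph G x\<^sub>G"
    and \<epsilon>_pos: "0 < \<epsilon>" and encodes_\<epsilon>: "encodes_rat \<epsilon> x\<^sub>\<epsilon>"
  let ?n = "cells (Cell x\<^sub>G x\<^sub>\<epsilon>)"
  obtain t y z l where run: "runs prog (Cell x\<^sub>G x\<^sub>\<epsilon>) t y" "encodes_rat z y"
      "\<bar>z - partition_function \<beta> \<gamma> G\<bar> \<le> \<epsilon> * \<bar>partition_function \<beta> \<gamma> G\<bar>"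
    and t_le: "t \<le> main_factor ?n l * (d G + 2) ^ l"
    and l_le: "real l \<le> real (5 * K) * log 2 (real ?n + 1 / of_rat \<epsilon>)"
    and size_le: "4 \<le> ?n" "size (edges G) \<le> ?n"
    using run_approximates[OF wf[OF G_in] encodes_G \<epsilon>_pos encodes_\<epsilon> degree[OF G_in]] by metis
  have "real t \<le> real (c * (?n + l + 1) ^ k * (d G + 2) ^ l)"
    using order_trans[OF t_le mult_right_mono[OF factor]] by (simp only: of_nat_le_iff)
  also have "\<dots> \<le> T ?n (1 / of_rat \<epsilon>)"
    using \<epsilon>_pos by (intro time[OF G_in size_le(2,1) _ l_le]) simp
  finally show "\<exists>t y z. runs prog (Cell x\<^sub>G x\<^sub>\<epsilon>) t y \<and> real t \<le> T ?n (1 / of_rat \<epsilon>) \<and>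
      encodes_rat z y \<and> \<bar>z - partition_function \<beta> \<gamma> G\<bar> \<le> \<epsilon> * \<bar>partition_function \<beta> \<gamma> G\<bar>"
    using run by blast
qed

theorem has_FPTAS_bounded_degree:
  "has_FPTAS (partition_function \<beta> \<gamma>) {G. wf_multigraph G \<and> max_degree_le G \<Delta>}"
proof -
  obtain c k where factor: "\<And>n l. main_factor n l \<le> c * (n + l + 1) ^ k"
    using poly_bounded_main_factor unfolding poly_bounded_def by blast
  have "approximates_within prog (partition_function \<beta> \<gamma>) {G. wf_multigraph G \<and> max_degree_le G \<Delta>}
      (\<lambda>n s. real c * (real n + s) ^ ((5 * K + 2) * k + 5 * K * (\<Delta> + 1)))"
  proof (rule approximates_within_prog[where d = "\<lambda>_. \<Delta>", OF _ _ factor])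
    show "length (neighbours u (proper_edges es)) \<le> \<Delta>"
      if "G \<in> {G. wf_multigraph G \<and> max_degree_le G \<Delta>}" "enumerates_edges es G" for G es u
      using that by (auto intro: length_neighbours_le_max_degree)
    show "real (c * (n + l + 1) ^ k * (\<Delta> + 2) ^ l)
        \<le> real c * (real n + s) ^ ((5 * K + 2) * k + 5 * K * (\<Delta> + 1))"
      if "4 \<le> n" "0 < s" "real l \<le> real (5 * K) * log 2 (real n + s)" for n l s
      using that by (intro bounded_degree_time_le) auto
  qed simp
  then show ?thesis
    unfolding has_FPTAS_def by blast
qed

theorem has_QPTAS: "has_QPTAS (partition_function \<beta> \<gamma>) {G. wf_multigraph G}"
proof -
  obtain c k where factor: "\<And>n l. main_factor n l \<le> c * (n + l + 1) ^ k"
    using poly_bounded_main_factor unfolding poly_bounded_def by blast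
  have "approximates_within prog (partition_function \<beta> \<gamma>) {G. wf_multigraph G}
      (\<lambda>n s. 2 powr ((real c + real ((5 * K + 2) * k) + 2 * real (5 * K)) * log 2 (real n + s) ^ 2))"
  proof (rule approximates_within_prog[where d = "\<lambda>G. size (edges G)", OF _ length_neighbours_le_size factor])
    show "real (c * (n + l + 1) ^ k * (size (edges G) + 2) ^ l)
        \<le> 2 powr ((real c + real ((5 * K + 2) * k) + 2 * real (5 * K)) * log 2 (real n + s) ^ 2)"
      if "size (edges G) \<le> n" "4 \<le> n" "0 < s" "real l \<le> real (5 * K) * log 2 (real n + s)"
      for G :: "nat multigraph" and n l s
      using that by (intro unbounded_degree_time_le) auto
  qed simp_all
  then show ?thesis
    unfolding has_QPTAS_def by blast
qed

end

lemma integral_parameters_exist: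
  fixes \<beta> \<gamma> :: rat
  assumes "\<beta> \<noteq> 0"
  obtains a g D :: int where "D > 0" "of_int a * \<beta> = of_int D" "of_int g = \<gamma> * of_int D"
proof -
  obtain p q r s where "quotient_of \<beta> = (p, q)" "quotient_of \<gamma> = (r, s)"
    by (metis surj_pair)
  then have q_props: "q > 0" "\<beta> = of_int p / of_int q" and s_props: "s > 0" "\<gamma> = of_int r / of_int s"
    by (auto dest: quotient_of_denom_pos quotient_of_div)
  then have p_nonzero: "p \<noteq> 0"
    using assms by auto
  show thesis
  proof
    show "\<bar>p\<bar> * s > 0"
      using p_nonzero s_props by simp
    have "of_int (sgn p * q * s) * \<beta> = of_int (sgn p * p * s)"
      using q_props by simp
    also have "sgn p * p = \<bar>p\<bar>"
      by (simp add: abs_sgn mult.commute)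
    finally show "of_int (sgn p * q * s) * \<beta> = of_int (\<bar>p\<bar> * s)" .
    show "of_int (r * \<bar>p\<bar>) = \<gamma> * of_int (\<bar>p\<bar> * s)"
      using s_props by simp
  qed
qed

lemma spin_system_exists:
  fixes \<beta> \<gamma> :: rat
  assumes "\<bar>\<gamma>\<bar> < \<bar>\<beta>\<bar>" "2 < \<bar>\<beta> + \<gamma>\<bar>"
  obtains a g D K \<rho> where "spin_system a g D K \<beta> \<gamma> \<rho>"
proof -
  obtain a g D :: int where "D > 0" "of_int a * \<beta> = of_int D" "of_int g = \<gamma> * of_int D"
    by (rule integral_parameters_exist[of \<beta> \<gamma>]) (use assms(1) in auto)
  moreover have "real_of_rat \<bar>\<gamma>\<bar> < of_rat \<bar>\<beta>\<bar>" "real_of_rat 2 < of_rat \<bar>\<beta> + \<gamma>\<bar>"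
    unfolding of_rat_less by (rule assms)+
  then have "\<bar>real_of_rat \<gamma>\<bar> < \<bar>real_of_rat \<beta>\<bar>" "2 < \<bar>real_of_rat \<beta> + real_of_rat \<gamma>\<bar>"
    by (simp_all flip: of_rat_add)
  then obtain \<rho> where \<rho>_props: "\<rho> > 1" "edge_zero_free (of_rat \<beta>) (of_rat \<gamma>) \<rho>"
    using edge_zero_free_exists[of "of_rat \<gamma>" "of_rat \<beta>"] unfolding of_real_of_rat by blast
  moreover obtain K where "2 * (1 + tail_const \<rho>) < \<rho> ^ K"
    using real_arch_pow[OF \<rho>_props(1)] by blast
  ultimately have "spin_system a g D K \<beta> \<gamma> \<rho>"
    by unfold_locales auto
  then show thesis
    by (rule that)
qed

lemma schemes_if_dominant:
  fixes \<beta> \<gamma> :: rat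
  assumes "\<bar>\<gamma>\<bar> < \<bar>\<beta>\<bar>" "2 < \<bar>\<beta> + \<gamma>\<bar>"
  shows "has_FPTAS (partition_function \<beta> \<gamma>) {G. wf_multigraph G \<and> max_degree_le G \<Delta>}"
    and "has_QPTAS (partition_function \<beta> \<gamma>) {G. wf_multigraph G}"
proof -
  obtain a g D K \<rho> where "spin_system a g D K \<beta> \<gamma> \<rho>"
    using assms by (rule spin_system_exists)
  then interpret spin_system a g D K \<beta> \<gamma> \<rho> .
  show "has_FPTAS (partition_function \<beta> \<gamma>) {G. wf_multigraph G \<and> max_degree_le G \<Delta>}"
    by (rule has_FPTAS_bounded_degree)
  show "has_QPTAS (partition_function \<beta> \<gamma>) {G. wf_multigraph G}"
    by (rule has_QPTAS)
qed

lemma approximates_within_cong: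
  "(\<And>G. G \<in> \<G> \<Longrightarrow> F G = F' G) \<Longrightarrow> approximates_within p F \<G> T \<longleftrightarrow> approximates_within p F' \<G> T"
  by (simp add: approximates_within_def)

lemma has_FPTAS_cong: "(\<And>G. G \<in> \<G> \<Longrightarrow> F G = F' G) \<Longrightarrow> has_FPTAS F \<G> \<longleftrightarrow> has_FPTAS F' \<G>"
  and has_QPTAS_cong: "(\<And>G. G \<in> \<G> \<Longrightarrow> F G = F' G) \<Longrightarrow> has_QPTAS F \<G> \<longleftrightarrow> has_QPTAS F' \<G>"
  by (simp_all add: has_FPTAS_def has_QPTAS_def cong: approximates_within_cong)

lemma schemes_swap:
  assumes "\<G> \<subseteq> {G. wf_multigraph G}"
  shows "has_FPTAS (partition_function \<beta> \<gamma>) \<G> \<longleftrightarrow> has_FPTAS (partition_function \<gamma> \<beta>) \<G>"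
    and "has_QPTAS (partition_function \<beta> \<gamma>) \<G> \<longleftrightarrow> has_QPTAS (partition_function \<gamma> \<beta>) \<G>"
  using assms partition_function_swap by (blast intro!: has_FPTAS_cong has_QPTAS_cong)+

theorem theorem2:
  fixes \<beta> \<gamma> :: rat
  assumes "\<beta> \<noteq> \<gamma>" and "\<bar>\<beta> + \<gamma>\<bar> > 2"
  shows "(\<forall>\<Delta>::nat. \<Delta> > 0 \<longrightarrow>
            has_FPTAS (partition_function \<beta> \<gamma>) {G. wf_multigraph G \<and> max_degree_le G \<Delta>})
         \<and> has_QPTAS (partition_function \<beta> \<gamma>) {G. wf_multigraph G}"
proof -
  have "\<bar>\<beta>\<bar> \<noteq> \<bar>\<gamma>\<bar>"
    using assms by (auto simp: abs_eq_iff)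
  then consider (dominant) "\<bar>\<gamma>\<bar> < \<bar>\<beta>\<bar>" | (dominated) "\<bar>\<beta>\<bar> < \<bar>\<gamma>\<bar>"
    by linarith
  then show ?thesis
  proof cases
    case dominant
    then show ?thesis
      using schemes_if_dominant[OF dominant assms(2)] by blast
  next
    case dominated
    then have "has_FPTAS (partition_function \<beta> \<gamma>) {G. wf_multigraph G \<and> max_degree_le G \<Delta>}"
      "has_QPTAS (partition_function \<beta> \<gamma>) {G. wf_multigraph G}" for \<Delta>
      using schemes_if_dominant[of \<beta> \<gamma>] assms(2) by (subst schemes_swap; auto simp: add.commute)+
    then show ?thesis
      by blast
  qed
qed

end
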